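(* Let $\mathbf{g}$ be a Lorentzian metric on $M$ whose Gauss curvature $K$ is either strictly positive ($\varepsilon=1$) or strictly negative ($\varepsilon=-1$). Let $q=|K|^{-3/4}$. Then the isometric embedding system $\mathcal{I}$ of $(M,\mathbf{g})$ into Minkowski space $\mathbb{R}^{1,2}$ is Darboux integrable if and only if the covariant derivatives of $q$, defined by $dq=q_i\eta^i$ and $dq_i=q_j\eta^j_i+q_{ij}\eta^j$ ($1\le i,j\le2$, summation convention), satisfy $$q_{11}=-q_{22}=3\varepsilon q^{-1/3},\qquad q_{12}=q_{21}=0.$$
   Context: $M$ is a Lorentzian surface with orthonormal frame bundle $\mathcal{F}_M$ (frames $(v_1,v_2)$ with $\langle v_1,v_1\rangle=1$, $\langle v_2,v_2\rangle=-1$, $\langle v_1,v_2\rangle=0$), canonical dual forms $\eta^1,\eta^2$ (so $\mathbf{g}=(\eta^1)^2-(\eta^2)^2$) and connection form $\eta^1_2=\eta^2_1$ satisfying $$d\eta^1=-\eta^1_2\wedge\eta^2,\quad d\eta^2=-\eta^2_1\wedge\eta^1,\quad d\eta^1_2=-K\,\eta^1\wedge\eta^2,$$ which fixes the sign convention for the Gauss curvature $K$; $\eta^1_1=\eta^2_2=0$. Functions on $M$ are pulled back to $\mathcal{F}_M$. $\mathbb{R}^{1,2}$ is $\mathbb{R}^3$ with inner product of signature $(1,2)$. $\mathcal{F}_{\mathbb{R}^{1,2}}$ is the bundle of orthonormal frames $(e_1,e_2,e_3)$ with $\langle e_1,e_1\rangle=1$, $\langle e_2,e_2\rangle=\langle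 e_3,e_3\rangle=-1$, $\langle e_a,e_b\rangle=0$ for $a\ne b$; with basepoint map $\rho$, its canonical and connection forms are defined by $d\rho=e_i\omega^i$, $de_i=e_j\omega^j_i$, so $\omega^1_2=\omega^2_1$, $\omega^1_3=\omega^3_1$, $\omega^3_2=-\omega^2_3$. Isometric embedding system: $\mathcal{I}$ is the Pfaffian exterior differential system on $\mathcal{F}_M\times\mathcal{F}_{\mathbb{R}^{1,2}}$ generated by $$\theta_0=\omega^3,\quad \theta_1=\omega^1-\eta^1,\quad \theta_2=\omega^2-\eta^2,\quad \theta_3=\omega^1_2-\eta^1_2 .$$ Darboux integrability. Put $k=\sqrt{|K|}$. If $K<0$ (hyperbolic case), the singular systems are $V_\pm=\operatorname{span}\{\theta_0,\theta_1,\theta_2,\theta_3,\omega^3_1\mp k\eta^2,\omega^3_2\pm k\eta^1\}$; if $K>0$ (elliptic case), they are the complex subbundle $W=\operatorname{span}_{\mathbb{C}}\{\theta_0,\theta_1,\theta_2,\theta_3,\omega^3_1-\mathrm{i}k\eta^2,\omega^3_2+\mathrm{i}k\eta^1\}$ of the complexified cotangent bundle and its conjugate $\overline{W}$. $\mathcal{I}$ is Darboux integrable if, locally, each of the two singular systems contains a (real, respectively complex) Frobenius subbundle of rank at least $2$ that intersects the span of $\theta_0,\theta_1,\theta_2,\theta_3$ only in $0$. *)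

theory Defs
  imports "HOL-Analysis.Analysis"
begin

section \<open>Smooth maps, forms and tangent spaces in Euclidean spaces\<close>

primrec Ck_on ::
  "nat \<Rightarrow> 'a::real_normed_vector set \<Rightarrow> ('a \<Rightarrow> 'b::real_normed_vector) \<Rightarrow> bool" where
  "Ck_on 0 S f \<longleftrightarrow> continuous_on S f"
| "Ck_on (Suc k) S f \<longleftrightarrow>
     (\<forall>x\<in>S. f differentiable (at x)) \<and>
     (\<forall>v. Ck_on k S (\<lambda>x. frechet_derivative f (at x) v))"

text \<open>Used on open sets of finite-dimensional spaces only, where this is the class
  \<open>C\<^sup>\<infinity>\<close>.\<close>

definition smooth_on ::
  "'a::real_normed_vector set \<Rightarrow> ('a \<Rightarrow> 'b::real_normed_vector) \<Rightarrow> bool" where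
  "smooth_on S f \<longleftrightarrow> (\<forall>k. Ck_on k S f)"

text \<open>Submanifolds \<open>N\<close> are subsets of a Euclidean space \<open>'e\<close>.  Forms on \<open>N\<close> are given by
  forms on an open subset of \<open>'e\<close>, and statements about them only ever evaluate them at points
  of \<open>N\<close> on vectors tangent to \<open>N\<close>.  As the exterior derivative commutes with restriction to
  \<open>N\<close>, computing it in \<open>'e\<close> is legitimate.  The values of the forms lie in \<open>'c\<close>, which is
  the reals or the complex numbers.\<close>

type_synonym ('e, 'c) form1 = "'e \<Rightarrow> 'e \<Rightarrow> 'c"
type_synonym ('e, 'c) form2 = "'e \<Rightarrow> 'e \<Rightarrow> 'e \<Rightarrow> 'c"

definition tangent_space :: "'e::real_normed_vector set \<Rightarrow> 'e \<Rightarrow> 'e set" where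
  "tangent_space N p =
     {v. \<exists>\<gamma>::real \<Rightarrow> 'e. (\<forall>t. \<gamma> t \<in> N) \<and> \<gamma> 0 = p \<and> (\<gamma> has_vector_derivative v) (at 0)}"

definition smooth_form ::
  "'e::real_normed_vector set \<Rightarrow> ('e, 'c::real_normed_vector) form1 \<Rightarrow> bool" where
  "smooth_form U \<alpha> \<longleftrightarrow> (\<forall>p\<in>U. linear (\<alpha> p)) \<and> (\<forall>v. smooth_on U (\<lambda>p. \<alpha> p v))"

definition differential ::
  "('e::real_normed_vector \<Rightarrow> 'c::real_normed_vector) \<Rightarrow> ('e, 'c) form1" where
  "differential f p v = frechet_derivative f (at p) v"

definition ext_d ::
  "('e::real_normed_vector, 'c::real_normed_vector) form1 \<Rightarrow> ('e, 'c) form2" where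
  "ext_d \<alpha> p v w =
     frechet_derivative (\<lambda>y. \<alpha> y w) (at p) v - frechet_derivative (\<lambda>y. \<alpha> y v) (at p) w"

definition wedge :: "('e, 'c::comm_ring) form1 \<Rightarrow> ('e, 'c) form1 \<Rightarrow> ('e, 'c) form2" where
  "wedge \<alpha> \<beta> p v w = \<alpha> p v * \<beta> p w - \<alpha> p w * \<beta> p v"


section \<open>Frobenius subbundles\<close>

text \<open>Near \<open>p\<close>, the subbundle of the (complexified) cotangent bundle of \<open>N\<close> spanned by the
  list of forms \<open>V\<close> contains a subbundle with local frame \<open>\<alpha> 0, \<dots>, \<alpha> (r - 1)\<close>, of rank
  \<open>r \<ge> 2\<close>, which meets the span of \<open>\<Theta>\<close> only in \<open>0\<close> and is Frobenius: each \<open>d (\<alpha> i)\<close>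
  lies in the ideal generated by the \<open>\<alpha> j\<close>.\<close>

definition contains_transverse_Frobenius ::
  "'e::real_normed_vector set \<Rightarrow> ('e, 'c::real_normed_field) form1 list \<Rightarrow>
     ('e, 'c) form1 list \<Rightarrow> 'e \<Rightarrow> bool" where
  "contains_transverse_Frobenius N \<Theta> V p \<longleftrightarrow>
     (\<exists>(r::nat) U \<alpha>. r \<ge> 2 \<and> open U \<and> p \<in> U \<and>
        (\<forall>i<r. smooth_form U (\<alpha> i)) \<and>
        (\<forall>y\<in>N \<inter> U.
           \<comment> \<open>linear independence\<close>
           (\<forall>a. (\<forall>v\<in>tangent_space N y. (\<Sum>i<r. a i * \<alpha> i y v) = 0) \<longrightarrow> (\<forall>i<r. a i = 0)) \<and>
           \<comment> \<open>containment in the span of \<open>V\<close>\<close>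
           (\<forall>i<r. \<exists>a. \<forall>v\<in>tangent_space N y. \<alpha> i y v = (\<Sum>j<length V. a j * (V ! j) y v)) \<and>
           \<comment> \<open>trivial intersection with the span of \<open>\<Theta>\<close>\<close>
           (\<forall>a b. (\<forall>v\<in>tangent_space N y.
                     (\<Sum>i<r. a i * \<alpha> i y v) = (\<Sum>j<length \<Theta>. b j * (\<Theta> ! j) y v)) \<longrightarrow>
                  (\<forall>v\<in>tangent_space N y. (\<Sum>i<r. a i * \<alpha> i y v) = 0)) \<and>
           \<comment> \<open>Frobenius condition\<close>
           (\<forall>i<r. \<exists>\<beta>. (\<forall>j<r. linear (\<beta> j)) \<and>
              (\<forall>v\<in>tangent_space N y. \<forall>w\<in>tangent_space N y.
                 ext_d (\<alpha> i) y v w = (\<Sum>j<r. wedge (\<lambda>_. \<beta> j) (\<alpha> j) y v w)))))"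


section \<open>Lorentzian surfaces\<close>

text \<open>A chart is a domain together with a coordinate map.\<close>

type_synonym 'm chart = "'m set \<times> ('m \<Rightarrow> real^2)"

definition chart_image :: "'m chart \<Rightarrow> (real^2) set" where
  "chart_image c = snd c ` fst c"

definition chart_inv :: "'m chart \<Rightarrow> real^2 \<Rightarrow> 'm" where
  "chart_inv c = inv_into (fst c) (snd c)"

definition overlap :: "'m chart \<Rightarrow> 'm chart \<Rightarrow> (real^2) set" where
  "overlap c c' = snd c ` (fst c \<inter> fst c')"

definition transition :: "'m chart \<Rightarrow> 'm chart \<Rightarrow> real^2 \<Rightarrow> real^2" where
  "transition c c' = snd c' \<circ> chart_inv c"

definition smooth_surface :: "'m topology \<Rightarrow> 'm chart set \<Rightarrow> bool" where
  "smooth_surface X A \<longleftrightarrow>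
     Hausdorff_space X \<and> second_countable X \<and>
     topspace X = (\<Union>c\<in>A. fst c) \<and>
     (\<forall>c\<in>A. openin X (fst c) \<and> open (chart_image c) \<and>
        homeomorphic_map (subtopology X (fst c)) (top_of_set (chart_image c)) (snd c)) \<and>
     (\<forall>c\<in>A. \<forall>c'\<in>A. smooth_on (overlap c c') (transition c c'))"

text \<open>\<open>g c x\<close> is the metric at the point with coordinates \<open>x\<close> in the chart \<open>c\<close>.\<close>

type_synonym 'm metric = "'m chart \<Rightarrow> real^2 \<Rightarrow> real^2 \<Rightarrow> real^2 \<Rightarrow> real"

definition Lorentzian_metric :: "'m chart set \<Rightarrow> 'm metric \<Rightarrow> bool" where
  "Lorentzian_metric A g \<longleftrightarrow>
     (\<forall>c\<in>A.
        (\<forall>x\<in>chart_image c. bilinear (g c x) \<and> (\<forall>u v. g c x u v = g c x v u) \<and>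
           (\<exists>v1 v2. g c x v1 v1 = 1 \<and> g c x v2 v2 = -1 \<and> g c x v1 v2 = 0)) \<and>
        (\<forall>u v. smooth_on (chart_image c) (\<lambda>x. g c x u v))) \<and>
     (\<forall>c\<in>A. \<forall>c'\<in>A. \<forall>x\<in>overlap c c'. \<forall>u v.
        g c x u v = g c' (transition c c' x)
          (frechet_derivative (transition c c') (at x) u)
          (frechet_derivative (transition c c') (at x) v))"

text \<open>The part of the orthonormal frame bundle over the domain of the chart \<open>c\<close>, in the
  coordinates of \<open>c\<close>: a frame \<open>(v\<^sub>1, v\<^sub>2)\<close> at the point with coordinates \<open>x\<close> is the triple
  \<open>(x, v\<^sub>1, v\<^sub>2)\<close>.  These parts are open and cover the frame bundle.\<close>

type_synonym frame2 = "(real^2) \<times> (real^2) \<times> (real^2)"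

definition FM :: "'m metric \<Rightarrow> 'm chart \<Rightarrow> frame2 set" where
  "FM g c = {(x, v1, v2). x \<in> chart_image c \<and>
     g c x v1 v1 = 1 \<and> g c x v2 v2 = -1 \<and> g c x v1 v2 = 0}"

text \<open>An open set of the ambient space of \<open>FM g c\<close> containing it.\<close>

definition FM_ambient :: "'m chart \<Rightarrow> frame2 set" where
  "FM_ambient c = chart_image c \<times> UNIV"

text \<open>The canonical forms are the coefficients in \<open>dx = v\<^sub>1 \<eta>\<^sup>1 + v\<^sub>2 \<eta>\<^sup>2\<close>; as the frame is
  orthonormal of signature \<open>(1,1)\<close>, they are obtained by pairing with \<open>v\<^sub>1\<close> and \<open>- v\<^sub>2\<close>.\<close>

definition eta1 :: "'m metric \<Rightarrow> 'm chart \<Rightarrow> (frame2, real) form1" where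
  "eta1 g c = (\<lambda>(x, v1, v2) (x', v1', v2'). g c x x' v1)"

definition eta2 :: "'m metric \<Rightarrow> 'm chart \<Rightarrow> (frame2, real) form1" where
  "eta2 g c = (\<lambda>(x, v1, v2) (x', v1', v2'). - g c x x' v2)"

text \<open>The connection form \<open>\<eta>\<^sup>1\<^sub>2 = \<eta>\<^sup>2\<^sub>1\<close>; on the frame bundle it is uniquely determined by
  these two structure equations.\<close>

definition connection_form ::
  "'m chart set \<Rightarrow> 'm metric \<Rightarrow> ('m chart \<Rightarrow> (frame2, real) form1) \<Rightarrow> bool" where
  "connection_form A g \<eta>12 \<longleftrightarrow>
     (\<forall>c\<in>A. smooth_form (FM_ambient c) (\<eta>12 c) \<and>
        (\<forall>p\<in>FM g c. \<forall>v\<in>tangent_space (FM g c) p. \<forall>w\<in>tangent_space (FM g c) p.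
           ext_d (eta1 g c) p v w = - wedge (\<eta>12 c) (eta2 g c) p v w \<and>
           ext_d (eta2 g c) p v w = - wedge (\<eta>12 c) (eta1 g c) p v w))"

definition pullback_FM :: "('m \<Rightarrow> real) \<Rightarrow> 'm chart \<Rightarrow> frame2 \<Rightarrow> real" where
  "pullback_FM f c = (\<lambda>(x, v1, v2). f (chart_inv c x))"

text \<open>Smoothness of the curvature follows from the structure equation; it is recorded here for
  convenience.\<close>

definition Gauss_curvature ::
  "'m chart set \<Rightarrow> 'm metric \<Rightarrow> ('m chart \<Rightarrow> (frame2, real) form1) \<Rightarrow> ('m \<Rightarrow> real) \<Rightarrow> bool" where
  "Gauss_curvature A g \<eta>12 K \<longleftrightarrow>
     (\<forall>c\<in>A. smooth_on (chart_image c) (\<lambda>x. K (chart_inv c x)) \<and>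
        (\<forall>p\<in>FM g c. \<forall>v\<in>tangent_space (FM g c) p. \<forall>w\<in>tangent_space (FM g c) p.
           ext_d (\<eta>12 c) p v w = - pullback_FM K c p * wedge (eta1 g c) (eta2 g c) p v w))"

text \<open>\<open>dq = q\<^sub>i \<eta>\<^sup>i\<close> and \<open>dq\<^sub>i = q\<^sub>j \<eta>\<^sup>j\<^sub>i + q\<^sub>i\<^sub>j \<eta>\<^sup>j\<close> on the frame bundle, where
  \<open>\<eta>\<^sup>1\<^sub>1 = \<eta>\<^sup>2\<^sub>2 = 0\<close>.  The equations determine \<open>q\<^sub>i\<close> and \<open>q\<^sub>i\<^sub>j\<close> on the frame bundle; smooth extensions
  to the ambient set always exist, as \<open>q\<^sub>i\<close> and \<open>q\<^sub>i\<^sub>j\<close> are polynomial in the frame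
  \<open>(v\<^sub>1, v\<^sub>2)\<close> with coefficients smooth in \<open>x\<close>.\<close>

definition covariant_derivatives ::
  "'m chart set \<Rightarrow> 'm metric \<Rightarrow> ('m chart \<Rightarrow> (frame2, real) form1) \<Rightarrow> ('m \<Rightarrow> real) \<Rightarrow>
     ('m chart \<Rightarrow> frame2 \<Rightarrow> real) \<Rightarrow> ('m chart \<Rightarrow> frame2 \<Rightarrow> real) \<Rightarrow>
     ('m chart \<Rightarrow> frame2 \<Rightarrow> real) \<Rightarrow> ('m chart \<Rightarrow> frame2 \<Rightarrow> real) \<Rightarrow>
     ('m chart \<Rightarrow> frame2 \<Rightarrow> real) \<Rightarrow> ('m chart \<Rightarrow> frame2 \<Rightarrow> real) \<Rightarrow> bool" where
  "covariant_derivatives A g \<eta>12 q q1 q2 q11 q12 q21 q22 \<longleftrightarrow>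
     (\<forall>c\<in>A. (\<forall>f\<in>{q1, q2, q11, q12, q21, q22}. smooth_on (FM_ambient c) (f c)) \<and>
        (\<forall>p\<in>FM g c. \<forall>v\<in>tangent_space (FM g c) p.
           differential (pullback_FM q c) p v =
             q1 c p * eta1 g c p v + q2 c p * eta2 g c p v \<and>
           differential (q1 c) p v =
             q2 c p * \<eta>12 c p v + q11 c p * eta1 g c p v + q12 c p * eta2 g c p v \<and>
           differential (q2 c) p v =
             q1 c p * \<eta>12 c p v + q21 c p * eta1 g c p v + q22 c p * eta2 g c p v))"


section \<open>Minkowski space\<close>

definition mink :: "real^3 \<Rightarrow> real^3 \<Rightarrow> real" where
  "mink x y = x$1 * y$1 - x$2 * y$2 - x$3 * y$3"

type_synonym frame3 = "(real^3) \<times> (real^3) \<times> (real^3) \<times> (real^3)"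

definition FR :: "frame3 set" where
  "FR = {(x, e1, e2, e3).
     mink e1 e1 = 1 \<and> mink e2 e2 = -1 \<and> mink e3 e3 = -1 \<and>
     mink e1 e2 = 0 \<and> mink e1 e3 = 0 \<and> mink e2 e3 = 0}"

text \<open>The canonical forms \<open>\<omega>\<^sup>i\<close> and connection forms \<open>\<omega>\<^sup>j\<^sub>i\<close> are the coefficients in
  \<open>d\<rho> = e\<^sub>i \<omega>\<^sup>i\<close> and \<open>de\<^sub>i = e\<^sub>j \<omega>\<^sup>j\<^sub>i\<close>, obtained by pairing with \<open>e\<^sub>1\<close>, \<open>- e\<^sub>2\<close>, \<open>- e\<^sub>3\<close>.
  Below \<open>omega31\<close> is \<open>\<omega>\<^sup>3\<^sub>1\<close>, etc.\<close>

definition omega1 :: "(frame3, real) form1" where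
  "omega1 = (\<lambda>(x, e1, e2, e3) (x', e1', e2', e3'). mink x' e1)"

definition omega2 :: "(frame3, real) form1" where
  "omega2 = (\<lambda>(x, e1, e2, e3) (x', e1', e2', e3'). - mink x' e2)"

definition omega3 :: "(frame3, real) form1" where
  "omega3 = (\<lambda>(x, e1, e2, e3) (x', e1', e2', e3'). - mink x' e3)"

definition omega12 :: "(frame3, real) form1" where
  "omega12 = (\<lambda>(x, e1, e2, e3) (x', e1', e2', e3'). mink e2' e1)"

definition omega31 :: "(frame3, real) form1" where
  "omega31 = (\<lambda>(x, e1, e2, e3) (x', e1', e2', e3'). - mink e1' e3)"

definition omega32 :: "(frame3, real) form1" where
  "omega32 = (\<lambda>(x, e1, e2, e3) (x', e1', e2', e3'). - mink e2' e3)"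


section \<open>The isometric embedding system and Darboux integrability\<close>

definition pull_fst :: "('a, 'c) form1 \<Rightarrow> ('a \<times> 'b, 'c) form1" where
  "pull_fst \<alpha> p v = \<alpha> (fst p) (fst v)"

definition pull_snd :: "('b, 'c) form1 \<Rightarrow> ('a \<times> 'b, 'c) form1" where
  "pull_snd \<alpha> p v = \<alpha> (snd p) (snd v)"

text \<open>The generators \<open>\<theta>\<^sub>0, \<theta>\<^sub>1, \<theta>\<^sub>2, \<theta>\<^sub>3\<close> on (the part over \<open>c\<close> of) the product of the two
  frame bundles, as real-valued or complex-valued forms.\<close>

definition embedding_system ::
  "'m metric \<Rightarrow> ('m chart \<Rightarrow> (frame2, real) form1) \<Rightarrow> 'm chart \<Rightarrow>
     (frame2 \<times> frame3, 'c::real_normed_field) form1 list" where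
  "embedding_system g \<eta>12 c =
     [\<lambda>p v. of_real (pull_snd omega3 p v),
      \<lambda>p v. of_real (pull_snd omega1 p v - pull_fst (eta1 g c) p v),
      \<lambda>p v. of_real (pull_snd omega2 p v - pull_fst (eta2 g c) p v),
      \<lambda>p v. of_real (pull_snd omega12 p v - pull_fst (\<eta>12 c) p v)]"

text \<open>With \<open>k = \<surd>|K|\<close>, the forms \<open>\<theta>\<^sub>0, \<dots>, \<theta>\<^sub>3, \<omega>\<^sup>3\<^sub>1 - \<kappa> k \<eta>\<^sup>2, \<omega>\<^sup>3\<^sub>2 + \<kappa> k \<eta>\<^sup>1\<close>.  Their span is
  \<open>V\<^sub>\<plusminus>\<close> for \<open>\<kappa> = \<plusminus>1\<close> and \<open>W\<close> for \<open>\<kappa> = \<i>\<close>.\<close>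

definition singular_system ::
  "'m metric \<Rightarrow> ('m chart \<Rightarrow> (frame2, real) form1) \<Rightarrow> ('m \<Rightarrow> real) \<Rightarrow> 'm chart \<Rightarrow>
     'c \<Rightarrow> (frame2 \<times> frame3, 'c::real_normed_field) form1 list" where
  "singular_system g \<eta>12 K c \<kappa> =
     (let k = (\<lambda>p. sqrt \<bar>pullback_FM K c (fst p)\<bar>) in
      embedding_system g \<eta>12 c @
      [\<lambda>p v. of_real (pull_snd omega31 p v) - \<kappa> * of_real (k p * pull_fst (eta2 g c) p v),
       \<lambda>p v. of_real (pull_snd omega32 p v) + \<kappa> * of_real (k p * pull_fst (eta1 g c) p v)])"

definition conj_system :: "('e, complex) form1 list \<Rightarrow> ('e, complex) form1 list" where
  "conj_system V = map (\<lambda>\<alpha> p v. cnj (\<alpha> p v)) V"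

definition Darboux_hyperbolic ::
  "'m chart set \<Rightarrow> 'm metric \<Rightarrow> ('m chart \<Rightarrow> (frame2, real) form1) \<Rightarrow> ('m \<Rightarrow> real) \<Rightarrow> bool" where
  "Darboux_hyperbolic A g \<eta>12 K \<longleftrightarrow>
     (\<forall>c\<in>A. \<forall>p\<in>FM g c \<times> FR. \<forall>\<kappa>\<in>{1, -1::real}.
        contains_transverse_Frobenius (FM g c \<times> FR)
          (embedding_system g \<eta>12 c) (singular_system g \<eta>12 K c \<kappa>) p)"

definition Darboux_elliptic ::
  "'m chart set \<Rightarrow> 'm metric \<Rightarrow> ('m chart \<Rightarrow> (frame2, real) form1) \<Rightarrow> ('m \<Rightarrow> real) \<Rightarrow> bool" where
  "Darboux_elliptic A g \<eta>12 K \<longleftrightarrow>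
     (\<forall>c\<in>A. \<forall>p\<in>FM g c \<times> FR.
        \<forall>W\<in>{singular_system g \<eta>12 K c \<i>, conj_system (singular_system g \<eta>12 K c \<i>)}.
        contains_transverse_Frobenius (FM g c \<times> FR) (embedding_system g \<eta>12 c) W p)"

definition Darboux_integrable ::
  "'m chart set \<Rightarrow> 'm metric \<Rightarrow> ('m chart \<Rightarrow> (frame2, real) form1) \<Rightarrow> ('m \<Rightarrow> real) \<Rightarrow> bool" where
  "Darboux_integrable A g \<eta>12 K \<longleftrightarrow>
     (\<forall>x\<in>(\<Union>c\<in>A. fst c). K x < 0) \<and> Darboux_hyperbolic A g \<eta>12 K \<or>
     (\<forall>x\<in>(\<Union>c\<in>A. fst c). K x > 0) \<and> Darboux_elliptic A g \<eta>12 K"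

end

theory Submission
  imports Defs
begin

text \<open>
  Write \<open>k = \<surd>|K|\<close>, \<open>q = k\<^sup>-\<^sup>3\<^sup>/\<^sup>2\<close>, and let \<open>\<kappa>\<^sup>2 = - \<epsilon>\<close>, so that both singular systems are spanned
  by the \<open>\<theta>\<^sub>i\<close> and \<open>\<pi>\<^sub>1 = \<omega>\<^sup>3\<^sub>1 - \<kappa> k \<eta>\<^sup>2\<close>, \<open>\<pi>\<^sub>2 = \<omega>\<^sup>3\<^sub>2 + \<kappa> k \<eta>\<^sup>1\<close>; the real and the complex case are treated
  simultaneously.  A transverse Frobenius subbundle has rank 2 and a basis
  \<open>\<alpha>\<^sub>1 = \<pi>\<^sub>1 + \<Sum> a\<^sub>i \<theta>\<^sub>i\<close>, \<open>\<alpha>\<^sub>2 = \<pi>\<^sub>2 + \<Sum> b\<^sub>i \<theta>\<^sub>i\<close>.  Let \<open>dk = 2 k (A \<eta>\<^sup>1 + B \<eta>\<^sup>2)\<close> and let \<open>Z\<^sub>1\<close>, \<open>Z\<^sub>2\<close> be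
  the vector fields dual to \<open>\<eta>\<^sup>1\<close>, \<open>\<eta>\<^sup>2\<close> in the coframe \<open>\<theta>\<^sub>i, \<eta>\<^sup>1, \<eta>\<^sup>2, \<eta>\<^sup>1\<^sub>2, \<alpha>\<^sub>1, \<alpha>\<^sub>2\<close>.  Evaluating \<open>d\<alpha>\<^sub>i\<close> on
  \<open>Z\<^sub>1, Z\<^sub>2\<close> gives \<open>A = a\<^sub>0 - \<kappa> k a\<^sub>3\<close> and \<open>B = b\<^sub>0 - \<kappa> k b\<^sub>3\<close>, and evaluating it on \<open>Z\<^sub>m\<close> and the
  fields dual to the \<open>\<theta>\<^sub>j\<close> gives the derivatives of all \<open>a\<^sub>j\<close>, \<open>b\<^sub>j\<close> along \<open>Z\<^sub>1\<close> and \<open>Z\<^sub>2\<close>.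
  Comparing \<open>Z\<^sub>2 A\<close> with \<open>Z\<^sub>1 B\<close> gives an algebraic relation between the \<open>a\<^sub>j\<close>, \<open>b\<^sub>j\<close>; differentiating it
  twice forces \<open>a\<^sub>0 = a\<^sub>1 = a\<^sub>2 = b\<^sub>0 = b\<^sub>1 = b\<^sub>2 = 0\<close>, after which the formulas for \<open>Z\<^sub>i A\<close> and \<open>Z\<^sub>i B\<close> are
  the condition on \<open>q\<close>.  Conversely, under the condition the forms
  \<open>\<pi>\<^sub>1 - (A / \<kappa> k) \<theta>\<^sub>3\<close> and \<open>\<pi>\<^sub>2 - (B / \<kappa> k) \<theta>\<^sub>3\<close> span a Frobenius bundle.
\<close>

section \<open>Calculus on open sets\<close>

text \<open>All relations hold only on the manifold \<open>N\<close>, which is not open in the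
  ambient space, so they are differentiated along tangent vectors only. The argument terminates
  because every derivative of a coefficient along \<open>Z1\<close>, \<open>Z2\<close> is again a
  polynomial in the coefficients, \<open>k\<close>, \<open>A\<close> and \<open>B\<close>: each
  algebraic relation yields new ones, and no second derivatives of the coefficients occur. The first
  relation stems from the symmetry of the second covariant derivatives of \<open>q\<close>. The
  unknown 1-forms of the Frobenius condition disappear, since their values on \<open>Z1\<close>,
  \<open>Z2\<close> are values of \<open>d \<alpha>\<close> against the fields dual to \<alpha>1 and
  \<alpha>2. The exponent -3/4 is explained by the outcome Z1 A = 3 A^2 - \<epsilon> k^2 and its
  companions, with k = sqrt |K|: as A = - q_1 / (3 q), the derivative of A contains the same term 3
  A^2, and what remains is q_11 = 3 \<epsilon> q k^2 = 3 \<epsilon> q^(-1/3).\<close>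

lemma differential_eqI: "(f has_derivative f') (at p) \<Longrightarrow> differential f p = f'"
  unfolding differential_def by (metis frechet_derivative_at)

lemma has_derivative_differential:
  "f differentiable (at p) \<Longrightarrow> (f has_derivative differential f p) (at p)"
  unfolding differential_def by (simp add: frechet_derivative_works[symmetric])

lemma linear_differential: "f differentiable (at p) \<Longrightarrow> linear (differential f p)"
  using has_derivative_differential has_derivative_linear by blast

lemma differential_bounded_linear: "bounded_linear f \<Longrightarrow> differential f p v = f v"
  by (metis differential_eqI bounded_linear_imp_has_derivative)

lemma differential_const [simp]: "differential (\<lambda>x. a) p v = 0"
  by (simp add: differential_eqI[OF has_derivative_const])

lemma differential_add:
  "f differentiable (at p) \<Longrightarrow> h differentiable (at p) \<Longrightarrow>
   differential (\<lambda>x. f x + h x) p v = differential f p v + differential h p v"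
  by (rule fun_cong[OF differential_eqI, of _ _ _ v])
    (intro has_derivative_add has_derivative_differential)

lemma differential_diff:
  "f differentiable (at p) \<Longrightarrow> h differentiable (at p) \<Longrightarrow>
   differential (\<lambda>x. f x - h x) p v = differential f p v - differential h p v"
  by (rule fun_cong[OF differential_eqI, of _ _ _ v])
    (intro has_derivative_diff has_derivative_differential)

lemma differential_minus:
  "f differentiable (at p) \<Longrightarrow> differential (\<lambda>x. - f x) p v = - differential f p v"
  by (rule fun_cong[OF differential_eqI, of _ _ _ v])
    (intro has_derivative_minus has_derivative_differential)

lemma differential_mult:
  fixes f h :: "'e::real_normed_vector \<Rightarrow> 'c::real_normed_algebra"
  shows "f differentiable (at p) \<Longrightarrow> h differentiable (at p) \<Longrightarrow>
   differential (\<lambda>x. f x * h x) p v = f p * differential h p v + differential f p v * h p"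
  by (rule fun_cong[OF differential_eqI, of _ _ _ v])
    (intro has_derivative_mult has_derivative_differential)

lemma differential_compose_bounded_linear:
  "bounded_linear L \<Longrightarrow> f differentiable (at p) \<Longrightarrow>
   differential (\<lambda>x. L (f x)) p v = L (differential f p v)"
  by (rule fun_cong[OF differential_eqI, of _ _ _ v])
    (rule bounded_linear.has_derivative[OF _ has_derivative_differential])

lemma differential_precompose_bounded_linear:
  assumes L: "bounded_linear L" and f: "f differentiable (at (L p))"
  shows "(\<lambda>x. f (L x)) differentiable (at p)"
    and "differential (\<lambda>x. f (L x)) p v = differential f (L p) (L v)"
proof -
  have "((\<lambda>x. f (L x)) has_derivative (\<lambda>v. differential f (L p) (L v))) (at p)"
    using has_derivative_compose[OF bounded_linear_imp_has_derivative[OF L]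
        has_derivative_differential[OF f]] .
  then show "(\<lambda>x. f (L x)) differentiable (at p)"
    and "differential (\<lambda>x. f (L x)) p v = differential f (L p) (L v)"
    by (auto simp: differentiable_def differential_eqI)
qed

lemma differential_cong_open:
  assumes "open S" "p \<in> S" "\<And>x. x \<in> S \<Longrightarrow> f x = h x"
  shows "differential f p = differential h p"
proof -
  have "(f has_derivative D) (at p) = (h has_derivative D) (at p)" for D
    using assms by (metis has_derivative_transform_within_open)
  then show ?thesis
    by (simp add: differential_def[abs_def] frechet_derivative_def)
qed

lemma differentiable_compose_bounded_linear:
  "bounded_linear L \<Longrightarrow> f differentiable (at p) \<Longrightarrow> (\<lambda>x. L (f x)) differentiable (at p)"
  unfolding differentiable_def using bounded_linear.has_derivative by blast

lemma differentiable_of_real: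
  "f differentiable (at p) \<Longrightarrow> (\<lambda>x. of_real (f x)) differentiable (at p)"
  by (rule differentiable_compose_bounded_linear[OF bounded_linear_of_real])

lemma differentiable_fst:
  assumes "f differentiable (at (fst p))"
  shows "(\<lambda>x. f (fst x)) differentiable (at p)"
  by (rule differential_precompose_bounded_linear(1)[OF bounded_linear_fst assms])

subsection \<open>Smooth maps\<close>

text \<open>On an open set equality of functions passes to their derivatives, which drives the
  induction. Derivative formulas are valid on \<open>S\<close> only, so every closure property below
  ends with this transfer.\<close>

lemma Ck_on_cong:
  assumes "open S" "\<And>x. x \<in> S \<Longrightarrow> f x = h x" "Ck_on k S f"
  shows "Ck_on k S h"
  using assms(2,3)
proof (induction k arbitrary: f h)
  case 0
  then show ?case by (metis Ck_on.simps(1) continuous_on_cong)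
next
  case (Suc k)
  have eq: "frechet_derivative f (at x) v = frechet_derivative h (at x) v" if "x \<in> S" for x v
    using differential_cong_open[OF assms(1) that, of f h] Suc.prems(1)
    by (simp add: differential_def fun_eq_iff)
  have "h differentiable (at x)" if "x \<in> S" for x
  proof -
    obtain D where "(f has_derivative D) (at x)"
      using Suc.prems(2) \<open>x \<in> S\<close> by (auto simp: differentiable_def)
    then have "(h has_derivative D) (at x)"
      using has_derivative_transform_within_open[of f D x UNIV S h] assms(1) \<open>x \<in> S\<close> Suc.prems(1)
      by blast
    then show ?thesis by (auto simp: differentiable_def)
  qed
  moreover have "Ck_on k S (\<lambda>x. frechet_derivative h (at x) v)" for v
    by (rule Suc.IH[OF eq]) (use Suc.prems(2) in auto)
  ultimately show ?case by simp
qed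

text \<open>\<open>Ck_on\<close> demands continuity only at the last order; the lower orders get it
  from differentiability. The product rule needs this for its undifferentiated factor.\<close>

lemma Ck_on_Suc_imp: "Ck_on (Suc k) S f \<Longrightarrow> Ck_on k S f"
proof (induction k arbitrary: f)
  case 0
  then show ?case
    by (auto intro!: continuous_at_imp_continuous_on differentiable_imp_continuous_within)
next
  case (Suc k)
  then show ?case by (metis Ck_on.simps(2))
qed

lemma Ck_on_const: "Ck_on k S (\<lambda>x. a)"
  by (induction k arbitrary: a) auto

lemma Ck_on_bounded_linear:
  assumes "bounded_linear L"
  shows "Ck_on k S L"
proof (cases k)
  case 0
  then show ?thesis using assms by (simp add: linear_continuous_on)
next
  case (Suc n)
  have "frechet_derivative L (at x) v = L v" for x v
    using differential_bounded_linear[OF assms] by (simp add: differential_def)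
  then show ?thesis
    using Suc assms by (auto simp: Ck_on_const bounded_linear_imp_differentiable)
qed

lemma Ck_on_add:
  assumes "open S"
  shows "Ck_on k S f \<Longrightarrow> Ck_on k S h \<Longrightarrow> Ck_on k S (\<lambda>x. f x + h x)"
proof (induction k arbitrary: f h)
  case 0
  then show ?case by (auto intro: continuous_on_add)
next
  case (Suc k)
  have "Ck_on k S (\<lambda>x. frechet_derivative f (at x) v + frechet_derivative h (at x) v)" for v
    using Suc.prems by (intro Suc.IH) auto
  then have "Ck_on k S (\<lambda>x. frechet_derivative (\<lambda>x. f x + h x) (at x) v)" for v
    using Suc.prems
    by (rule_tac Ck_on_cong[OF assms]) (auto simp: differential_add[unfolded differential_def])
  then show ?case using Suc.prems by auto
qed

lemma Ck_on_mult:
  fixes f h :: "'e::real_normed_vector \<Rightarrow> 'c::real_normed_algebra"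
  assumes "open S"
  shows "Ck_on k S f \<Longrightarrow> Ck_on k S h \<Longrightarrow> Ck_on k S (\<lambda>x. f x * h x)"
proof (induction k arbitrary: f h)
  case 0
  then show ?case by (auto intro: continuous_on_mult)
next
  case (Suc k)
  have "Ck_on k S (\<lambda>x. f x * frechet_derivative h (at x) v + frechet_derivative f (at x) v * h x)"
    for v
    using Suc.prems Suc.prems[THEN Ck_on_Suc_imp] by (intro Ck_on_add assms Suc.IH) simp_all
  then have "Ck_on k S (\<lambda>x. frechet_derivative (\<lambda>x. f x * h x) (at x) v)" for v
    using Suc.prems
    by (rule_tac Ck_on_cong[OF assms]) (auto simp: differential_mult[unfolded differential_def])
  then show ?case using Suc.prems by auto
qed

lemma Ck_on_compose_bounded_linear:
  assumes "open S" and L: "bounded_linear L"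
  shows "Ck_on k S f \<Longrightarrow> Ck_on k S (\<lambda>x. L (f x))"
proof (induction k arbitrary: f)
  case 0
  then show ?case using L by (auto intro: bounded_linear.continuous_on)
next
  case (Suc k)
  have "Ck_on k S (\<lambda>x. L (frechet_derivative f (at x) v))" for v
    using Suc.prems by (intro Suc.IH) auto
  then have "Ck_on k S (\<lambda>x. frechet_derivative (\<lambda>x. L (f x)) (at x) v)" for v
    using Suc.prems
    by (rule_tac Ck_on_cong[OF assms(1)])
      (auto simp: differential_compose_bounded_linear[OF L, unfolded differential_def])
  then show ?case using Suc.prems L by (simp add: differentiable_compose_bounded_linear)
qed

lemma Ck_on_precompose_bounded_linear:
  assumes "open T" and L: "bounded_linear L" and LT: "\<And>x. x \<in> T \<Longrightarrow> L x \<in> S"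
  shows "Ck_on k S f \<Longrightarrow> Ck_on k T (\<lambda>x. f (L x))"
proof (induction k arbitrary: f)
  case 0
  then show ?case
    using LT linear_continuous_on[OF L, of T] by (auto intro!: continuous_on_compose2[of S f])
next
  case (Suc k)
  have "Ck_on k T (\<lambda>x. frechet_derivative f (at (L x)) (L v))" for v
    using Suc.prems by (intro Suc.IH[of "\<lambda>x. frechet_derivative f (at x) (L v)"]) auto
  then have "Ck_on k T (\<lambda>x. frechet_derivative (\<lambda>x. f (L x)) (at x) v)" for v
    using Suc.prems LT
    by (rule_tac Ck_on_cong[OF assms(1)])
      (auto simp: differential_precompose_bounded_linear[OF L, unfolded differential_def])
  then show ?case using Suc.prems LT by (simp add: differential_precompose_bounded_linear(1)[OF L])
qed

text \<open>The exponent is kept arbitrary in the induction because differentiation lowers it by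
  one.\<close>

lemma Ck_on_powr:
  fixes f :: "'e::real_normed_vector \<Rightarrow> real"
  assumes "open S" and pos: "\<And>x. x \<in> S \<Longrightarrow> f x > 0"
  shows "Ck_on k S f \<Longrightarrow> Ck_on k S (\<lambda>x. f x powr s)"
proof (induction k arbitrary: s)
  case 0
  then show ?case using pos by (auto intro!: continuous_on_powr continuous_on_const) (metis less_irrefl)
next
  case (Suc k)
  have D: "((\<lambda>x. f x powr s) has_derivative
      (\<lambda>v. s * f x powr (s - 1) * frechet_derivative f (at x) v)) (at x)" if "x \<in> S" for x
  proof -
    have "(f has_derivative frechet_derivative f (at x)) (at x)"
      using Suc.prems that by (simp add: frechet_derivative_works[symmetric])
    then have "((\<lambda>x. f x powr s) has_derivative
      (\<lambda>v. f x powr s * (0 * ln (f x) + frechet_derivative f (at x) v * s / f x))) (at x)"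
      using pos[OF that] by (intro has_derivative_powr) auto
    then show ?thesis
      using pos[OF that] by (simp add: powr_diff mult_ac)
  qed
  have "Ck_on k S (\<lambda>x. f x powr (s - 1))"
    by (rule Suc.IH[OF Ck_on_Suc_imp[OF Suc.prems]])
  then have *: "Ck_on k S (\<lambda>x. s * f x powr (s - 1) * frechet_derivative f (at x) v)" for v
    using Suc.prems by (intro Ck_on_mult[OF assms(1)] Ck_on_const) auto
  have "Ck_on k S (\<lambda>x. frechet_derivative (\<lambda>x. f x powr s) (at x) v)" for v
    by (rule Ck_on_cong[OF assms(1) _ *[of v]]) (simp add: frechet_derivative_at[OF D, symmetric])
  moreover have "(\<lambda>x. f x powr s) differentiable (at x)" if "x \<in> S" for x
    using D[OF that] unfolding differentiable_def by blast
  ultimately show ?case by simp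
qed

lemma smooth_on_differentiable: "smooth_on S f \<Longrightarrow> x \<in> S \<Longrightarrow> f differentiable (at x)"
  by (auto simp: smooth_on_def dest!: spec[of _ "Suc 0"])

lemma smooth_on_differential: "smooth_on S f \<Longrightarrow> smooth_on S (\<lambda>x. differential f x v)"
  unfolding smooth_on_def differential_def
proof
  fix k assume "\<forall>k. Ck_on k S f"
  then have "Ck_on (Suc k) S f" by blast
  then show "Ck_on k S (\<lambda>x. frechet_derivative f (at x) v)" by simp
qed

lemma smooth_on_cong: "open S \<Longrightarrow> (\<And>x. x \<in> S \<Longrightarrow> f x = h x) \<Longrightarrow> smooth_on S f \<Longrightarrow> smooth_on S h"
  by (simp add: smooth_on_def Ck_on_cong[of S f h])

lemma smooth_on_const: "smooth_on S (\<lambda>x. a)"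
  by (simp add: smooth_on_def Ck_on_const)

lemma smooth_on_bounded_linear: "bounded_linear f \<Longrightarrow> smooth_on S f"
  by (simp add: smooth_on_def Ck_on_bounded_linear)

lemma smooth_on_add:
  "open S \<Longrightarrow> smooth_on S f \<Longrightarrow> smooth_on S h \<Longrightarrow> smooth_on S (\<lambda>x. f x + h x)"
  by (simp add: smooth_on_def Ck_on_add)

lemma smooth_on_mult:
  fixes f h :: "'e::real_normed_vector \<Rightarrow> 'c::real_normed_algebra"
  shows "open S \<Longrightarrow> smooth_on S f \<Longrightarrow> smooth_on S h \<Longrightarrow> smooth_on S (\<lambda>x. f x * h x)"
  by (simp add: smooth_on_def Ck_on_mult)

lemma smooth_on_compose_bounded_linear:
  "open S \<Longrightarrow> bounded_linear L \<Longrightarrow> smooth_on S f \<Longrightarrow> smooth_on S (\<lambda>x. L (f x))"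
  by (simp add: smooth_on_def Ck_on_compose_bounded_linear)

lemma smooth_on_precompose_bounded_linear:
  "open T \<Longrightarrow> bounded_linear L \<Longrightarrow> (\<And>x. x \<in> T \<Longrightarrow> L x \<in> S) \<Longrightarrow> smooth_on S f \<Longrightarrow>
   smooth_on T (\<lambda>x. f (L x))"
  using Ck_on_precompose_bounded_linear[of T L S _ f] by (simp add: smooth_on_def)

lemma smooth_on_powr:
  "open S \<Longrightarrow> (\<And>x. x \<in> S \<Longrightarrow> f x > 0) \<Longrightarrow> smooth_on S f \<Longrightarrow> smooth_on S (\<lambda>x. f x powr s :: real)"
  by (simp add: smooth_on_def Ck_on_powr)

lemma smooth_on_minus: "open S \<Longrightarrow> smooth_on S f \<Longrightarrow> smooth_on S (\<lambda>x. - f x)"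
  using smooth_on_compose_bounded_linear[OF _ bounded_linear_minus[OF bounded_linear_ident]]
  by blast

lemma smooth_on_diff:
  "open S \<Longrightarrow> smooth_on S f \<Longrightarrow> smooth_on S h \<Longrightarrow> smooth_on S (\<lambda>x. f x - h x)"
  using smooth_on_add[OF _ _ smooth_on_minus] by fastforce

subsection \<open>Symmetry of second derivatives\<close>

text \<open>The mean value theorem in direction \<open>v\<close> turns the second difference into a
  difference of two values of the \<open>v\<close>-derivative, and the first-order expansion of that
  derivative at \<open>p\<close> produces its derivative along \<open>w\<close>.\<close>

lemma second_difference_estimate:
  fixes f :: "'e::real_normed_vector \<Rightarrow> real"
  assumes "open U" "p \<in> U" and f: "\<And>x. x \<in> U \<Longrightarrow> f differentiable (at x)"
    and G: "(\<lambda>x. differential f x v) differentiable (at p)" and e: "e > 0"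
  shows "\<exists>d>0. \<forall>h. 0 < h \<and> h < d \<longrightarrow>
    \<bar>(f (p + h *\<^sub>R v + h *\<^sub>R w) - f (p + h *\<^sub>R v) - f (p + h *\<^sub>R w) + f p) / h^2
      - differential (\<lambda>x. differential f x v) p w\<bar> \<le> e"
proof -
  define G where "G = (\<lambda>x. differential f x v)"
  define G' where "G' = differential G p"
  \<comment> \<open>The expansion is used at z v + h w and at z v with z < h; the two errors
    together are at most e / M times h (2 |v| + |w|). The summand 1 keeps \<open>M\<close>
    positive.\<close>
  define M where "M = 2 * norm v + norm w + 1"
  have M: "M > 0" unfolding M_def by (smt (verit) norm_ge_zero)
  have GD: "(G has_derivative G') (at p)"
    unfolding G'_def using G has_derivative_differential[of G p] by (simp add: G_def)
  obtain d1 where d1: "d1 > 0" "\<And>z. norm (z - p) < d1 \<Longrightarrow>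
      norm (G z - G p - G' (z - p)) \<le> e / M * norm (z - p)"
    using GD e M unfolding has_derivative_at_alt by (meson divide_pos_pos)
  obtain d2 where d2: "d2 > 0" "\<And>z. dist z p < d2 \<Longrightarrow> z \<in> U"
    using assms(1,2) unfolding open_dist by blast
  have G'lin: "linear G'" using GD has_derivative_linear by blast
  define d where "d = min d1 d2 / M"
  have "d > 0" using d1 d2 M by (simp add: d_def)
  moreover have "\<bar>(f (p + h *\<^sub>R v + h *\<^sub>R w) - f (p + h *\<^sub>R v) - f (p + h *\<^sub>R w) + f p) / h^2
      - G' w\<bar> \<le> e" if h: "0 < h" "h < d" for h
  proof -
    have hM: "h * M < min d1 d2" using h M by (simp add: d_def pos_less_divide_eq)
    have small: "norm (s *\<^sub>R v + t *\<^sub>R w) \<le> h * (norm v + norm w)"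
      if "0 \<le> s" "s \<le> h" "0 \<le> t" "t \<le> h" for s t
    proof -
      have "norm (s *\<^sub>R v + t *\<^sub>R w) \<le> s * norm v + t * norm w"
        using that norm_triangle_ineq[of "s *\<^sub>R v" "t *\<^sub>R w"] by simp
      also have "\<dots> \<le> h * norm v + h * norm w"
        using that by (intro add_mono mult_right_mono) auto
      finally show ?thesis by (simp add: algebra_simps)
    qed
    have less: "h * (norm v + norm w) < min d1 d2"
    proof -
      have "h * (norm v + norm w) \<le> h * M"
        using h by (intro mult_left_mono) (auto simp: M_def)
      then show ?thesis using hM by linarith
    qed
    have inU: "p + s *\<^sub>R v + t *\<^sub>R w \<in> U" if "0 \<le> s" "s \<le> h" "0 \<le> t" "t \<le> h" for s t
      using small[OF that] less d2(2)[of "p + s *\<^sub>R v + t *\<^sub>R w"] by (simp add: dist_norm add.assoc)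
    have der: "((\<lambda>s. f (p + s *\<^sub>R v + t *\<^sub>R w)) has_field_derivative G (p + s *\<^sub>R v + t *\<^sub>R w)) (at s)"
      if "0 \<le> s" "s \<le> h" "0 \<le> t" "t \<le> h" for s t
    proof -
      let ?q = "p + s *\<^sub>R v + t *\<^sub>R w"
      have a: "((\<lambda>s. p + s *\<^sub>R v + t *\<^sub>R w) has_derivative (\<lambda>s. s *\<^sub>R v)) (at s)"
        by (auto intro!: derivative_eq_intros)
      have b: "(f has_derivative differential f ?q) (at ?q)"
        using f[OF inU[OF that]] by (rule has_derivative_differential)
      have "((\<lambda>s. f (p + s *\<^sub>R v + t *\<^sub>R w)) has_derivative (\<lambda>s. differential f ?q (s *\<^sub>R v))) (at s)"
        using has_derivative_compose[OF a b] .
      moreover have "differential f ?q (s *\<^sub>R v) = G ?q * s" for s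
        using linear_differential[OF f[OF inU[OF that]]] by (simp add: G_def linear_cmul)
      ultimately show ?thesis by (simp add: has_field_derivative_def)
    qed
    \<comment> \<open>The second difference is \<open>g h - g 0\<close>. The vanishing summand is
      kept so that \<open>der\<close> applies with t = 0.\<close>
    define g where "g = (\<lambda>s. f (p + s *\<^sub>R v + h *\<^sub>R w) - f (p + s *\<^sub>R v + 0 *\<^sub>R w))"
    have "(g has_field_derivative (G (p + s *\<^sub>R v + h *\<^sub>R w) - G (p + s *\<^sub>R v + 0 *\<^sub>R w))) (at s)"
      if "0 \<le> s" "s \<le> h" for s
      unfolding g_def using that h by (intro DERIV_diff der) auto
    then obtain z where z: "0 < z" "z < h"
      "g h - g 0 = (h - 0) * (G (p + z *\<^sub>R v + h *\<^sub>R w) - G (p + z *\<^sub>R v + 0 *\<^sub>R w))"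
      using MVT2[OF h(1), of g "\<lambda>s. G (p + s *\<^sub>R v + h *\<^sub>R w) - G (p + s *\<^sub>R v + 0 *\<^sub>R w)"] by blast
    have est: "\<bar>G (p + z *\<^sub>R v + t *\<^sub>R w) - G p - G' (z *\<^sub>R v + t *\<^sub>R w)\<bar>
        \<le> e / M * norm (z *\<^sub>R v + t *\<^sub>R w)"
      if "0 \<le> t" "t \<le> h" for t
      using d1(2)[of "p + z *\<^sub>R v + t *\<^sub>R w"] small[of z t] that z less by (simp add: add.assoc)
    have "G' (z *\<^sub>R v + h *\<^sub>R w) - G' (z *\<^sub>R v) = h * G' w"
      using G'lin by (simp add: linear_add linear_cmul)
    then have "\<bar>(G (p + z *\<^sub>R v + h *\<^sub>R w) - G (p + z *\<^sub>R v + 0 *\<^sub>R w)) - h * G' w\<bar>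
      \<le> e / M * norm (z *\<^sub>R v + h *\<^sub>R w) + e / M * norm (z *\<^sub>R v)"
      using est[of h] est[of 0] h by simp
    also have "\<dots> \<le> e / M * (h * (norm v + norm w)) + e / M * (h * norm v)"
      using small[of z h] z h e M by (intro add_mono mult_left_mono) (auto intro: mult_right_mono)
    also have "\<dots> \<le> e / M * (h * M)"
    proof -
      have "h * (norm v + norm w) + h * norm v \<le> h * M"
        using h by (simp add: M_def algebra_simps)
      then have "e / M * (h * (norm v + norm w) + h * norm v) \<le> e / M * (h * M)"
        using e M by (intro mult_left_mono) auto
      then show ?thesis by (simp add: algebra_simps)
    qed
    also have "\<dots> = e * h" using M by simp
    finally have fin: "\<bar>(G (p + z *\<^sub>R v + h *\<^sub>R w) - G (p + z *\<^sub>R v + 0 *\<^sub>R w)) - h * G' w\<bar> \<le> e * h" .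
    define D where "D = G (p + z *\<^sub>R v + h *\<^sub>R w) - G (p + z *\<^sub>R v + 0 *\<^sub>R w)"
    have "f (p + h *\<^sub>R v + h *\<^sub>R w) - f (p + h *\<^sub>R v) - f (p + h *\<^sub>R w) + f p = h * D"
      using z(3) by (simp add: g_def D_def)
    then have "(f (p + h *\<^sub>R v + h *\<^sub>R w) - f (p + h *\<^sub>R v) - f (p + h *\<^sub>R w) + f p) / h^2 - G' w
       = (D - h * G' w) / h"
      using h by (simp add: field_simps power2_eq_square)
    moreover have "\<bar>(D - h * G' w) / h\<bar> \<le> e"
      using fin h by (simp add: D_def abs_divide pos_divide_le_eq)
    ultimately show ?thesis by simp
  qed
  ultimately show ?thesis unfolding G'_def G_def by blast
qed

text \<open>The second difference is symmetric in \<open>v\<close> and \<open>w\<close> and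
  approximates both mixed derivatives. Two distinct numbers cannot both be within a third of their
  distance from the same quotient.\<close>

lemma differential_symmetric:
  fixes f :: "'e::real_normed_vector \<Rightarrow> real"
  assumes "open U" "p \<in> U" and f: "\<And>x. x \<in> U \<Longrightarrow> f differentiable (at x)"
    and "(\<lambda>x. differential f x v) differentiable (at p)"
    and "(\<lambda>x. differential f x w) differentiable (at p)"
  shows "differential (\<lambda>x. differential f x v) p w = differential (\<lambda>x. differential f x w) p v"
proof (rule ccontr)
  let ?a = "differential (\<lambda>x. differential f x v) p w"
  let ?b = "differential (\<lambda>x. differential f x w) p v"
  assume "?a \<noteq> ?b"
  then have e: "\<bar>?a - ?b\<bar> / 3 > 0" by simp
  obtain d where d: "d > 0" "\<And>h. 0 < h \<and> h < d \<Longrightarrow>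
    \<bar>(f (p + h *\<^sub>R v + h *\<^sub>R w) - f (p + h *\<^sub>R v) - f (p + h *\<^sub>R w) + f p) / h^2 - ?a\<bar> \<le> \<bar>?a - ?b\<bar> / 3"
    using second_difference_estimate[OF assms(1-4) e, of w] by blast
  obtain d' where d': "d' > 0" "\<And>h. 0 < h \<and> h < d' \<Longrightarrow>
    \<bar>(f (p + h *\<^sub>R w + h *\<^sub>R v) - f (p + h *\<^sub>R w) - f (p + h *\<^sub>R v) + f p) / h^2 - ?b\<bar> \<le> \<bar>?a - ?b\<bar> / 3"
    using second_difference_estimate[OF assms(1-3,5) e, of v] by blast
  define h where "h = min d d' / 2"
  have h: "0 < h" "h < d" "h < d'" using d(1) d'(1) by (auto simp: h_def)
  define Q where
    "Q = (f (p + h *\<^sub>R v + h *\<^sub>R w) - f (p + h *\<^sub>R v) - f (p + h *\<^sub>R w) + f p) / h^2"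
  have c: "p + h *\<^sub>R w + h *\<^sub>R v = p + h *\<^sub>R v + h *\<^sub>R w" by simp
  have "(f (p + h *\<^sub>R w + h *\<^sub>R v) - f (p + h *\<^sub>R w) - f (p + h *\<^sub>R v) + f p) / h^2 = Q"
    unfolding Q_def c by (rule arg_cong[of _ _ "\<lambda>x. x / h^2"]) linarith
  then have "\<bar>Q - ?a\<bar> \<le> \<bar>?a - ?b\<bar> / 3" "\<bar>Q - ?b\<bar> \<le> \<bar>?a - ?b\<bar> / 3"
    using d(2)[of h, folded Q_def] d'(2)[of h] h by simp_all
  moreover have "a = b" if "\<bar>Q - a\<bar> \<le> \<bar>a - b\<bar> / 3" "\<bar>Q - b\<bar> \<le> \<bar>a - b\<bar> / 3" for a b :: real
    using that by (auto simp: abs_if field_simps split: if_splits)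
  ultimately show False using \<open>?a \<noteq> ?b\<close> by blast
qed

section \<open>Forms along vector fields\<close>

lemma ext_d_differential:
  "ext_d \<alpha> p v w = differential (\<lambda>y. \<alpha> y w) p v - differential (\<lambda>y. \<alpha> y v) p w"
  by (simp add: ext_d_def differential_def)

definition lie_bracket :: "('e::real_normed_vector \<Rightarrow> 'e) \<Rightarrow> ('e \<Rightarrow> 'e) \<Rightarrow> 'e \<Rightarrow> 'e" where
  "lie_bracket X Y p = differential Y p (X p) - differential X p (Y p)"

text \<open>A form is known to be differentiable only with a fixed vector inserted. Expanding the
  vector in the finite basis reduces the product rule to that case.\<close>

lemma has_derivative_form_field:
  fixes B :: "'e::real_normed_vector \<Rightarrow> 'f::euclidean_space \<Rightarrow> 'c::real_normed_vector"
  assumes U: "open U" "p \<in> U" and lin: "\<And>y. y \<in> U \<Longrightarrow> linear (B y)"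
    and B: "\<And>v. (\<lambda>y. B y v) differentiable (at p)" and X: "X differentiable (at p)"
  shows "((\<lambda>y. B y (X y)) has_derivative
    (\<lambda>h. differential (\<lambda>y. B y (X p)) p h + B p (differential X p h))) (at p)"
proof -
  have expand: "B y u = (\<Sum>b\<in>Basis. (u \<bullet> b) *\<^sub>R B y b)" if "y \<in> U" for y u
    using lin[OF that] by (subst euclidean_representation[of u, symmetric])
      (simp add: linear_sum linear_scale)
  have Xb: "((\<lambda>y. X y \<bullet> b) has_derivative (\<lambda>h. differential X p h \<bullet> b)) (at p)" for b
    by (intro has_derivative_inner_left has_derivative_differential X)
  have Bb: "((\<lambda>y. B y b) has_derivative differential (\<lambda>y. B y b) p) (at p)" for b
    by (intro has_derivative_differential B)
  have "((\<lambda>y. \<Sum>b\<in>Basis. (X p \<bullet> b) *\<^sub>R B y b) has_derivative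
      (\<lambda>h. \<Sum>b\<in>Basis. (X p \<bullet> b) *\<^sub>R differential (\<lambda>y. B y b) p h)) (at p)"
    by (intro has_derivative_sum has_derivative_scaleR_right Bb)
  then have "((\<lambda>y. B y (X p)) has_derivative
      (\<lambda>h. \<Sum>b\<in>Basis. (X p \<bullet> b) *\<^sub>R differential (\<lambda>y. B y b) p h)) (at p)"
    by (rule has_derivative_transform_within_open[OF _ U]) (simp add: expand[symmetric])
  then have const: "differential (\<lambda>y. B y (X p)) p h =
      (\<Sum>b\<in>Basis. (X p \<bullet> b) *\<^sub>R differential (\<lambda>y. B y b) p h)" for h
    by (simp add: differential_eqI)
  have "((\<lambda>y. \<Sum>b\<in>Basis. (X y \<bullet> b) *\<^sub>R B y b) has_derivative
      (\<lambda>h. \<Sum>b\<in>Basis. (X p \<bullet> b) *\<^sub>R differential (\<lambda>y. B y b) p h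
         + (differential X p h \<bullet> b) *\<^sub>R B p b)) (at p)"
    by (intro has_derivative_sum has_derivative_scaleR Bb Xb)
  then have "((\<lambda>y. B y (X y)) has_derivative
      (\<lambda>h. \<Sum>b\<in>Basis. (X p \<bullet> b) *\<^sub>R differential (\<lambda>y. B y b) p h
         + (differential X p h \<bullet> b) *\<^sub>R B p b)) (at p)"
    by (rule has_derivative_transform_within_open[OF _ U]) (simp add: expand[symmetric])
  moreover have "(\<Sum>b\<in>Basis. (X p \<bullet> b) *\<^sub>R differential (\<lambda>y. B y b) p h
         + (differential X p h \<bullet> b) *\<^sub>R B p b)
      = differential (\<lambda>y. B y (X p)) p h + B p (differential X p h)" for h
    using expand[OF U(2), of "differential X p h"] const[of h] by (simp add: sum.distrib)
  ultimately show ?thesis by simp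
qed

lemma differentiable_form_field:
  fixes B :: "'e::real_normed_vector \<Rightarrow> 'f::euclidean_space \<Rightarrow> 'c::real_normed_vector"
  assumes "open U" "p \<in> U" "\<And>y. y \<in> U \<Longrightarrow> linear (B y)"
    "\<And>v. (\<lambda>y. B y v) differentiable (at p)" "X differentiable (at p)"
  shows "(\<lambda>y. B y (X y)) differentiable (at p)"
  using has_derivative_form_field[OF assms] unfolding differentiable_def by blast

lemma differential_form_field:
  fixes B :: "'e::real_normed_vector \<Rightarrow> 'f::euclidean_space \<Rightarrow> 'c::real_normed_vector"
  assumes "open U" "p \<in> U" "\<And>y. y \<in> U \<Longrightarrow> linear (B y)"
    "\<And>v. (\<lambda>y. B y v) differentiable (at p)" "X differentiable (at p)"
  shows "differential (\<lambda>y. B y (X y)) p h =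
    differential (\<lambda>y. B y (X p)) p h + B p (differential X p h)"
  using differential_eqI[OF has_derivative_form_field[OF assms]] by simp

text \<open>Cartan's formula: in the derivatives of \<alpha>(X) and \<alpha>(Y), the terms in which
  the fields are differentiated combine to \<alpha> of the bracket.\<close>

lemma ext_d_fields:
  fixes \<alpha> :: "('e::euclidean_space, 'c::real_normed_vector) form1"
  assumes "open U" "p \<in> U" "\<And>y. y \<in> U \<Longrightarrow> linear (\<alpha> y)"
    "\<And>v. (\<lambda>y. \<alpha> y v) differentiable (at p)"
    and X: "X differentiable (at p)" and Y: "Y differentiable (at p)"
  shows "ext_d \<alpha> p (X p) (Y p) = differential (\<lambda>y. \<alpha> y (Y y)) p (X p)
    - differential (\<lambda>y. \<alpha> y (X y)) p (Y p) - \<alpha> p (lie_bracket X Y p)"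
  using linear_diff[OF assms(3)[OF assms(2)]]
  by (simp add: differential_form_field[OF assms(1-4) X] differential_form_field[OF assms(1-4) Y]
      ext_d_differential lie_bracket_def)

text \<open>Leibniz rule for function coefficients. It serves both for the change of basis in a
  Frobenius bundle and for the forms \<open>b1\<close>, \<open>b2\<close> of the converse
  direction.\<close>

lemma ext_d_combination:
  fixes m n :: "'e::real_normed_vector \<Rightarrow> 'c::real_normed_field"
  assumes "m differentiable (at y)" "n differentiable (at y)"
    "\<And>v. (\<lambda>y. \<alpha> y v) differentiable (at y)" "\<And>v. (\<lambda>y. \<beta> y v) differentiable (at y)"
  shows "ext_d (\<lambda>y v. m y * \<alpha> y v + n y * \<beta> y v) y v w =
    wedge (\<lambda>_. differential m y) \<alpha> y v w + wedge (\<lambda>_. differential n y) \<beta> y v w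
    + m y * ext_d \<alpha> y v w + n y * ext_d \<beta> y v w"
  using assms
  by (simp add: ext_d_differential wedge_def differential_add differential_mult algebra_simps)

subsection \<open>Tangent vectors\<close>

text \<open>\<open>tangent_space\<close> asks for a curve that stays in \<open>N\<close> at all
  times. A local curve is continued by the constant \<open>p\<close>; the possible jump does not
  matter, since only the derivative at 0 counts.\<close>

lemma tangent_spaceI_local:
  assumes "p \<in> N" "d > 0" "\<And>t. \<bar>t\<bar> < d \<Longrightarrow> \<gamma> t \<in> N" "\<gamma> 0 = p"
    "(\<gamma> has_vector_derivative v) (at 0)"
  shows "v \<in> tangent_space N p"
proof -
  define \<delta> where "\<delta> = (\<lambda>t. if \<bar>t\<bar> < d then \<gamma> t else p)"
  have "(\<delta> has_vector_derivative v) (at 0)"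
    by (rule has_vector_derivative_transform_within_open[OF assms(5), of "{-d<..<d}"])
      (use assms(2) in \<open>auto simp: \<delta>_def\<close>)
  then show ?thesis
    using assms unfolding tangent_space_def by (auto intro!: exI[of _ \<delta>] simp: \<delta>_def)
qed

lemma tangent_space_Times:
  "tangent_space (M \<times> N) (p, q) = tangent_space M p \<times> tangent_space N q"
proof safe
  fix v w assume "(v, w) \<in> tangent_space (M \<times> N) (p, q)"
  then obtain \<gamma> where g: "\<forall>t. \<gamma> t \<in> M \<times> N" "\<gamma> 0 = (p, q)" "(\<gamma> has_vector_derivative (v, w)) (at (0::real))"
    unfolding tangent_space_def by blast
  have "((\<lambda>t. fst (\<gamma> t)) has_vector_derivative v) (at 0)" "((\<lambda>t. snd (\<gamma> t)) has_vector_derivative w) (at 0)"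
    using bounded_linear.has_vector_derivative[OF bounded_linear_fst g(3)]
      bounded_linear.has_vector_derivative[OF bounded_linear_snd g(3)] by auto
  moreover have "fst (\<gamma> t) \<in> M" "snd (\<gamma> t) \<in> N" for t
    using g(1)[rule_format, of t] by (auto simp: mem_Times_iff)
  ultimately show "v \<in> tangent_space M p" "w \<in> tangent_space N q"
    using g(2) unfolding tangent_space_def
    by (auto intro!: exI[of _ "\<lambda>t. fst (\<gamma> t)"] exI[of _ "\<lambda>t. snd (\<gamma> t)"])
next
  fix v w assume "v \<in> tangent_space M p" "w \<in> tangent_space N q"
  then obtain \<gamma> \<delta> where "\<forall>t. \<gamma> t \<in> M" "\<gamma> 0 = p" "(\<gamma> has_vector_derivative v) (at (0::real))"
    "\<forall>t. \<delta> t \<in> N" "\<delta> 0 = q" "(\<delta> has_vector_derivative w) (at (0::real))"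
    unfolding tangent_space_def by blast
  then show "(v, w) \<in> tangent_space (M \<times> N) (p, q)"
    unfolding tangent_space_def
    by (auto intro!: exI[of _ "\<lambda>t. (\<gamma> t, \<delta> t)"] has_vector_derivative_Pair)
qed

lemma zero_in_tangent_space: "p \<in> N \<Longrightarrow> 0 \<in> tangent_space N p"
  unfolding tangent_space_def by (auto intro!: exI[of _ "\<lambda>t. p"])

text \<open>Along a curve in \<open>N\<close> with velocity \<open>v\<close> both functions coincide
  near time 0, and the chain rule reads off their derivatives. This is what allows identities that
  are valid only on \<open>N\<close> to be differentiated.\<close>

lemma differential_cong_tangent:
  assumes v: "v \<in> tangent_space N p" and U: "open U" "p \<in> U"
    and f: "f differentiable (at p)" and h: "h differentiable (at p)"
    and eq: "\<And>y. y \<in> N \<Longrightarrow> y \<in> U \<Longrightarrow> f y = h y"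
  shows "differential f p v = differential h p v"
proof -
  obtain \<gamma> where g: "\<forall>t. \<gamma> t \<in> N" "\<gamma> 0 = p" "(\<gamma> has_vector_derivative v) (at (0::real))"
    using v unfolding tangent_space_def by blast
  have der: "((\<lambda>t. f (\<gamma> t)) has_vector_derivative differential f p v) (at 0)"
    if "f differentiable (at p)" for f :: "'a \<Rightarrow> 'b"
  proof -
    have "(f has_derivative differential f p) (at (\<gamma> 0))"
      using that g(2) by (simp add: has_derivative_differential)
    from has_derivative_compose[OF g(3)[unfolded has_vector_derivative_def] this]
    show ?thesis
      using linear_differential[OF that] by (simp add: has_vector_derivative_def linear_cmul)
  qed
  have "continuous (at 0) \<gamma>"
    by (rule has_vector_derivative_continuous[OF g(3)])
  then obtain S where S: "open S" "0 \<in> S" "\<And>t. t \<in> S \<Longrightarrow> \<gamma> t \<in> U"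
    using U g(2) unfolding continuous_at_open by (elim allE[of _ U]) auto
  have S': "f (\<gamma> t) = h (\<gamma> t)" if "t \<in> S" for t
    using g(1) S(3)[OF that] eq by blast
  have "((\<lambda>t. h (\<gamma> t)) has_vector_derivative differential f p v) (at 0)"
    using has_vector_derivative_transform_within_open[OF der[OF f] S(1,2) S'] .
  then show ?thesis using der[OF h] vector_derivative_unique_at by blast
qed

section \<open>The algebra of the necessity proof\<close>

text \<open>Abstracts differentiation along a vector field tangent to \<open>S\<close>. The last
  clause, by which only values on \<open>S\<close> matter, reflects that \<open>S\<close> will be a
  piece of a submanifold and not an open set. \<open>Z\<close> need not map \<open>D\<close> to
  itself, because the derivatives of the coefficients are prescribed by formulas.\<close>

definition derivation_on :: "'e set \<Rightarrow> ('e \<Rightarrow> 'c::field) set \<Rightarrow> (('e \<Rightarrow> 'c) \<Rightarrow> 'e \<Rightarrow> 'c) \<Rightarrow> bool" where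
  "derivation_on S D Z \<longleftrightarrow> (\<forall>f\<in>D. \<forall>h\<in>D.
     (\<lambda>y. f y - h y) \<in> D \<and> (\<lambda>y. f y * h y) \<in> D \<and>
     (\<forall>y\<in>S. Z (\<lambda>y. f y - h y) y = Z f y - Z h y \<and>
            Z (\<lambda>y. f y * h y) y = f y * Z h y + Z f y * h y) \<and>
     ((\<forall>y\<in>S. f y = h y) \<longrightarrow> (\<forall>y\<in>S. Z f y = Z h y)))"

text \<open>Here \<open>k\<close> stands for \<kappa> times sqrt |K|, so that no sign of the
  curvature appears, and the a's and b's are the \<theta>-coefficients of the normalised \<alpha>1,
  \<alpha>2. Once all of them but \<open>a3\<close>, \<open>b3\<close> vanish, A = - k a3 and B = -
  k b3 turn the formulas for the derivatives of \<open>A\<close> and \<open>B\<close> into the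
  claim.\<close>

lemma Frobenius_equations_imp_second_derivatives:
  fixes Z1 Z2 :: "('e \<Rightarrow> 'c::field_char_0) \<Rightarrow> 'e \<Rightarrow> 'c"
  assumes Z: "derivation_on S D Z1" "derivation_on S D Z2"
    and D: "a0 \<in> D" "a1 \<in> D" "a2 \<in> D" "a3 \<in> D" "b0 \<in> D" "b1 \<in> D" "b2 \<in> D" "b3 \<in> D"
      "A \<in> D" "B \<in> D" "k \<in> D"
    and k0: "\<And>y. y \<in> S \<Longrightarrow> k y \<noteq> 0"
    and A: "\<And>y. y \<in> S \<Longrightarrow> A y = a0 y - k y * a3 y"
    and B: "\<And>y. y \<in> S \<Longrightarrow> B y = b0 y - k y * b3 y"
    and dk: "\<And>y. y \<in> S \<Longrightarrow> Z1 k y = 2 * A y * k y" "\<And>y. y \<in> S \<Longrightarrow> Z2 k y = 2 * B y * k y"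
    and dA: "\<And>y. y \<in> S \<Longrightarrow> Z1 A y = A11 y" "\<And>y. y \<in> S \<Longrightarrow> Z2 A y = A12 y"
    and dB: "\<And>y. y \<in> S \<Longrightarrow> Z1 B y = A12 y" "\<And>y. y \<in> S \<Longrightarrow> Z2 B y = A22 y"
    and Z1a: "\<And>y. y \<in> S \<Longrightarrow> Z1 a0 y = A y * a0 y + k y * a2 y"
      "\<And>y. y \<in> S \<Longrightarrow> Z1 a1 y = A y * a1 y"
      "\<And>y. y \<in> S \<Longrightarrow> Z1 a2 y = A y * a2 y - k y * a0 y"
      "\<And>y. y \<in> S \<Longrightarrow> Z1 a3 y = A y * a3 y - k y - a2 y"
    and Z1b: "\<And>y. y \<in> S \<Longrightarrow> Z1 b0 y = B y * a0 y + k y * b2 y"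
      "\<And>y. y \<in> S \<Longrightarrow> Z1 b1 y = B y * a1 y"
      "\<And>y. y \<in> S \<Longrightarrow> Z1 b2 y = B y * a2 y - k y * b0 y"
      "\<And>y. y \<in> S \<Longrightarrow> Z1 b3 y = B y * a3 y - b2 y"
    and Z2a: "\<And>y. y \<in> S \<Longrightarrow> Z2 a0 y = A y * b0 y + k y * a1 y"
      "\<And>y. y \<in> S \<Longrightarrow> Z2 a1 y = A y * b1 y + k y * a0 y"
      "\<And>y. y \<in> S \<Longrightarrow> Z2 a2 y = A y * b2 y"
      "\<And>y. y \<in> S \<Longrightarrow> Z2 a3 y = A y * b3 y - a1 y"
    and Z2b: "\<And>y. y \<in> S \<Longrightarrow> Z2 b0 y = B y * b0 y + k y * b1 y"
      "\<And>y. y \<in> S \<Longrightarrow> Z2 b1 y = B y * b1 y + k y * b0 y"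
      "\<And>y. y \<in> S \<Longrightarrow> Z2 b2 y = B y * b2 y"
      "\<And>y. y \<in> S \<Longrightarrow> Z2 b3 y = B y * b3 y + k y - b1 y"
    and y: "y \<in> S"
  shows "A11 y = 3 * (A y)\<^sup>2 + (k y)\<^sup>2" (is ?t1) "A12 y = 3 * A y * B y" (is ?t2) "A22 y = 3 * (B y)\<^sup>2 - (k y)\<^sup>2" (is ?t3)
proof -
  have closed: "f \<in> D \<Longrightarrow> h \<in> D \<Longrightarrow> (\<lambda>y. f y - h y) \<in> D"
      "f \<in> D \<Longrightarrow> h \<in> D \<Longrightarrow> (\<lambda>y. f y * h y) \<in> D" for f h
    using Z(1) unfolding derivation_on_def by blast+
  have rule1: "f \<in> D \<Longrightarrow> h \<in> D \<Longrightarrow> y \<in> S \<Longrightarrow> Z1 (\<lambda>y. f y - h y) y = Z1 f y - Z1 h y"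
      "f \<in> D \<Longrightarrow> h \<in> D \<Longrightarrow> y \<in> S \<Longrightarrow> Z1 (\<lambda>y. f y * h y) y = f y * Z1 h y + Z1 f y * h y" for f h y
    using Z(1) unfolding derivation_on_def by blast+
  have rule2: "f \<in> D \<Longrightarrow> h \<in> D \<Longrightarrow> y \<in> S \<Longrightarrow> Z2 (\<lambda>y. f y - h y) y = Z2 f y - Z2 h y"
      "f \<in> D \<Longrightarrow> h \<in> D \<Longrightarrow> y \<in> S \<Longrightarrow> Z2 (\<lambda>y. f y * h y) y = f y * Z2 h y + Z2 f y * h y" for f h y
    using Z(2) unfolding derivation_on_def by blast+
  have cong: "f \<in> D \<Longrightarrow> h \<in> D \<Longrightarrow> (\<And>y. y \<in> S \<Longrightarrow> f y = h y) \<Longrightarrow> y \<in> S \<Longrightarrow> Z1 f y = Z1 h y"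
      "f \<in> D \<Longrightarrow> h \<in> D \<Longrightarrow> (\<And>y. y \<in> S \<Longrightarrow> f y = h y) \<Longrightarrow> y \<in> S \<Longrightarrow> Z2 f y = Z2 h y" for f h y
    using Z unfolding derivation_on_def by blast+
  note rules = rule1 rule2 closed D dk dA dB Z1a Z1b Z2a Z2b
  \<comment> \<open>These are the derivatives of A = a0 - k a3 and B = b0 - k b3. \<open>A12\<close>
    arises twice, from \<open>Z2 A\<close> and from \<open>Z1 B\<close>.\<close>
  have A11: "A11 y = A y * a0 y + 2 * k y * a2 y - 3 * A y * k y * a3 y + (k y)\<^sup>2" (is ?e1)
    and A12: "A12 y = A y * b0 y + 2 * k y * a1 y - k y * A y * b3 y - 2 * B y * k y * a3 y" (is ?e2)
    and A12': "A12 y = B y * a0 y + 2 * k y * b2 y - k y * B y * a3 y - 2 * A y * k y * b3 y" (is ?e3)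
    and A22: "A22 y = B y * b0 y + 2 * k y * b1 y - 3 * B y * k y * b3 y - (k y)\<^sup>2" (is ?e4)
    if "y \<in> S" for y
  proof -
    have "Z1 A y = Z1 (\<lambda>y. a0 y - k y * a3 y) y" "Z2 A y = Z2 (\<lambda>y. a0 y - k y * a3 y) y"
      "Z1 B y = Z1 (\<lambda>y. b0 y - k y * b3 y) y" "Z2 B y = Z2 (\<lambda>y. b0 y - k y * b3 y) y"
      using that by (rule cong[rotated 3]; simp add: closed D A B)+
    then show ?e1
      ?e2
      ?e3
      ?e4
      using that by (simp_all add: rules power2_eq_square algebra_simps)
  qed
  have cancel: "u = v" if "2 * k y * u = 2 * k y * v" "y \<in> S" for u v y
    using that k0[OF that(2)] by simp
  \<comment> \<open>With \<open>A\<close> and \<open>B\<close> eliminated, the difference of the two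
    expressions for \<open>A12\<close> is 2 k times this relation.\<close>
  have s1: "a1 y - b2 y = b0 y * a3 y - a0 y * b3 y" if y: "y \<in> S" for y
    by (rule cancel[OF _ y]) (use A12[OF y] A12'[OF y] A[OF y] B[OF y] in algebra)
  have Z1s1: "Z1 (\<lambda>y. a1 y - b2 y) y = Z1 (\<lambda>y. b0 y * a3 y - a0 y * b3 y) y"
    and Z2s1: "Z2 (\<lambda>y. a1 y - b2 y) y = Z2 (\<lambda>y. b0 y * a3 y - a0 y * b3 y) y" if "y \<in> S" for y
    using that by (rule cong[rotated 3]; simp add: closed D s1)+
  \<comment> \<open>First round: \<open>s1\<close> differentiated along \<open>Z1\<close> gives
    \<open>s2\<close>, along \<open>Z2\<close> it gives \<open>s3\<close>.\<close>
  have s2: "b0 y = a3 y * b2 y - a2 y * b3 y" if y: "y \<in> S" for y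
  proof (rule cancel[OF _ y])
    have "A y * a1 y - (B y * a2 y - k y * b0 y)
        = b0 y * (A y * a3 y - k y - a2 y) + (B y * a0 y + k y * b2 y) * a3 y
          - (a0 y * (B y * a3 y - b2 y) + (A y * a0 y + k y * a2 y) * b3 y)"
      using Z1s1[OF y] y by (simp add: rules)
    then show "2 * k y * b0 y = 2 * k y * (a3 y * b2 y - a2 y * b3 y)"
      using s1[OF y] A[OF y] B[OF y] by algebra
  qed
  have s3: "a0 y = a3 y * b1 y - a1 y * b3 y" if y: "y \<in> S" for y
  proof (rule cancel[OF _ y])
    have "A y * b1 y + k y * a0 y - B y * b2 y
        = b0 y * (A y * b3 y - a1 y) + (B y * b0 y + k y * b1 y) * a3 y
          - (a0 y * (B y * b3 y + k y - b1 y) + (A y * b0 y + k y * a1 y) * b3 y)"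
      using Z2s1[OF y] y by (simp add: rules)
    then show "2 * k y * a0 y = 2 * k y * (a3 y * b1 y - a1 y * b3 y)"
      using s1[OF y] A[OF y] B[OF y] by algebra
  qed
  \<comment> \<open>Second round: \<open>s2\<close> and \<open>s3\<close> are differentiated along
    both fields. Together with \<open>s1\<close>, \<open>s2\<close>, \<open>s3\<close> the resulting
    four equations leave no freedom in the six coefficients.\<close>
  have "Z1 a0 y = Z1 (\<lambda>y. a3 y * b1 y - a1 y * b3 y) y" "Z2 a0 y = Z2 (\<lambda>y. a3 y * b1 y - a1 y * b3 y) y"
    "Z1 b0 y = Z1 (\<lambda>y. a3 y * b2 y - a2 y * b3 y) y" "Z2 b0 y = Z2 (\<lambda>y. a3 y * b2 y - a2 y * b3 y) y"
    using y by (rule cong[rotated 3]; simp add: closed D s2[symmetric] s3[symmetric])+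
  then have e: "A y * a0 y + k y * a2 y = a3 y * (B y * a1 y) + (A y * a3 y - k y - a2 y) * b1 y
        - (a1 y * (B y * a3 y - b2 y) + (A y * a1 y) * b3 y)"
    "A y * b0 y + k y * a1 y = a3 y * (B y * b1 y + k y * b0 y) + (A y * b3 y - a1 y) * b1 y
        - (a1 y * (B y * b3 y + k y - b1 y) + (A y * b1 y + k y * a0 y) * b3 y)"
    "B y * a0 y + k y * b2 y = a3 y * (B y * a2 y - k y * b0 y) + (A y * a3 y - k y - a2 y) * b2 y
        - (a2 y * (B y * a3 y - b2 y) + (A y * a2 y - k y * a0 y) * b3 y)"
    "B y * b0 y + k y * b1 y = a3 y * (B y * b2 y) + (A y * b3 y - a1 y) * b2 y
        - (a2 y * (B y * b3 y + k y - b1 y) + (A y * b2 y) * b3 y)"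
    using y by (simp_all add: rules)
  note AB = A[OF y] B[OF y]
  have a1: "a1 y = a3 y * b0 y - a0 y * b3 y"
    by (rule cancel[OF _ y]) (use e(2) AB s3[OF y] in algebra)
  have b2: "b2 y = - (a3 y * b0 y - a0 y * b3 y)"
    by (rule cancel[OF _ y]) (use e(3) AB s2[OF y] in algebra)
  \<comment> \<open>Both \<open>a1\<close> and \<open>- b2\<close> equal the right-hand side of
    \<open>s1\<close>, so \<open>s1\<close> equates that quantity with its double.\<close>
  have "2 * a1 y = a1 y"
    using a1 b2 s1[OF y] by algebra
  then have a1_0: "a1 y = 0" by simp
  then have b2_0: "b2 y = 0" using a1 b2 by simp
  \<comment> \<open>The first and the last equation of \<open>e\<close> give k (a2 + b1) with
    opposite right-hand sides. Hence the sum of \<open>a2\<close> and \<open>b1\<close> vanishes,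
    and, as a1 = b2 = 0, so does their product.\<close>
  have a2_b1: "k y * a2 y + k y * b1 y = a1 y * b2 y - a2 y * b1 y"
      "k y * a2 y + k y * b1 y = a2 y * b1 y - a1 y * b2 y"
    using e(1,4) AB s2[OF y] s3[OF y] by algebra+
  then have "2 * k y * (a2 y + b1 y) = 2 * k y * 0" by algebra
  then have "a2 y + b1 y = 0" using cancel[OF _ y] by blast
  moreover have "a2 y * b1 y = 0" using a2_b1 calculation a1_0 b2_0
    by (metis distrib_left mult_zero_right diff_zero)
  ultimately have a2_0: "a2 y = 0" and b1_0: "b1 y = 0"
    by (auto simp: add_eq_0_iff2)
  have "a0 y = 0" "b0 y = 0"
    using s2[OF y] s3[OF y] a1_0 a2_0 b1_0 b2_0 by simp_all
  then show ?t1 ?t2 ?t3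
    using A11[OF y] A12[OF y] A22[OF y] AB a1_0 a2_0 b1_0 b2_0
    by (simp_all add: power2_eq_square algebra_simps)
qed

section \<open>Normal form of a transverse Frobenius subbundle\<close>

lemma sum_lessThan_two:
  fixes f :: "nat \<Rightarrow> 'c::comm_monoid_add"
  assumes "(2::nat) \<le> r" "\<And>i. 2 \<le> i \<Longrightarrow> i < r \<Longrightarrow> f i = 0"
  shows "sum f {..<r} = f 0 + f 1"
proof -
  have "sum f {..<r} = sum f {0, 1}"
    using assms by (intro sum.mono_neutral_right) (auto simp: not_less_eq_eq numeral_2_eq_2)
  then show ?thesis by simp
qed

lemma sum_lessThan_three:
  fixes f :: "nat \<Rightarrow> 'c::comm_monoid_add"
  assumes "(3::nat) \<le> r" "\<And>i. 3 \<le> i \<Longrightarrow> i < r \<Longrightarrow> f i = 0"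
  shows "sum f {..<r} = f 0 + f 1 + f 2"
proof -
  have "i \<in> {0, 1, 2} \<or> 3 \<le> i" for i :: nat by auto
  then have "sum f {..<r} = sum f {0, 1, 2}"
    using assms by (intro sum.mono_neutral_right) auto
  then show ?thesis by (simp add: add.assoc)
qed

text \<open>Modulo \<Theta> a form of the bundle is given by its two \<pi>-coefficients, which
  \<open>E1\<close> and \<open>E2\<close> read off. Transversality and independence make this
  reduction injective, so the rank is exactly 2 and the 2 by 2 matrix of coefficients is invertible;
  multiplying by its inverse normalises the basis. Only differentiability is passed on, as only
  first derivatives are taken later.\<close>

lemma transverse_Frobenius_normal_form:
  fixes N :: "'e::euclidean_space set" and \<Theta> :: "('e, 'c::real_normed_field) form1 list"
  assumes Fro: "contains_transverse_Frobenius N \<Theta> (\<Theta> @ [\<pi>1, \<pi>2]) p" and p: "p \<in> N"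
    and dE: "\<And>y. y \<in> O' \<Longrightarrow> E1 differentiable (at y)" "\<And>y. y \<in> O' \<Longrightarrow> E2 differentiable (at y)"
    and O': "open O'" "p \<in> O'"
    and ET: "\<And>y. y \<in> N \<Longrightarrow> E1 y \<in> tangent_space N y" "\<And>y. y \<in> N \<Longrightarrow> E2 y \<in> tangent_space N y"
    and E\<Theta>: "\<And>y \<theta>. y \<in> N \<Longrightarrow> \<theta> \<in> set \<Theta> \<Longrightarrow> \<theta> y (E1 y) = 0 \<and> \<theta> y (E2 y) = 0"
    and E\<pi>: "\<And>y. y \<in> N \<Longrightarrow> \<pi>1 y (E1 y) = 1 \<and> \<pi>1 y (E2 y) = 0 \<and> \<pi>2 y (E1 y) = 0 \<and> \<pi>2 y (E2 y) = 1"
  obtains U \<alpha>1 \<alpha>2 where "open U" "p \<in> U" "U \<subseteq> O'"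
    "\<And>y \<alpha>. y \<in> U \<Longrightarrow> \<alpha> \<in> {\<alpha>1, \<alpha>2} \<Longrightarrow> linear (\<alpha> y)"
    "\<And>y \<alpha> v. y \<in> U \<Longrightarrow> \<alpha> \<in> {\<alpha>1, \<alpha>2} \<Longrightarrow> (\<lambda>y. \<alpha> y v) differentiable (at y)"
    "\<And>y. y \<in> N \<inter> U \<Longrightarrow> \<alpha>1 y (E1 y) = 1 \<and> \<alpha>1 y (E2 y) = 0 \<and> \<alpha>2 y (E1 y) = 0 \<and> \<alpha>2 y (E2 y) = 1"
    "\<And>y \<alpha>. y \<in> N \<inter> U \<Longrightarrow> \<alpha> \<in> {\<alpha>1, \<alpha>2} \<Longrightarrow>
       \<exists>a x z. \<forall>v\<in>tangent_space N y. \<alpha> y v = (\<Sum>j<length \<Theta>. a j * (\<Theta> ! j) y v) + x * \<pi>1 y v + z * \<pi>2 y v"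
    "\<And>y \<alpha>. y \<in> N \<inter> U \<Longrightarrow> \<alpha> \<in> {\<alpha>1, \<alpha>2} \<Longrightarrow>
       \<exists>\<beta>1 \<beta>2. linear \<beta>1 \<and> linear \<beta>2 \<and> (\<forall>v\<in>tangent_space N y. \<forall>w\<in>tangent_space N y.
         ext_d \<alpha> y v w = wedge (\<lambda>_. \<beta>1) \<alpha>1 y v w + wedge (\<lambda>_. \<beta>2) \<alpha>2 y v w)"
proof -
  define n where "n = length \<Theta>"
  let ?T = "tangent_space N"
  show ?thesis
    using Fro[unfolded contains_transverse_Frobenius_def]
  proof (elim exE conjE)
  fix r :: nat and U and \<alpha> :: "nat \<Rightarrow> ('e, 'c) form1"
  assume r: "r \<ge> 2" and U: "open U" "p \<in> U"
    and sm: "\<forall>i<r. smooth_form U (\<alpha> i)"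
    and all: "\<forall>y\<in>N \<inter> U.
      (\<forall>a. (\<forall>v\<in>?T y. (\<Sum>i<r. a i * \<alpha> i y v) = 0) \<longrightarrow> (\<forall>i<r. a i = 0)) \<and>
      (\<forall>i<r. \<exists>a. \<forall>v\<in>?T y. \<alpha> i y v =
         (\<Sum>j<length (\<Theta> @ [\<pi>1, \<pi>2]). a j * ((\<Theta> @ [\<pi>1, \<pi>2]) ! j) y v)) \<and>
      (\<forall>a b. (\<forall>v\<in>?T y. (\<Sum>i<r. a i * \<alpha> i y v) = (\<Sum>j<length \<Theta>. b j * (\<Theta> ! j) y v)) \<longrightarrow>
         (\<forall>v\<in>?T y. (\<Sum>i<r. a i * \<alpha> i y v) = 0)) \<and>
      (\<forall>i<r. \<exists>\<beta>. (\<forall>j<r. linear (\<beta> j)) \<and>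
         (\<forall>v\<in>?T y. \<forall>w\<in>?T y. ext_d (\<alpha> i) y v w = (\<Sum>j<r. wedge (\<lambda>_. \<beta> j) (\<alpha> j) y v w)))"
  have indep: "\<forall>i<r. a i = 0" if "y \<in> N \<inter> U" "\<forall>v\<in>?T y. (\<Sum>i<r. a i * \<alpha> i y v) = 0" for y a
    using bspec[OF all that(1)] that(2) by (elim conjE allE[of _ a]) simp
  have cont: "\<exists>a. \<forall>v\<in>?T y. \<alpha> i y v =
      (\<Sum>j<length (\<Theta> @ [\<pi>1, \<pi>2]). a j * ((\<Theta> @ [\<pi>1, \<pi>2]) ! j) y v)"
    if "y \<in> N \<inter> U" "i < r" for y i
    by (rule bspec[OF all that(1), THEN conjunct2, THEN conjunct1, rule_format, OF that(2)])
  have trans: "\<forall>v\<in>?T y. (\<Sum>i<r. a i * \<alpha> i y v) = 0"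
    if "y \<in> N \<inter> U" "\<forall>v\<in>?T y. (\<Sum>i<r. a i * \<alpha> i y v) = (\<Sum>j<length \<Theta>. b j * (\<Theta> ! j) y v)" for y a b
    by (rule bspec[OF all that(1), THEN conjunct2, THEN conjunct2, THEN conjunct1, THEN spec[of _ a],
        THEN spec[of _ b], THEN mp, OF that(2)])
  have frob: "\<exists>\<beta>. (\<forall>j<r. linear (\<beta> j)) \<and>
      (\<forall>v\<in>?T y. \<forall>w\<in>?T y. ext_d (\<alpha> i) y v w = (\<Sum>j<r. wedge (\<lambda>_. \<beta> j) (\<alpha> j) y v w))"
    if "y \<in> N \<inter> U" "i < r" for y i
    by (rule bspec[OF all that(1), THEN conjunct2, THEN conjunct2, THEN conjunct2, THEN spec[of _ i],
        THEN mp, OF that(2)])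
  define x where "x = (\<lambda>i y. \<alpha> i y (E1 y))"
  define z where "z = (\<lambda>i y. \<alpha> i y (E2 y))"
  have cont': "\<exists>b. \<forall>v\<in>?T y. \<alpha> i y v = (\<Sum>j<n. b j * (\<Theta> ! j) y v) + x i y * \<pi>1 y v + z i y * \<pi>2 y v"
    if y: "y \<in> N \<inter> U" and i: "i < r" for y i
  proof -
    obtain a where a: "\<forall>v\<in>?T y. \<alpha> i y v = (\<Sum>j<length (\<Theta> @ [\<pi>1, \<pi>2]). a j * ((\<Theta> @ [\<pi>1, \<pi>2]) ! j) y v)"
      using cont[OF y i] by blast
    have a': "\<alpha> i y v = (\<Sum>j<n. a j * (\<Theta> ! j) y v) + a n * \<pi>1 y v + a (Suc n) * \<pi>2 y v" if "v \<in> ?T y" for v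
      using a that by (simp add: n_def nth_append)
    have "(\<Sum>j<n. a j * (\<Theta> ! j) y (E1 y)) = 0" "(\<Sum>j<n. a j * (\<Theta> ! j) y (E2 y)) = 0"
      using E\<Theta> y by (auto simp: n_def intro!: sum.neutral)
    then have "x i y = a n" "z i y = a (Suc n)"
      using a'[of "E1 y"] a'[of "E2 y"] ET y E\<pi>[of y] by (auto simp: x_def z_def)
    then show ?thesis using a' by auto
  qed
  \<comment> \<open>A combination without \<pi>-components lies in the span of \<Theta>;
    transversality makes it vanish, and independence then makes its coefficients vanish.\<close>
  have inj: "\<forall>i<r. s i = 0"
    if y: "y \<in> N \<inter> U" and s: "(\<Sum>i<r. s i * x i y) = 0" "(\<Sum>i<r. s i * z i y) = 0" for y s
  proof -
    obtain b where b: "\<And>i v. i < r \<Longrightarrow> v \<in> ?T y \<Longrightarrow>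
        \<alpha> i y v = (\<Sum>j<n. b i j * (\<Theta> ! j) y v) + x i y * \<pi>1 y v + z i y * \<pi>2 y v"
      using cont'[OF y] by metis
    have "(\<Sum>i<r. s i * \<alpha> i y v) = (\<Sum>j<length \<Theta>. (\<Sum>i<r. s i * b i j) * (\<Theta> ! j) y v)" if v: "v \<in> ?T y" for v
    proof -
      have "(\<Sum>i<r. s i * \<alpha> i y v) = (\<Sum>i<r. \<Sum>j<n. s i * b i j * (\<Theta> ! j) y v)
          + (\<Sum>i<r. s i * x i y) * \<pi>1 y v + (\<Sum>i<r. s i * z i y) * \<pi>2 y v"
        unfolding sum_distrib_right sum.distrib[symmetric]
        by (intro sum.cong refl) (simp add: b v algebra_simps sum_distrib_left)
      also have "(\<Sum>i<r. \<Sum>j<n. s i * b i j * (\<Theta> ! j) y v) = (\<Sum>j<n. \<Sum>i<r. s i * b i j * (\<Theta> ! j) y v)"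
        by (rule sum.swap)
      finally show ?thesis by (simp add: s n_def sum_distrib_right)
    qed
    then have "\<forall>v\<in>?T y. (\<Sum>i<r. s i * \<alpha> i y v) = 0"
      by (intro trans[OF y, of s "\<lambda>j. \<Sum>i<r. s i * b i j"]) simp
    then show ?thesis by (rule indep[OF y])
  qed
  define det where "det = (\<lambda>y. x 0 y * z 1 y - x 1 y * z 0 y)"
  have two: "(\<Sum>i<r. (if i = 0 then c else if i = 1 then d else 0) * f i) = c * f 0 + d * f 1"
    for c d :: 'c and f
    using sum_lessThan_two[OF r, of "\<lambda>i. (if i = 0 then c else if i = 1 then d else 0) * f i"] by simp
  have indep2: "c = 0 \<and> d = 0"
    if "y \<in> N \<inter> U" "c * x 0 y + d * x 1 y = 0" "c * z 0 y + d * z 1 y = 0" for y c d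
  proof -
    have s: "\<forall>i<r. (if i = 0 then c else if i = 1 then d else 0) = 0"
      by (rule inj[OF that(1)]; unfold two; rule that)
    have "0 < r" "1 < r" using r by auto
    then show ?thesis using s[rule_format, of 0] s[rule_format, of 1] by simp
  qed
  have det: "det y \<noteq> 0" if y: "y \<in> N \<inter> U" for y
  proof
    assume "det y = 0"
    \<comment> \<open>If the determinant vanishes, (z1, -z0) and (x1, -x0) are relations between the
      two rows, so all entries are 0; then (1, 0) is a relation as well.\<close>
    then have "z 1 y = 0 \<and> - z 0 y = 0" "x 1 y = 0 \<and> - x 0 y = 0"
      by (intro indep2[OF y]; simp add: det_def algebra_simps)+
    then show False using indep2[OF y, of 1 0] by simp
  qed
  have r2: "r = 2"
  proof (rule ccontr)
    assume "r \<noteq> 2"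
    then have r3: "3 \<le> r" using r by simp
    have y: "p \<in> N \<inter> U" using p U by simp
    \<comment> \<open>Cramer's rule writes the third row as a combination of the first two. The
      relation \<open>s\<close>, with -1 at index 2, contradicts injectivity at the single point
      \<open>p\<close>.\<close>
    define c where "c = (x 2 p * z 1 p - x 1 p * z 2 p) / det p"
    define d where "d = (x 0 p * z 2 p - x 2 p * z 0 p) / det p"
    define s where "s = (\<lambda>i::nat. if i = 0 then c else if i = 1 then d else if i = 2 then -1 else 0)"
    have three: "(\<Sum>i<r. s i * f i) = c * f 0 + d * f 1 - f 2" for f
      using sum_lessThan_three[OF r3, of "\<lambda>i. s i * f i"] by (simp add: s_def)
    have cd: "c * det p = x 2 p * z 1 p - x 1 p * z 2 p" "d * det p = x 0 p * z 2 p - x 2 p * z 0 p"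
      using det[OF y] by (simp_all add: c_def d_def)
    have "(c * x 0 p + d * x 1 p - x 2 p) * det p = 0" "(c * z 0 p + d * z 1 p - z 2 p) * det p = 0"
      using cd unfolding det_def by algebra+
    then have "s 2 = 0"
      using inj[OF y, of s] r3 det[OF y] by (auto simp: three)
    then show False by (simp add: s_def)
  qed
  have sum2: "(\<Sum>i<r. f i) = f 0 + f 1" for f :: "nat \<Rightarrow> 'c"
    by (simp add: r2 numeral_2_eq_2)
  have lin: "linear (\<alpha> i y)" and dif: "(\<lambda>y. \<alpha> i y v) differentiable (at y)"
    if "i < r" "y \<in> U" for i y v
  proof -
    have sf: "smooth_form U (\<alpha> i)" using sm that(1) by blast
    then have "\<forall>y\<in>U. linear (\<alpha> i y)" unfolding smooth_form_def by (rule conjunct1)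
    then show "linear (\<alpha> i y)" using that(2) by (rule bspec)
    have "\<forall>v. smooth_on U (\<lambda>y. \<alpha> i y v)" using sf unfolding smooth_form_def by (rule conjunct2)
    then have "smooth_on U (\<lambda>y. \<alpha> i y v)" by (rule spec)
    then show "(\<lambda>y. \<alpha> i y v) differentiable (at y)" using that(2) by (rule smooth_on_differentiable)
  qed
  have dx: "x i differentiable (at y)" and dz: "z i differentiable (at y)" if "i < r" "y \<in> U \<inter> O'" for i y
    unfolding x_def z_def using that
    by (auto intro!: differentiable_form_field[of U y "\<alpha> i" E1] differentiable_form_field[of U y "\<alpha> i" E2]
        lin dif dE simp: U(1))
  have r01: "0 < r" "1 < r" using r by auto
  have ddet: "det differentiable (at y)" if "y \<in> U \<inter> O'" for y
    unfolding det_def using dx dz r01 that by (auto intro!: differentiable_diff differentiable_mult)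
  \<comment> \<open>The determinant is known to be nonzero on \<open>N\<close> only. On this smaller
    open set it is nonzero off \<open>N\<close> too, so the quotients below are differentiable in
    the ambient space.\<close>
  define U' where "U' = {y \<in> U \<inter> O'. det y \<noteq> 0}"
  have "continuous_on (U \<inter> O') det"
    using ddet differentiable_imp_continuous_within
    by (meson continuous_at_imp_continuous_on differentiable_at_withinI)
  then have "open ((U \<inter> O') \<inter> det -` (- {0}))"
    using U O' by (intro continuous_open_preimage) auto
  moreover have "(U \<inter> O') \<inter> det -` (- {0}) = U'" by (auto simp: U'_def)
  ultimately have oU': "open U'" by simp
  have pU': "p \<in> U'" using p U O' det by (auto simp: U'_def)
  define lc where "lc = (\<lambda>m n y v. m y * \<alpha> 0 y v + n y * \<alpha> 1 y v)"
  \<comment> \<open>(m1, n1) and (m2, n2) are the rows of the inverse of the matrix with rows (x0,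
    z0) and (x1, z1).\<close>
  define m1 where "m1 = (\<lambda>y. z 1 y / det y)"
  define n1 where "n1 = (\<lambda>y. - z 0 y / det y)"
  define m2 where "m2 = (\<lambda>y. - x 1 y / det y)"
  define n2 where "n2 = (\<lambda>y. x 0 y / det y)"
  have dm: "m1 differentiable (at y)" "n1 differentiable (at y)" "m2 differentiable (at y)" "n2 differentiable (at y)"
    if "y \<in> U'" for y
    unfolding m1_def n1_def m2_def n2_def using that dx dz ddet r01
    by (auto intro!: differentiable_divide differentiable_minus simp: U'_def)
  have recover: "\<alpha> 0 y v = x 0 y * lc m1 n1 y v + z 0 y * lc m2 n2 y v" (is ?e1)
    "\<alpha> 1 y v = x 1 y * lc m1 n1 y v + z 1 y * lc m2 n2 y v" (is ?e2) if "y \<in> U'" for y v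
  proof -
    have d: "det y \<noteq> 0" using that by (simp add: U'_def)
    have "x 0 y * lc m1 n1 y v + z 0 y * lc m2 n2 y v = \<alpha> 0 y v * (det y / det y)"
      "x 1 y * lc m1 n1 y v + z 1 y * lc m2 n2 y v = \<alpha> 1 y v * (det y / det y)"
      using d by (simp_all add: lc_def m1_def n1_def m2_def n2_def divide_simps) (simp_all add: det_def algebra_simps)
    then show ?e1
      ?e2 using d by simp_all
  qed
  have lclin: "linear (lc m n y)" if "y \<in> U'" for m n y
    using that lin r01 unfolding lc_def U'_def
    by (intro linearI) (auto simp: linear_add linear_scale algebra_simps)
  have lcdif: "(\<lambda>y. lc m n y v) differentiable (at y)"
    if "y \<in> U'" "m differentiable (at y)" "n differentiable (at y)" for m n y v
    unfolding lc_def using that dif r01 by (auto intro!: differentiable_add differentiable_mult simp: U'_def)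
  have lcspan: "\<exists>a x z. \<forall>v\<in>?T y. lc m n y v = (\<Sum>j<length \<Theta>. a j * (\<Theta> ! j) y v) + x * \<pi>1 y v + z * \<pi>2 y v"
    if y: "y \<in> N \<inter> U'" for m y and n :: "'e \<Rightarrow> 'c"
  proof -
    have y': "y \<in> N \<inter> U" using y by (auto simp: U'_def)
    obtain b where b: "\<forall>v\<in>?T y. \<alpha> 0 y v = (\<Sum>j<length \<Theta>. b j * (\<Theta> ! j) y v) + x 0 y * \<pi>1 y v + z 0 y * \<pi>2 y v"
      using cont'[OF y' r01(1)] n_def by blast
    obtain b' where b': "\<forall>v\<in>?T y. \<alpha> 1 y v = (\<Sum>j<length \<Theta>. b' j * (\<Theta> ! j) y v) + x 1 y * \<pi>1 y v + z 1 y * \<pi>2 y v"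
      using cont'[OF y' r01(2)] n_def by blast
    have "lc m n y v = (\<Sum>j<length \<Theta>. (m y * b j + n y * b' j) * (\<Theta> ! j) y v)
        + (m y * x 0 y + n y * x 1 y) * \<pi>1 y v + (m y * z 0 y + n y * z 1 y) * \<pi>2 y v" if "v \<in> ?T y" for v
    proof -
      have "(\<Sum>j<length \<Theta>. (m y * b j + n y * b' j) * (\<Theta> ! j) y v)
          = m y * (\<Sum>j<length \<Theta>. b j * (\<Theta> ! j) y v) + n y * (\<Sum>j<length \<Theta>. b' j * (\<Theta> ! j) y v)"
        by (simp only: distrib_right sum.distrib sum_distrib_left mult.assoc)
      moreover have "lc m n y v = m y * \<alpha> 0 y v + n y * \<alpha> 1 y v" by (simp only: lc_def)
      ultimately show ?thesis
        using bspec[OF b that] bspec[OF b' that] by algebra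
    qed
    note eq = this
    show ?thesis
      by (rule exI[of _ "\<lambda>j. m y * b j + n y * b' j"], rule exI[of _ "m y * x 0 y + n y * x 1 y"],
          rule exI[of _ "m y * z 0 y + n y * z 1 y"], rule ballI, rule eq)
  qed
  have lin_cmul: "linear (\<lambda>v. c * f v)" if "linear f" for c :: 'c and f :: "'e \<Rightarrow> 'c"
    using that by (intro linearI) (auto simp: linear_add linear_scale algebra_simps)
  have lcfrob: "\<exists>\<beta>1 \<beta>2. linear \<beta>1 \<and> linear \<beta>2 \<and> (\<forall>v\<in>?T y. \<forall>w\<in>?T y.
         ext_d (lc m n) y v w = wedge (\<lambda>_. \<beta>1) (lc m1 n1) y v w + wedge (\<lambda>_. \<beta>2) (lc m2 n2) y v w)"
    if y: "y \<in> N \<inter> U'" and mn: "m differentiable (at y)" "n differentiable (at y)" for m n y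
  proof -
    have y': "y \<in> N \<inter> U" "y \<in> U'" "y \<in> U" using y by (auto simp: U'_def)
    obtain \<beta> where \<beta>: "\<forall>j<r. linear (\<beta> j)"
        "\<forall>v\<in>?T y. \<forall>w\<in>?T y. ext_d (\<alpha> 0) y v w = (\<Sum>j<r. wedge (\<lambda>_. \<beta> j) (\<alpha> j) y v w)"
      using frob[OF y'(1) r01(1)] by blast
    obtain \<beta>' where \<beta>': "\<forall>j<r. linear (\<beta>' j)"
        "\<forall>v\<in>?T y. \<forall>w\<in>?T y. ext_d (\<alpha> 1) y v w = (\<Sum>j<r. wedge (\<lambda>_. \<beta>' j) (\<alpha> j) y v w)"
      using frob[OF y'(1) r01(2)] by blast
    \<comment> \<open>\<open>d0\<close> and \<open>d1\<close> collect what stands in front of the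
      old basis forms: the differential of the coefficient and the old Frobenius 1-forms.
      \<open>recover\<close> then rewrites the old basis in the new one.\<close>
    define d0 where "d0 = (\<lambda>v. differential m y v + (m y * \<beta> 0 v + n y * \<beta>' 0 v))"
    define d1 where "d1 = (\<lambda>v. differential n y v + (m y * \<beta> 1 v + n y * \<beta>' 1 v))"
    have lind: "linear d0" "linear d1"
      unfolding d0_def d1_def using linear_differential mn \<beta>(1) \<beta>'(1) r01
      by (auto intro!: linear_compose_add lin_cmul)
    have eq: "ext_d (lc m n) y v w = d0 v * \<alpha> 0 y w - d0 w * \<alpha> 0 y v + d1 v * \<alpha> 1 y w - d1 w * \<alpha> 1 y v"
      if "v \<in> ?T y" "w \<in> ?T y" for v w
    proof -
      have e0: "ext_d (\<alpha> 0) y v w = \<beta> 0 v * \<alpha> 0 y w - \<beta> 0 w * \<alpha> 0 y v + (\<beta> 1 v * \<alpha> 1 y w - \<beta> 1 w * \<alpha> 1 y v)"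
        using bspec[OF bspec[OF \<beta>(2) that(1)] that(2)] by (simp only: sum2 wedge_def)
      have e1: "ext_d (\<alpha> 1) y v w = \<beta>' 0 v * \<alpha> 0 y w - \<beta>' 0 w * \<alpha> 0 y v + (\<beta>' 1 v * \<alpha> 1 y w - \<beta>' 1 w * \<alpha> 1 y v)"
        using bspec[OF bspec[OF \<beta>'(2) that(1)] that(2)] by (simp only: sum2 wedge_def)
      have "ext_d (lc m n) y v w = wedge (\<lambda>_. differential m y) (\<alpha> 0) y v w
          + wedge (\<lambda>_. differential n y) (\<alpha> 1) y v w + m y * ext_d (\<alpha> 0) y v w + n y * ext_d (\<alpha> 1) y v w"
        unfolding lc_def by (rule ext_d_combination[OF mn dif[OF r01(1) y'(3)] dif[OF r01(2) y'(3)]])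
      then show ?thesis
        unfolding e0 e1 wedge_def d0_def d1_def by (simp only: algebra_simps)
    qed
    have "ext_d (lc m n) y v w = wedge (\<lambda>_. (\<lambda>v. x 0 y * d0 v + x 1 y * d1 v)) (lc m1 n1) y v w
         + wedge (\<lambda>_. (\<lambda>v. z 0 y * d0 v + z 1 y * d1 v)) (lc m2 n2) y v w"
      if "v \<in> ?T y" "w \<in> ?T y" for v w
      unfolding eq[OF that] wedge_def recover[OF y'(2)] by (simp add: algebra_simps)
    note dec = this
    show ?thesis
      by (rule exI[of _ "\<lambda>v. x 0 y * d0 v + x 1 y * d1 v"], rule exI[of _ "\<lambda>v. z 0 y * d0 v + z 1 y * d1 v"])
        (intro conjI ballI linear_compose_add lin_cmul lind dec)
  qed
  show ?thesis
  proof (rule that[of U' "lc m1 n1" "lc m2 n2"])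
    show "lc m1 n1 y (E1 y) = 1 \<and> lc m1 n1 y (E2 y) = 0 \<and> lc m2 n2 y (E1 y) = 0 \<and> lc m2 n2 y (E2 y) = 1"
      if "y \<in> N \<inter> U'" for y
    proof -
      have d: "det y \<noteq> 0" using that by (simp add: U'_def)
      have *: "lc m n y (E1 y) = m y * x 0 y + n y * x 1 y" "lc m n y (E2 y) = m y * z 0 y + n y * z 1 y" for m n
        by (simp_all add: lc_def x_def z_def)
      have md: "m1 y * det y = z 1 y" "n1 y * det y = - z 0 y" "m2 y * det y = - x 1 y" "n2 y * det y = x 0 y"
        using d by (simp_all add: m1_def n1_def m2_def n2_def)
      have "det y = x 0 y * z 1 y - x 1 y * z 0 y" by (simp only: det_def)
      then have "(m1 y * x 0 y + n1 y * x 1 y) * det y = 1 * det y" "(m1 y * z 0 y + n1 y * z 1 y) * det y = 0 * det y"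
        "(m2 y * x 0 y + n2 y * x 1 y) * det y = 0 * det y" "(m2 y * z 0 y + n2 y * z 1 y) * det y = 1 * det y"
        using md by algebra+
      then show ?thesis using d unfolding * by (blast intro: mult_right_cancel[THEN iffD1])
    qed
    show "open U'" "p \<in> U'" by (rule oU' pU')+
    show "U' \<subseteq> O'" by (auto simp: U'_def)
    fix y \<alpha>' assume \<alpha>': "\<alpha>' \<in> {lc m1 n1, lc m2 n2}"
    show "linear (\<alpha>' y)" if "y \<in> U'"
      using \<alpha>' lclin[OF that] by auto
    show "(\<lambda>y. \<alpha>' y v) differentiable (at y)" if "y \<in> U'" for v
      using \<alpha>' lcdif[OF that dm(1,2)[OF that], of v] lcdif[OF that dm(3,4)[OF that], of v] by auto
    show "\<exists>a x z. \<forall>v\<in>tangent_space N y.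
        \<alpha>' y v = (\<Sum>j<length \<Theta>. a j * (\<Theta> ! j) y v) + x * \<pi>1 y v + z * \<pi>2 y v" if "y \<in> N \<inter> U'"
      using \<alpha>' lcspan[OF that, of m1 n1] lcspan[OF that, of m2 n2] by (elim insertE emptyE; hypsubst)
    show "\<exists>\<beta>1 \<beta>2. linear \<beta>1 \<and> linear \<beta>2 \<and> (\<forall>v\<in>tangent_space N y. \<forall>w\<in>tangent_space N y.
        ext_d \<alpha>' y v w = wedge (\<lambda>_. \<beta>1) (lc m1 n1) y v w + wedge (\<lambda>_. \<beta>2) (lc m2 n2) y v w)" if "y \<in> N \<inter> U'"
    proof -
      have "y \<in> U'" using that by simp
      then show ?thesis
        using \<alpha>' lcfrob[OF that dm(1,2)] lcfrob[OF that dm(3,4)] by (elim insertE emptyE; hypsubst)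
    qed
  qed
  qed
qed

section \<open>The frame bundle of Minkowski space\<close>

lemma mink_commute: "mink x y = mink y x"
  by (simp add: mink_def algebra_simps)

lemma mink_linear_simps:
  "mink (x + y) z = mink x z + mink y z" "mink z (x + y) = mink z x + mink z y"
  "mink (x - y) z = mink x z - mink y z" "mink z (x - y) = mink z x - mink z y"
  "mink (- x) z = - mink x z" "mink z (- x) = - mink z x"
  "mink (c *\<^sub>R x) z = c * mink x z" "mink z (c *\<^sub>R x) = c * mink z x"
  "mink 0 z = 0" "mink z 0 = 0"
  by (simp_all add: mink_def algebra_simps)

lemma bounded_bilinear_mink: "bounded_bilinear mink"
  unfolding bilinear_conv_bounded_bilinear[symmetric] bilinear_def
  by (auto intro!: linearI simp: mink_linear_simps)

text \<open>Orthonormality provides a left inverse of the matrix of the frame. For square matrices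
  it is also a right inverse, and that is the completeness relation \<open>**\<close> of the
  frame.\<close>

lemma mink_orthonormal_expansion:
  assumes "mink e1 e1 = 1" "mink e2 e2 = -1" "mink e3 e3 = -1"
    "mink e1 e2 = 0" "mink e1 e3 = 0" "mink e2 e3 = 0"
  shows "mink u w = mink u e1 * mink w e1 - mink u e2 * mink w e2 - mink u e3 * mink w e3"
proof -
  define e where "e = (\<lambda>i::3. if i = 1 then e1 else if i = 2 then e2 else e3)"
  define \<eta> where "\<eta> = (\<lambda>i::3. if i = 1 then 1 else (-1::real))"
  have ne: "(2::3) \<noteq> 1" "(3::3) \<noteq> 1" "(3::3) \<noteq> 2" by auto
  have e: "e 1 = e1" "e 2 = e2" "e 3 = e3" and \<eta>: "\<eta> 1 = 1" "\<eta> 2 = -1" "\<eta> 3 = -1"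
    using ne by (auto simp: e_def \<eta>_def)
  have "(\<Sum>k\<in>UNIV. (\<eta> i * \<eta> k * e i $ k) * e j $ k) = (if i = j then 1 else 0)" for i j
    using exhaust_3[of i] exhaust_3[of j] assms ne
    by (elim disjE) (simp_all add: sum_3 e \<eta> mink_def algebra_simps)
  then have "(\<chi> i j. \<eta> i * \<eta> j * e i $ j) ** (\<chi> i j. e j $ i) = (mat 1 :: real^3^3)"
    by (simp add: matrix_matrix_mult_def mat_def vec_eq_iff)
  then have "(\<chi> i j. e j $ i) ** (\<chi> i j. \<eta> i * \<eta> j * e i $ j) = (mat 1 :: real^3^3)"
    using matrix_left_right_inverse by blast
  then have *: "(\<Sum>k\<in>UNIV. e k $ i * (\<eta> k * \<eta> j * e k $ j)) = (if i = j then 1 else 0)" for i j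
    by (simp add: matrix_matrix_mult_def mat_def vec_eq_iff)
  have **: "e1 $ i * e1 $ j - e2 $ i * e2 $ j - e3 $ i * e3 $ j = (if i = j then \<eta> j else 0)" for i j
    using *[of i j] exhaust_3[of j] by (auto simp: sum_3 e \<eta> split: if_splits)
  have "mink u e1 * mink w e1 - mink u e2 * mink w e2 - mink u e3 * mink w e3
     = (\<Sum>i\<in>UNIV. \<Sum>j\<in>UNIV. \<eta> i * \<eta> j * u $ i * w $ j * (e1 $ i * e1 $ j - e2 $ i * e2 $ j - e3 $ i * e3 $ j))"
    by (simp add: sum_3 \<eta> mink_def algebra_simps)
  also have "\<dots> = mink u w"
    unfolding ** using ne by (simp add: sum_3 \<eta> mink_def)
  finally show ?thesis by simp
qed

lemma tangent_mink_constant: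
  assumes v: "v \<in> tangent_space N p" and L: "bounded_linear L" "bounded_linear M"
    and c: "\<And>y. y \<in> N \<Longrightarrow> mink (L y) (M y) = c"
  shows "mink (L p) (M v) + mink (L v) (M p) = 0"
proof -
  obtain \<gamma> where g: "\<forall>t. \<gamma> t \<in> N" "\<gamma> 0 = p" "(\<gamma> has_vector_derivative v) (at (0::real))"
    using v unfolding tangent_space_def by blast
  have "((\<lambda>t. mink (L (\<gamma> t)) (M (\<gamma> t))) has_vector_derivative
      (mink (L (\<gamma> 0)) (M v) + mink (L v) (M (\<gamma> 0)))) (at 0)"
    by (intro bounded_bilinear.has_vector_derivative[OF bounded_bilinear_mink]
        bounded_linear.has_vector_derivative[OF L(1) g(3)] bounded_linear.has_vector_derivative[OF L(2) g(3)])
  moreover have "(\<lambda>t. mink (L (\<gamma> t)) (M (\<gamma> t))) = (\<lambda>t. c)" using g(1) c by auto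
  ultimately have "((\<lambda>t. c) has_vector_derivative (mink (L p) (M v) + mink (L v) (M p))) (at 0)"
    using g(2) by simp
  then show ?thesis
    using has_vector_derivative_const vector_derivative_unique_at by blast
qed

lemma tangent_FR:
  assumes "(x', a1, a2, a3) \<in> tangent_space FR (x, e1, e2, e3)"
  shows "mink a1 e1 = 0" "mink a2 e2 = 0" "mink a3 e3 = 0"
    "mink a1 e2 = - mink a2 e1" "mink a1 e3 = - mink a3 e1" "mink a2 e3 = - mink a3 e2"
proof -
  have bl: "bounded_linear (\<lambda>y::frame3. fst (snd y))" "bounded_linear (\<lambda>y::frame3. fst (snd (snd y)))"
    "bounded_linear (\<lambda>y::frame3. snd (snd (snd y)))"
    by (auto intro!: bounded_linear_fst_comp bounded_linear_snd_comp bounded_linear_fst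
        bounded_linear_snd bounded_linear_ident)
  note t = tangent_mink_constant[OF assms]
  have "mink e1 a1 + mink a1 e1 = 0" using t[OF bl(1) bl(1), of 1] by (auto simp: FR_def)
  moreover have "mink e2 a2 + mink a2 e2 = 0" using t[OF bl(2) bl(2), of "-1"] by (auto simp: FR_def)
  moreover have "mink e3 a3 + mink a3 e3 = 0" using t[OF bl(3) bl(3), of "-1"] by (auto simp: FR_def)
  moreover have "mink e1 a2 + mink a1 e2 = 0" using t[OF bl(1) bl(2), of 0] by (auto simp: FR_def)
  moreover have "mink e1 a3 + mink a1 e3 = 0" using t[OF bl(1) bl(3), of 0] by (auto simp: FR_def)
  moreover have "mink e2 a3 + mink a2 e3 = 0" using t[OF bl(2) bl(3), of 0] by (auto simp: FR_def)
  ultimately show "mink a1 e1 = 0" "mink a2 e2 = 0" "mink a3 e3 = 0"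
    "mink a1 e2 = - mink a2 e1" "mink a1 e3 = - mink a3 e1" "mink a2 e3 = - mink a3 e2"
    using mink_commute[of e1] mink_commute[of e2] mink_commute[of e3] by auto
qed

lemmas omega_defs = omega1_def omega2_def omega3_def omega12_def omega31_def omega32_def

lemma linear_omega:
  "linear (omega1 s)" "linear (omega2 s)" "linear (omega3 s)" "linear (omega12 s)"
  "linear (omega31 s)" "linear (omega32 s)"
  by (cases s; auto intro!: linearI simp: omega_defs mink_linear_simps)+

lemma bounded_linear_omega_at:
  "bounded_linear (\<lambda>s. omega1 s v)" "bounded_linear (\<lambda>s. omega2 s v)" "bounded_linear (\<lambda>s. omega3 s v)"
  "bounded_linear (\<lambda>s. omega12 s v)" "bounded_linear (\<lambda>s. omega31 s v)" "bounded_linear (\<lambda>s. omega32 s v)"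
  unfolding linear_conv_bounded_linear[symmetric]
  by (cases v; auto intro!: linearI simp: omega_defs mink_linear_simps)+

text \<open>The forms depend linearly on the base point, so \<open>ext_d\<close> is an explicit
  difference of two inner products of components. Expanded in the frame, each product keeps one
  summand, the others being zero by the tangency relations.\<close>

lemma omega_structure_equations:
  assumes s: "s \<in> FR" and v: "v \<in> tangent_space FR s" and w: "w \<in> tangent_space FR s"
  shows "ext_d omega31 s v w = - wedge omega32 omega12 s v w" (is ?s1)
    and "ext_d omega32 s v w = - wedge omega31 omega12 s v w" (is ?s2)
    and "ext_d omega12 s v w = - wedge omega31 omega32 s v w" (is ?s3)
proof -
  obtain x e1 e2 e3 where s': "s = (x, e1, e2, e3)" by (metis prod.exhaust)
  obtain v0 v1 v2 v3 where v': "v = (v0, v1, v2, v3)" by (metis prod.exhaust)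
  obtain w0 w1 w2 w3 where w': "w = (w0, w1, w2, w3)" by (metis prod.exhaust)
  have ex: "mink u w = mink u e1 * mink w e1 - mink u e2 * mink w e2 - mink u e3 * mink w e3" for u w
    using s unfolding s' FR_def by (intro mink_orthonormal_expansion) auto
  note tv = tangent_FR[OF v[unfolded v' s']] and tw = tangent_FR[OF w[unfolded w' s']]
  have "ext_d omega31 s v w = mink v1 w3 - mink w1 v3"
    by (simp add: ext_d_differential differential_bounded_linear[OF bounded_linear_omega_at(5)])
      (simp add: omega_defs v' w')
  then show ?s1
    using tv tw ex[of v1 w3] ex[of w1 v3] by (simp add: wedge_def omega_defs s' v' w' algebra_simps)
  have "ext_d omega32 s v w = mink v2 w3 - mink w2 v3"
    by (simp add: ext_d_differential differential_bounded_linear[OF bounded_linear_omega_at(6)])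
      (simp add: omega_defs v' w')
  then show ?s2
    using tv tw ex[of v2 w3] ex[of w2 v3] by (simp add: wedge_def omega_defs s' v' w' algebra_simps)
  have "ext_d omega12 s v w = mink w2 v1 - mink v2 w1"
    by (simp add: ext_d_differential differential_bounded_linear[OF bounded_linear_omega_at(4)])
      (simp add: omega_defs v' w')
  then show ?s3
    using tv tw ex[of w2 v1] ex[of v2 w1] by (simp add: wedge_def omega_defs s' v' w' algebra_simps)
qed

text \<open>The frame of \<open>FR\<close> dual to \<open>\<omega>\<^sup>1, \<omega>\<^sup>2, \<omega>\<^sup>3, \<omega>\<^sup>1\<^sub>2, \<omega>\<^sup>3\<^sub>1, \<omega>\<^sup>3\<^sub>2\<close>.\<close>

definition fr_e1 :: "frame3 \<Rightarrow> frame3" where "fr_e1 = (\<lambda>(x, e1, e2, e3). (e1, 0, 0, 0))"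
definition fr_e2 :: "frame3 \<Rightarrow> frame3" where "fr_e2 = (\<lambda>(x, e1, e2, e3). (e2, 0, 0, 0))"
definition fr_e3 :: "frame3 \<Rightarrow> frame3" where "fr_e3 = (\<lambda>(x, e1, e2, e3). (e3, 0, 0, 0))"
definition fr_12 :: "frame3 \<Rightarrow> frame3" where "fr_12 = (\<lambda>(x, e1, e2, e3). (0, e2, e1, 0))"
definition fr_31 :: "frame3 \<Rightarrow> frame3" where "fr_31 = (\<lambda>(x, e1, e2, e3). (0, e3, 0, e1))"
definition fr_32 :: "frame3 \<Rightarrow> frame3" where "fr_32 = (\<lambda>(x, e1, e2, e3). (0, 0, e3, - e2))"

lemmas fr_defs = fr_e1_def fr_e2_def fr_e3_def fr_12_def fr_31_def fr_32_def

abbreviation "fr_fields \<equiv> {fr_e1, fr_e2, fr_e3, fr_12, fr_31, fr_32}"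

lemma linear_fr:
  "linear fr_e1" "linear fr_e2" "linear fr_e3" "linear fr_12" "linear fr_31" "linear fr_32"
  by (auto intro!: linearI simp: fr_defs)

text \<open>The curves are translations of the base point, boosts in the planes of e1, e2 and of e1,
  e3, and a rotation in the negative definite plane of e2, e3.\<close>

lemma fr_tangent:
  assumes s: "s \<in> FR"
  shows "fr_e1 s \<in> tangent_space FR s" "fr_e2 s \<in> tangent_space FR s" "fr_e3 s \<in> tangent_space FR s"
    "fr_12 s \<in> tangent_space FR s" "fr_31 s \<in> tangent_space FR s" "fr_32 s \<in> tangent_space FR s"
proof -
  obtain x e1 e2 e3 where s': "s = (x, e1, e2, e3)" by (metis prod.exhaust)
  have o: "mink e1 e1 = 1" "mink e2 e2 = -1" "mink e3 e3 = -1" "mink e1 e2 = 0" "mink e1 e3 = 0" "mink e2 e3 = 0"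
    "mink e2 e1 = 0" "mink e3 e1 = 0" "mink e3 e2 = 0"
    using s mink_commute unfolding s' FR_def by auto
  have tr: "(u, 0, 0, 0) \<in> tangent_space FR s" for u
    unfolding tangent_space_def
  proof (intro CollectI exI conjI allI)
    show "(x + t *\<^sub>R u, e1, e2, e3) \<in> FR" for t using s by (simp add: s' FR_def)
    show "((\<lambda>t. (x + t *\<^sub>R u, e1, e2, e3)) has_vector_derivative (u, 0, 0, 0)) (at 0)"
      by (intro has_vector_derivative_Pair has_vector_derivative_const) (auto intro!: derivative_eq_intros)
  qed (simp add: s')
  then show "fr_e1 s \<in> tangent_space FR s" "fr_e2 s \<in> tangent_space FR s" "fr_e3 s \<in> tangent_space FR s"
    by (simp_all add: s' fr_defs)
  have ch: "((\<lambda>t. cosh t *\<^sub>R a + sinh t *\<^sub>R b) has_vector_derivative b) (at 0)"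
    "((\<lambda>t. cos t *\<^sub>R a + sin t *\<^sub>R b) has_vector_derivative b) (at 0)" for a b :: "real^3"
    by (auto intro!: derivative_eq_intros)
  have sq: "(cosh t)\<^sup>2 - (sinh t)\<^sup>2 = 1" "(sin t)\<^sup>2 + (cos t)\<^sup>2 = 1" for t :: real
    using hyperbolic_pythagoras[of t] by simp_all
  have sq': "cosh t * cosh t = sinh t * sinh t + 1" "cos t * cos t = 1 - sin t * sin t" for t :: real
    using sq[of t] by (simp_all add: power2_eq_square)
  show "fr_12 s \<in> tangent_space FR s"
    unfolding tangent_space_def
  proof (intro CollectI exI conjI allI)
    show "(x, cosh t *\<^sub>R e1 + sinh t *\<^sub>R e2, cosh t *\<^sub>R e2 + sinh t *\<^sub>R e1, e3) \<in> FR" for t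
      by (simp add: FR_def mink_linear_simps o sq' algebra_simps)
    show "((\<lambda>t. (x, cosh t *\<^sub>R e1 + sinh t *\<^sub>R e2, cosh t *\<^sub>R e2 + sinh t *\<^sub>R e1, e3))
        has_vector_derivative fr_12 s) (at 0)"
      unfolding s' fr_defs prod.case by (intro has_vector_derivative_Pair has_vector_derivative_const ch)
  qed (simp add: s')
  show "fr_31 s \<in> tangent_space FR s"
    unfolding tangent_space_def
  proof (intro CollectI exI conjI allI)
    show "(x, cosh t *\<^sub>R e1 + sinh t *\<^sub>R e3, e2, cosh t *\<^sub>R e3 + sinh t *\<^sub>R e1) \<in> FR" for t
      by (simp add: FR_def mink_linear_simps o sq' algebra_simps)
    show "((\<lambda>t. (x, cosh t *\<^sub>R e1 + sinh t *\<^sub>R e3, e2, cosh t *\<^sub>R e3 + sinh t *\<^sub>R e1))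
        has_vector_derivative fr_31 s) (at 0)"
      unfolding s' fr_defs prod.case by (intro has_vector_derivative_Pair has_vector_derivative_const ch)
  qed (simp add: s')
  show "fr_32 s \<in> tangent_space FR s"
    unfolding tangent_space_def
  proof (intro CollectI exI conjI allI)
    show "(x, e1, cos t *\<^sub>R e2 + sin t *\<^sub>R e3, cos t *\<^sub>R e3 + sin t *\<^sub>R (- e2)) \<in> FR" for t
      by (simp add: FR_def mink_linear_simps o sq' algebra_simps)
    show "((\<lambda>t. (x, e1, cos t *\<^sub>R e2 + sin t *\<^sub>R e3, cos t *\<^sub>R e3 + sin t *\<^sub>R (- e2)))
        has_vector_derivative fr_32 s) (at 0)"
      unfolding s' fr_defs prod.case by (intro has_vector_derivative_Pair has_vector_derivative_const ch)
  qed (simp add: s')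
qed

lemma omega_fr:
  assumes "s \<in> FR"
  shows "omega1 s (fr_e1 s) = 1" "omega2 s (fr_e1 s) = 0" "omega3 s (fr_e1 s) = 0"
    "omega12 s (fr_e1 s) = 0" "omega31 s (fr_e1 s) = 0" "omega32 s (fr_e1 s) = 0"
    "omega1 s (fr_e2 s) = 0" "omega2 s (fr_e2 s) = 1" "omega3 s (fr_e2 s) = 0"
    "omega12 s (fr_e2 s) = 0" "omega31 s (fr_e2 s) = 0" "omega32 s (fr_e2 s) = 0"
    "omega1 s (fr_e3 s) = 0" "omega2 s (fr_e3 s) = 0" "omega3 s (fr_e3 s) = 1"
    "omega12 s (fr_e3 s) = 0" "omega31 s (fr_e3 s) = 0" "omega32 s (fr_e3 s) = 0"
    "omega1 s (fr_12 s) = 0" "omega2 s (fr_12 s) = 0" "omega3 s (fr_12 s) = 0"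
    "omega12 s (fr_12 s) = 1" "omega31 s (fr_12 s) = 0" "omega32 s (fr_12 s) = 0"
    "omega1 s (fr_31 s) = 0" "omega2 s (fr_31 s) = 0" "omega3 s (fr_31 s) = 0"
    "omega12 s (fr_31 s) = 0" "omega31 s (fr_31 s) = 1" "omega32 s (fr_31 s) = 0"
    "omega1 s (fr_32 s) = 0" "omega2 s (fr_32 s) = 0" "omega3 s (fr_32 s) = 0"
    "omega12 s (fr_32 s) = 0" "omega31 s (fr_32 s) = 0" "omega32 s (fr_32 s) = 1"
  using assms mink_commute
  by (auto simp: omega_defs fr_defs FR_def mink_linear_simps split: prod.splits)

text \<open>The fields are linear maps of the ambient space, so these commutators are Lie brackets
  up to the order of the factors, see \<open>lie_bracket_vf\<close> and
  \<open>lie_bracket_Y_vf\<close>.\<close>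

lemma fr_commutators:
  "fr_e1 (fr_e1 s) = 0" "fr_e1 (fr_e2 s) = 0" "fr_e1 (fr_e3 s) = 0"
  "fr_e2 (fr_e1 s) = 0" "fr_e2 (fr_e2 s) = 0" "fr_e2 (fr_e3 s) = 0"
  "fr_e3 (fr_e1 s) = 0" "fr_e3 (fr_e2 s) = 0" "fr_e3 (fr_e3 s) = 0"
  "fr_12 (fr_e1 s) - fr_e1 (fr_12 s) = - fr_e2 s"
  "fr_12 (fr_e2 s) - fr_e2 (fr_12 s) = - fr_e1 s"
  "fr_31 (fr_e1 s) - fr_e1 (fr_31 s) = - fr_e3 s"
  "fr_31 (fr_e2 s) - fr_e2 (fr_31 s) = 0"
  "fr_32 (fr_e1 s) - fr_e1 (fr_32 s) = 0"
  "fr_32 (fr_e2 s) - fr_e2 (fr_32 s) = - fr_e3 s"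
  "fr_e1 (fr_31 s) - fr_31 (fr_e1 s) = fr_e3 s"
  "fr_e2 (fr_31 s) - fr_31 (fr_e2 s) = 0"
  "fr_e3 (fr_31 s) - fr_31 (fr_e3 s) = fr_e1 s"
  "fr_12 (fr_31 s) - fr_31 (fr_12 s) = fr_32 s"
  "fr_e1 (fr_32 s) - fr_32 (fr_e1 s) = 0"
  "fr_e2 (fr_32 s) - fr_32 (fr_e2 s) = fr_e3 s"
  "fr_e3 (fr_32 s) - fr_32 (fr_e3 s) = - fr_e2 s"
  "fr_12 (fr_32 s) - fr_32 (fr_12 s) = fr_31 s"
  "fr_32 (fr_31 s) - fr_31 (fr_32 s) = fr_12 s"
  "fr_31 (fr_32 s) - fr_32 (fr_31 s) = - fr_12 s"
  by (cases s; simp add: fr_defs zero_prod_def)+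

section \<open>The frame bundle of a Lorentzian surface\<close>

lemma smooth_on_sum:
  "open S \<Longrightarrow> (\<And>i. i \<in> I \<Longrightarrow> smooth_on S (f i)) \<Longrightarrow> smooth_on S (\<lambda>x. \<Sum>i\<in>I. f i x)"
  by (induction I rule: infinite_finite_induct) (simp_all add: smooth_on_const smooth_on_add)

lemma ext_d_differential_eq_0:
  fixes f :: "'e::real_normed_vector \<Rightarrow> real"
  assumes "open U" "p \<in> U" "smooth_on U f"
  shows "ext_d (differential f) p v w = 0"
proof -
  have "(\<lambda>x. differential f x v) differentiable (at p)" for v
    by (rule smooth_on_differentiable[OF smooth_on_differential[OF assms(3)] assms(2)])
  then show ?thesis
    using differential_symmetric[OF assms(1,2) smooth_on_differentiable[OF assms(3)]]
    by (simp add: ext_d_differential)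
qed

text \<open>The connection form is given by its structure equations, not by a formula; its value on
  vertical vectors has to be derived from them in \<open>\<phi>_vert\<close>.\<close>

locale lorentzian_chart =
  fixes g :: "'m metric" and c :: "'m chart" and \<eta>12 :: "'m chart \<Rightarrow> (frame2, real) form1"
  assumes open_chart: "open (chart_image c)"
    and bilinear_g: "\<And>x. x \<in> chart_image c \<Longrightarrow> bilinear (g c x)"
    and g_commute: "\<And>x u v. x \<in> chart_image c \<Longrightarrow> g c x u v = g c x v u"
    and smooth_g: "\<And>u v. smooth_on (chart_image c) (\<lambda>x. g c x u v)"
    and smooth_\<eta>12: "smooth_form (FM_ambient c) (\<eta>12 c)"
    and structure_eta1: "\<And>p v w. p \<in> FM g c \<Longrightarrow> v \<in> tangent_space (FM g c) p \<Longrightarrow>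
      w \<in> tangent_space (FM g c) p \<Longrightarrow> ext_d (eta1 g c) p v w = - wedge (\<eta>12 c) (eta2 g c) p v w"
    and structure_eta2: "\<And>p v w. p \<in> FM g c \<Longrightarrow> v \<in> tangent_space (FM g c) p \<Longrightarrow>
      w \<in> tangent_space (FM g c) p \<Longrightarrow> ext_d (eta2 g c) p v w = - wedge (\<eta>12 c) (eta1 g c) p v w"
begin

abbreviation "U0 \<equiv> FM_ambient c"
abbreviation "M \<equiv> FM g c"
abbreviation "\<phi> \<equiv> \<eta>12 c"
abbreviation "TM \<equiv> tangent_space (FM g c)"
abbreviation (input) "v1 y \<equiv> fst (snd y)" for y :: frame2
abbreviation (input) "v2 y \<equiv> snd (snd y)" for y :: frame2

lemma open_U0: "open U0"
  using open_chart by (simp add: FM_ambient_def open_Times)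

lemma mem_U0: "y \<in> U0 \<longleftrightarrow> fst y \<in> chart_image c"
  by (cases y) (auto simp: FM_ambient_def)

lemma g_simps:
  assumes "x \<in> chart_image c"
  shows "g c x (a + b) d = g c x a d + g c x b d" "g c x d (a + b) = g c x d a + g c x d b"
    "g c x (a - b) d = g c x a d - g c x b d" "g c x d (a - b) = g c x d a - g c x d b"
    "g c x (r *\<^sub>R a) d = r * g c x a d" "g c x d (r *\<^sub>R a) = r * g c x d a"
    "g c x (- a) d = - g c x a d" "g c x d (- a) = - g c x d a"
    "g c x 0 d = 0" "g c x d 0 = 0"
  using bilinear_g[OF assms]
  by (simp_all add: bilinear_ladd bilinear_radd bilinear_lsub bilinear_rsub bilinear_lmul bilinear_rmul
      bilinear_lneg bilinear_rneg bilinear_lzero bilinear_rzero)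

lemma linear_g:
  assumes "x \<in> chart_image c"
  shows "linear (\<lambda>u. g c x u v)" "linear (\<lambda>v. g c x u v)"
  by (auto intro!: linearI simp: g_simps[OF assms])

lemma bounded_linear_components:
  "bounded_linear (\<lambda>y::frame2. fst y)" "bounded_linear (\<lambda>y::frame2. v1 y)" "bounded_linear (\<lambda>y::frame2. v2 y)"
  by (auto intro!: bounded_linear_fst_comp bounded_linear_snd_comp bounded_linear_fst
      bounded_linear_snd bounded_linear_ident)

lemma differentiable_components:
  "(\<lambda>y::frame2. fst y) differentiable (at p)" "(\<lambda>y::frame2. v1 y) differentiable (at p)"
  "(\<lambda>y::frame2. v2 y) differentiable (at p)"
  by (rule bounded_linear_imp_differentiable[OF bounded_linear_components(1)]
      bounded_linear_imp_differentiable[OF bounded_linear_components(2)]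
      bounded_linear_imp_differentiable[OF bounded_linear_components(3)])+

lemmas differential_components = bounded_linear_components[THEN differential_bounded_linear]

definition dg :: "real^2 \<Rightarrow> real^2 \<Rightarrow> real^2 \<Rightarrow> real^2 \<Rightarrow> real" where
  "dg x w u v = differential (\<lambda>x. g c x u v) x w"

lemma differentiable_g: "x \<in> chart_image c \<Longrightarrow> (\<lambda>x. g c x u v) differentiable (at x)"
  by (rule smooth_on_differentiable[OF smooth_g])

text \<open>In the metric arguments, linearity comes from differentiating the linearity of the
  metric itself, which holds on the whole open chart image.\<close>

lemma linear_dg:
  assumes x: "x \<in> chart_image c"
  shows "linear (\<lambda>w. dg x w u v)" "linear (\<lambda>u. dg x w u v)" "linear (\<lambda>v. dg x w u v)"
proof -
  note d = differentiable_g[OF x]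
  show "linear (\<lambda>w. dg x w u v)"
    using linear_differential[OF d, of u v] by (simp add: dg_def[abs_def] cong del: if_weak_cong)
  have cong: "differential f x = differential h x" if "\<And>y. y \<in> chart_image c \<Longrightarrow> f y = h y" for f h :: "real^2 \<Rightarrow> real"
    by (rule differential_cong_open[OF open_chart x that])
  have add: "differential (\<lambda>y. g c y a d + g c y b e) x w = dg x w a d + dg x w b e" for a b d e
    unfolding dg_def by (rule differential_add[OF d d])
  have mul: "differential (\<lambda>y. r * g c y a b) x w = r * dg x w a b" for r a b
    using differential_mult[OF differentiable_const d, of r a b w] by (simp add: dg_def)
  show "linear (\<lambda>u. dg x w u v)"
  proof (rule linearI)
    show "dg x w (a + b) v = dg x w a v + dg x w b v" for a b
      unfolding add[symmetric] unfolding dg_def by (rule fun_cong[OF cong]) (simp add: g_simps)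
    show "dg x w (r *\<^sub>R a) v = r *\<^sub>R dg x w a v" for r a
      unfolding real_scaleR_def mul[symmetric] unfolding dg_def by (rule fun_cong[OF cong]) (simp add: g_simps)
  qed
  show "linear (\<lambda>v. dg x w u v)"
  proof (rule linearI)
    show "dg x w u (a + b) = dg x w u a + dg x w u b" for a b
      unfolding add[symmetric] unfolding dg_def by (rule fun_cong[OF cong]) (simp add: g_simps)
    show "dg x w u (r *\<^sub>R a) = r *\<^sub>R dg x w u a" for r a
      unfolding real_scaleR_def mul[symmetric] unfolding dg_def by (rule fun_cong[OF cong]) (simp add: g_simps)
  qed
qed

lemma dg_0: "x \<in> chart_image c \<Longrightarrow> dg x 0 u v = 0" "x \<in> chart_image c \<Longrightarrow> dg x w 0 v = 0"
    "x \<in> chart_image c \<Longrightarrow> dg x w u 0 = 0"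
  using linear_0[OF linear_dg(1)] linear_0[OF linear_dg(2)] linear_0[OF linear_dg(3)] by blast+

lemma dg_commute: "x \<in> chart_image c \<Longrightarrow> dg x w u v = dg x w v u"
  unfolding dg_def
  by (rule fun_cong[OF differential_cong_open[OF open_chart]]) (auto intro: g_commute)

lemma g_along:
  assumes p: "p \<in> U0" and a: "a differentiable (at p)" and b: "b differentiable (at p)"
  shows "(\<lambda>y. g c (fst y) (a y) (b y)) differentiable (at p)"
    and "differential (\<lambda>y. g c (fst y) (a y) (b y)) p h = dg (fst p) (fst h) (a p) (b p)
      + g c (fst p) (differential a p h) (b p) + g c (fst p) (a p) (differential b p h)"
proof -
  have x: "fst p \<in> chart_image c" using p by (simp add: mem_U0)
  have 1: "(\<lambda>y. g c (fst y) u v) differentiable (at p)"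
      "differential (\<lambda>y. g c (fst y) u v) p h = dg (fst p) (fst h) u v" for u v
    using differential_precompose_bounded_linear[OF bounded_linear_components(1), of "\<lambda>x. g c x u v" p]
      differentiable_g[OF x] by (simp_all add: dg_def)
  have lin: "linear (\<lambda>u. g c (fst y) u v)" if "y \<in> U0" for y v
    using that by (simp add: linear_g mem_U0)
  have 2: "(\<lambda>y. g c (fst y) (a y) v) differentiable (at p)"
      "differential (\<lambda>y. g c (fst y) (a y) v) p h =
        dg (fst p) (fst h) (a p) v + g c (fst p) (differential a p h) v" for v
    using differentiable_form_field[OF open_U0 p lin 1(1) a] differential_form_field[OF open_U0 p lin 1(1) a]
    by (simp_all add: 1)
  have lin': "linear (g c (fst y) (a y))" if "y \<in> U0" for y
    using that linear_g(2) by (simp add: mem_U0)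
  show "(\<lambda>y. g c (fst y) (a y) (b y)) differentiable (at p)"
    by (rule differentiable_form_field[OF open_U0 p lin' 2(1) b])
  show "differential (\<lambda>y. g c (fst y) (a y) (b y)) p h = dg (fst p) (fst h) (a p) (b p)
      + g c (fst p) (differential a p h) (b p) + g c (fst p) (a p) (differential b p h)"
    using differential_form_field[OF open_U0 p lin' 2(1) b] by (simp add: 2)
qed

lemma dg_along:
  assumes p: "p \<in> U0" and w: "w differentiable (at p)" and a: "a differentiable (at p)" and b: "b differentiable (at p)"
  shows "(\<lambda>y. dg (fst y) (w y) (a y) (b y)) differentiable (at p)"
proof -
  have x: "fst p \<in> chart_image c" using p by (simp add: mem_U0)
  have 0: "(\<lambda>y. dg (fst y) w u v) differentiable (at p)" for w u v
    unfolding dg_def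
    by (rule differential_precompose_bounded_linear(1)[OF bounded_linear_components(1)])
      (rule smooth_on_differentiable[OF smooth_on_differential[OF smooth_g] x])
  have l: "linear (\<lambda>w. dg (fst y) w u v)" "linear (\<lambda>u. dg (fst y) z u v)" "linear (\<lambda>v. dg (fst y) z u v)"
    if "y \<in> U0" for y z u v
    using that by (simp_all add: linear_dg mem_U0)
  have 1: "(\<lambda>y. dg (fst y) (w y) u v) differentiable (at p)" for u v
    by (rule differentiable_form_field[OF open_U0 p l(1) 0 w])
  have 2: "(\<lambda>y. dg (fst y) (w y) (a y) v) differentiable (at p)" for v
    by (rule differentiable_form_field[OF open_U0 p l(2) 1 a])
  show ?thesis
    by (rule differentiable_form_field[OF open_U0 p l(3) 2 b])
qed

lemma smooth_g_along:
  assumes "smooth_on U0 a" "smooth_on U0 b"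
  shows "smooth_on U0 (\<lambda>y. g c (fst y) (a y) (b y))"
proof -
  have ex: "g c (fst y) (a y) (b y) = (\<Sum>i\<in>Basis. \<Sum>j\<in>Basis. (a y \<bullet> i) * ((b y \<bullet> j) * g c (fst y) i j))"
    if "y \<in> U0" for y
  proof -
    have x: "fst y \<in> chart_image c" using that by (simp add: mem_U0)
    have "g c (fst y) (\<Sum>i\<in>Basis. (a y \<bullet> i) *\<^sub>R i) (\<Sum>j\<in>Basis. (b y \<bullet> j) *\<^sub>R j)
       = (\<Sum>i\<in>Basis. \<Sum>j\<in>Basis. (a y \<bullet> i) * ((b y \<bullet> j) * g c (fst y) i j))"
      unfolding linear_sum[OF linear_g(1)[OF x]] linear_sum[OF linear_g(2)[OF x]]
      by (simp add: g_simps[OF x]) (subst sum.swap, simp add: mult.left_commute)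
    then show ?thesis by (simp add: euclidean_representation)
  qed
  have gij: "smooth_on U0 (\<lambda>y. g c (fst y) i j)" for i j
    by (rule smooth_on_precompose_bounded_linear[OF open_U0 bounded_linear_components(1) _ smooth_g])
      (simp add: mem_U0)
  have "smooth_on U0 (\<lambda>y. \<Sum>i\<in>Basis. \<Sum>j\<in>Basis. (a y \<bullet> i) * ((b y \<bullet> j) * g c (fst y) i j))"
    by (intro smooth_on_sum smooth_on_mult open_U0 gij
        smooth_on_compose_bounded_linear[OF open_U0 bounded_linear_inner_left] assms)
  then show ?thesis
    by (rule smooth_on_cong[OF open_U0, rotated]) (rule ex[symmetric])
qed

text \<open>The entries of the Gram matrix are extended to arbitrary pairs of vectors. The frame
  bundle becomes a level set of them, and its tangent spaces are the common kernels of their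
  differentials.\<close>

definition gram11 :: "frame2 \<Rightarrow> real" where "gram11 y = g c (fst y) (v1 y) (v1 y)"
definition gram12 :: "frame2 \<Rightarrow> real" where "gram12 y = g c (fst y) (v1 y) (v2 y)"
definition gram22 :: "frame2 \<Rightarrow> real" where "gram22 y = g c (fst y) (v2 y) (v2 y)"

lemma FM_iff: "y \<in> M \<longleftrightarrow> y \<in> U0 \<and> gram11 y = 1 \<and> gram22 y = -1 \<and> gram12 y = 0"
  by (cases y) (auto simp: FM_def FM_ambient_def gram11_def gram12_def gram22_def)

lemma FM_subset: "y \<in> M \<Longrightarrow> y \<in> U0" "y \<in> M \<Longrightarrow> fst y \<in> chart_image c"
  using FM_iff mem_U0 by blast+

lemma FM_gram:
  assumes "y \<in> M"
  shows "g c (fst y) (v1 y) (v1 y) = 1" "g c (fst y) (v2 y) (v2 y) = -1"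
    "g c (fst y) (v1 y) (v2 y) = 0" "g c (fst y) (v2 y) (v1 y) = 0"
  using assms g_commute[OF FM_subset(2)[OF assms], of "v2 y" "v1 y"]
  by (simp_all add: FM_iff gram11_def gram12_def gram22_def)

lemma smooth_gram: "smooth_on U0 gram11" "smooth_on U0 gram12" "smooth_on U0 gram22"
  unfolding gram11_def[abs_def] gram12_def[abs_def] gram22_def[abs_def]
  by (intro smooth_g_along smooth_on_bounded_linear bounded_linear_components)+

lemma differential_gram:
  assumes "p \<in> U0"
  shows "differential gram11 p h = dg (fst p) (fst h) (v1 p) (v1 p) + 2 * g c (fst p) (v1 p) (v1 h)"
    "differential gram12 p h = dg (fst p) (fst h) (v1 p) (v2 p) + g c (fst p) (v1 h) (v2 p) + g c (fst p) (v1 p) (v2 h)"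
    "differential gram22 p h = dg (fst p) (fst h) (v2 p) (v2 p) + 2 * g c (fst p) (v2 p) (v2 h)"
  unfolding gram11_def[abs_def] gram12_def[abs_def] gram22_def[abs_def]
  using assms g_commute[of "fst p"]
  by (simp_all add: g_along(2)[OF assms] differentiable_components differential_components mem_U0)

lemma tangent_FM_gram:
  assumes "p \<in> M" "v \<in> TM p"
  shows "differential gram11 p v = 0" "differential gram12 p v = 0" "differential gram22 p v = 0"
proof -
  note s = smooth_gram[THEN smooth_on_differentiable, OF FM_subset(1)[OF assms(1)]]
  note t = differential_cong_tangent[OF assms(2) open_UNIV UNIV_I _ differentiable_const]
  show "differential gram11 p v = 0" using t[OF s(1), of 1] FM_iff by simp
  show "differential gram12 p v = 0" using t[OF s(2), of 0] FM_iff by simp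
  show "differential gram22 p v = 0" using t[OF s(3), of "-1"] FM_iff by simp
qed

text \<open>Gram--Schmidt applied to the straight line \<open>p + t v\<close> gives a curve in the frame bundle;
  its velocity is still \<open>v\<close>, as the Gram matrix is constant along the line to first order.\<close>

lemma tangent_FM_I:
  assumes p: "p \<in> M"
    and v: "differential gram11 p v = 0" "differential gram12 p v = 0" "differential gram22 p v = 0"
  shows "v \<in> TM p"
proof -
  define y where "y = (\<lambda>t::real. p + t *\<^sub>R v)"
  have y0: "y 0 = p" by (simp add: y_def)
  have pU: "p \<in> U0" using FM_subset p by blast
  have dline: "((\<lambda>t. f (y t)) has_real_derivative 0) (at 0)"
    if "smooth_on U0 f" "differential f p v = 0" for f
  proof -
    have "f differentiable (at p)" by (rule smooth_on_differentiable[OF that(1) pU])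
    then have a: "(f has_derivative differential f p) (at (y 0))" and l: "linear (differential f p)"
      using y0 by (simp_all add: has_derivative_differential linear_differential)
    have b: "(y has_derivative (\<lambda>t. t *\<^sub>R v)) (at 0)"
      unfolding y_def by (auto intro!: derivative_eq_intros)
    show ?thesis
      using has_derivative_compose[OF b a] that(2) l
      by (simp add: has_field_derivative_def linear_cmul lambda_zero)
  qed
  define a where "a = (\<lambda>t. gram11 (y t))"
  define b where "b = (\<lambda>t. gram12 (y t))"
  define d where "d = (\<lambda>t. gram22 (y t))"
  have da: "(a has_real_derivative 0) (at 0)" and db: "(b has_real_derivative 0) (at 0)"
    and dd: "(d has_real_derivative 0) (at 0)"
    unfolding a_def b_def d_def using dline smooth_gram v by blast+
  have a0: "a 0 = 1" and b0: "b 0 = 0" and d0: "d 0 = -1"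
    using p by (simp_all add: a_def b_def d_def y0 FM_iff)
  define s where "s = (\<lambda>t. 1 / sqrt (a t))"
  define r where "r = (\<lambda>t. b t / a t)"
  \<comment> \<open>Minus the square of the part of the second vector orthogonal to the first; it is
    1 at time 0, so its root can be divided by near 0.\<close>
  define e where "e = (\<lambda>t. (b t)\<^sup>2 / a t - d t)"
  define z where "z = (\<lambda>t. 1 / sqrt (e t))"
  have de: "(e has_real_derivative 0) (at 0)"
    unfolding e_def by (rule derivative_eq_intros da db dd refl | simp add: a0 b0)+
  have e0: "e 0 = 1" by (simp add: e_def a0 b0 d0)
  have ds: "(s has_real_derivative 0) (at 0)"
    unfolding s_def by (rule derivative_eq_intros da refl | simp add: a0)+
  have dr: "(r has_real_derivative 0) (at 0)"
    unfolding r_def by (rule derivative_eq_intros da db refl | simp add: a0)+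
  have dz: "(z has_real_derivative 0) (at 0)"
    unfolding z_def by (rule derivative_eq_intros de refl | simp add: e0)+
  define \<gamma> where "\<gamma> = (\<lambda>t. (fst p + t *\<^sub>R fst v, s t *\<^sub>R (v1 p + t *\<^sub>R v1 v),
     z t *\<^sub>R ((v2 p + t *\<^sub>R v2 v) - r t *\<^sub>R (v1 p + t *\<^sub>R v1 v))))"
  have lines: "((\<lambda>t. u + t *\<^sub>R w) has_vector_derivative w) (at 0)" for u w :: "real^2"
    by (auto intro!: derivative_eq_intros)
  have "(\<gamma> has_vector_derivative (fst v, v1 v, v2 v)) (at 0)"
    unfolding \<gamma>_def
  proof (intro has_vector_derivative_Pair lines)
    show "((\<lambda>t. s t *\<^sub>R (v1 p + t *\<^sub>R v1 v)) has_vector_derivative v1 v) (at 0)"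
      using has_vector_derivative_scaleR[OF ds lines[of "v1 p" "v1 v"]] by (simp add: s_def a0)
    have "((\<lambda>t. r t *\<^sub>R (v1 p + t *\<^sub>R v1 v)) has_vector_derivative 0) (at 0)"
      using has_vector_derivative_scaleR[OF dr lines[of "v1 p" "v1 v"]] by (simp add: r_def b0)
    from has_vector_derivative_scaleR[OF dz has_vector_derivative_diff[OF lines[of "v2 p" "v2 v"] this]]
    show "((\<lambda>t. z t *\<^sub>R ((v2 p + t *\<^sub>R v2 v) - r t *\<^sub>R (v1 p + t *\<^sub>R v1 v))) has_vector_derivative v2 v) (at 0)"
      by (simp add: z_def e0)
  qed
  then have d\<gamma>: "(\<gamma> has_vector_derivative v) (at 0)" by simp
  have \<gamma>0: "\<gamma> 0 = p" by (simp add: \<gamma>_def s_def r_def z_def a0 b0 e0)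
  have "a \<midarrow>0\<rightarrow> 1" "e \<midarrow>0\<rightarrow> 1"
    using DERIV_isCont[OF da] DERIV_isCont[OF de] a0 e0 by (simp_all add: isCont_def)
  then have "\<forall>\<^sub>F t in at 0. a t > 0" "\<forall>\<^sub>F t in at 0. e t > 0"
    by (auto intro: order_tendstoD(1))
  moreover have "\<forall>\<^sub>F t in at 0. fst p + t *\<^sub>R fst v \<in> chart_image c"
  proof -
    have "((\<lambda>t. fst p + t *\<^sub>R fst v) \<longlongrightarrow> fst p) (at 0)"
      by (auto intro!: tendsto_eq_intros)
    then show ?thesis
      using open_chart FM_subset(2)[OF p] topological_tendstoD by blast
  qed
  ultimately have "\<forall>\<^sub>F t in at 0. a t > 0 \<and> e t > 0 \<and> fst p + t *\<^sub>R fst v \<in> chart_image c"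
    by eventually_elim simp
  then obtain \<delta> where \<delta>: "\<delta> > 0" "\<And>t. t \<noteq> 0 \<Longrightarrow> \<bar>t\<bar> < \<delta> \<Longrightarrow>
      a t > 0 \<and> e t > 0 \<and> fst p + t *\<^sub>R fst v \<in> chart_image c"
    unfolding eventually_at by (auto simp: dist_real_def)
  have "\<gamma> t \<in> M" if t: "\<bar>t\<bar> < \<delta>" for t
  proof (cases "t = 0")
    case True
    then show ?thesis using \<gamma>0 p by simp
  next
    case False
    then have at: "a t > 0" "e t > 0" and x: "fst p + t *\<^sub>R fst v \<in> chart_image c"
      using \<delta>(2) t by auto
    let ?x = "fst p + t *\<^sub>R fst v" and ?a = "v1 p + t *\<^sub>R v1 v" and ?b = "v2 p + t *\<^sub>R v2 v"
    have gr: "g c ?x ?a ?a = a t" "g c ?x ?a ?b = b t" "g c ?x ?b ?a = b t" "g c ?x ?b ?b = d t"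
      using g_commute[OF x] by (simp_all add: a_def b_def d_def y_def gram11_def gram12_def gram22_def)
    have ss: "s t * s t = 1 / a t" "z t * z t = 1 / e t"
      using at by (simp_all add: s_def z_def)
    have rr: "r t * a t = b t" "e t = b t * r t - d t"
      using at by (simp_all add: r_def e_def power2_eq_square)
    have "g c ?x (s t *\<^sub>R ?a) (s t *\<^sub>R ?a) = s t * s t * a t"
      by (simp only: g_simps(5,6)[OF x] gr mult.assoc)
    moreover have "g c ?x (s t *\<^sub>R ?a) (z t *\<^sub>R (?b - r t *\<^sub>R ?a)) = s t * z t * (b t - r t * a t)"
      by (simp only: g_simps(3-6)[OF x] gr) (simp add: algebra_simps)
    moreover have "g c ?x (z t *\<^sub>R (?b - r t *\<^sub>R ?a)) (z t *\<^sub>R (?b - r t *\<^sub>R ?a))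
        = z t * z t * (d t - 2 * r t * b t + r t * (r t * a t))"
      by (simp only: g_simps(3-6)[OF x] gr) (simp add: algebra_simps)
    moreover have "z t * z t * (d t - 2 * r t * b t + r t * (r t * a t)) = - 1"
      unfolding ss rr(1) using at rr(2) by (simp add: field_simps)
    ultimately show ?thesis
      using at x ss rr(1) by (simp add: FM_iff mem_U0 gram11_def gram12_def gram22_def \<gamma>_def)
  qed
  then show ?thesis
    by (rule tangent_spaceI_local[OF p \<delta>(1) _ \<gamma>0 d\<gamma>])
qed

end

section \<open>Vertical and horizontal fields on the frame bundle of the surface, and their
  bracket\<close>

context lorentzian_chart
begin

lemma linear_\<phi>: "p \<in> U0 \<Longrightarrow> linear (\<phi> p)"
  using smooth_\<eta>12 unfolding smooth_form_def by blast

lemma smooth_\<phi>: "smooth_on U0 (\<lambda>p. \<phi> p v)"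
  using smooth_\<eta>12 unfolding smooth_form_def by (elim conjE allE)

lemma differentiable_\<phi>: "p \<in> U0 \<Longrightarrow> (\<lambda>p. \<phi> p v) differentiable (at p)"
  by (rule smooth_on_differentiable[OF smooth_\<phi>])

lemma eta1_eq: "eta1 g c y w = g c (fst y) (fst w) (v1 y)"
  by (simp add: eta1_def case_prod_beta)

lemma eta2_eq: "eta2 g c y w = - g c (fst y) (fst w) (v2 y)"
  by (simp add: eta2_def case_prod_beta)

lemma linear_eta:
  assumes "y \<in> U0"
  shows "linear (eta1 g c y)" "linear (eta2 g c y)"
  using assms by (auto intro!: linearI simp: eta1_eq eta2_eq g_simps mem_U0)

lemma smooth_eta:
  "smooth_on U0 (\<lambda>y. eta1 g c y w)" "smooth_on U0 (\<lambda>y. eta2 g c y w)"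
  unfolding eta1_eq eta2_eq
  by (intro smooth_on_minus open_U0 smooth_g_along smooth_on_const smooth_on_bounded_linear
      bounded_linear_components)+

lemmas differentiable_eta = smooth_eta[THEN smooth_on_differentiable]

text \<open>The infinitesimal boost of the frame, that is, the generator of the structure
  group.\<close>

definition vert :: "frame2 \<Rightarrow> frame2" where
  "vert y = (0, v2 y, v1 y)"

text \<open>A lift of \<open>w\<close> that is tangent to the frame bundle but not yet horizontal.
  The frame velocities are chosen such that the product of the i-th velocity with the j-th frame
  vector is - dg(v_i, v_j) / 2; the two symmetric halves compensate the variation of the
  metric.\<close>

definition hor :: "(frame2 \<Rightarrow> real^2) \<Rightarrow> frame2 \<Rightarrow> frame2" where
  "hor w y = (w y,
     (-1/2) *\<^sub>R (dg (fst y) (w y) (v1 y) (v1 y) *\<^sub>R v1 y - dg (fst y) (w y) (v1 y) (v2 y) *\<^sub>R v2 y),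
     (-1/2) *\<^sub>R (dg (fst y) (w y) (v2 y) (v1 y) *\<^sub>R v1 y - dg (fst y) (w y) (v2 y) (v2 y) *\<^sub>R v2 y))"

text \<open>As the connection form is 1 on \<open>vert\<close>, this subtraction removes its value
  on \<open>hor w\<close> and leaves the horizontal lift.\<close>

definition hlift :: "(frame2 \<Rightarrow> real^2) \<Rightarrow> frame2 \<Rightarrow> frame2" where
  "hlift w y = hor w y - \<phi> y (hor w y) *\<^sub>R vert y"

definition X1 :: "frame2 \<Rightarrow> frame2" where "X1 = hlift (\<lambda>y. v1 y)"
definition X2 :: "frame2 \<Rightarrow> frame2" where "X2 = hlift (\<lambda>y. v2 y)"

lemma vert_tangent: "p \<in> M \<Longrightarrow> vert p \<in> TM p"
  by (rule tangent_FM_I) (simp_all add: differential_gram FM_subset vert_def dg_0 FM_gram)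

lemma hor_tangent: "p \<in> M \<Longrightarrow> hor w p \<in> TM p"
  using dg_commute[OF FM_subset(2)]
  by (intro tangent_FM_I)
    (simp_all add: differential_gram FM_subset hor_def g_simps FM_gram algebra_simps)

text \<open>The structure equation of \<eta>1 is evaluated on \<open>vert\<close> and a lift of the
  second frame vector. Moving v1 in the direction v2 changes the left side at the rate g(v2, v2) =
  -1, while the right side is - \<phi>(vert).\<close>

lemma \<phi>_vert:
  assumes p: "p \<in> M"
  shows "\<phi> p (vert p) = 1"
proof -
  let ?W = "hor (\<lambda>y. v2 y) p"
  note pU = FM_subset(1)[OF p] and x = FM_subset(2)[OF p]
  have a: "differential (\<lambda>y. eta1 g c y ?W) p (vert p) = -1"
    unfolding eta1_eq
    using g_along(2)[OF pU differentiable_const[of "v2 p"] differentiable_components(2), of "vert p"]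
    by (simp add: hor_def dg_0[OF x] g_simps[OF x] differential_components) (simp add: vert_def dg_0[OF x] FM_gram[OF p])
  have "differential (\<lambda>y. eta1 g c y (vert p)) p = differential (\<lambda>y. 0) p"
    by (rule differential_cong_open[OF open_U0 pU]) (simp add: eta1_eq vert_def g_simps mem_U0)
  then have b: "differential (\<lambda>y. eta1 g c y (vert p)) p ?W = 0" by simp
  have "ext_d (eta1 g c) p (vert p) ?W = -1"
    using a b by (simp add: ext_d_differential)
  moreover have "wedge \<phi> (eta2 g c) p (vert p) ?W = \<phi> p (vert p)"
    by (simp add: wedge_def eta2_eq hor_def) (simp add: vert_def g_simps[OF x] FM_gram[OF p])
  ultimately show ?thesis
    using structure_eta1[OF p vert_tangent[OF p] hor_tangent[OF p], of "\<lambda>y. v2 y"] by simp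
qed

lemma hlift_tangent:
  assumes p: "p \<in> M"
  shows "hlift w p \<in> TM p"
proof (rule tangent_FM_I[OF p])
  note s = smooth_gram[THEN smooth_on_differentiable, OF FM_subset(1)[OF p], THEN linear_differential]
  note h = tangent_FM_gram[OF p hor_tangent[OF p]] and v = tangent_FM_gram[OF p vert_tangent[OF p]]
  show "differential gram11 p (hlift w p) = 0" "differential gram12 p (hlift w p) = 0"
    "differential gram22 p (hlift w p) = 0"
    unfolding hlift_def using s h v by (simp_all only: linear_diff linear_scale) simp_all
qed

lemma forms_hlift:
  assumes p: "p \<in> M"
  shows "\<phi> p (hlift w p) = 0" "fst (hlift w p) = w p"
  using \<phi>_vert[OF p] linear_\<phi>[OF FM_subset(1)[OF p]]
  by (simp_all add: hlift_def linear_diff linear_scale) (simp add: hor_def vert_def)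

lemma forms_X:
  assumes p: "p \<in> M"
  shows "X1 p \<in> TM p" "eta1 g c p (X1 p) = 1" "eta2 g c p (X1 p) = 0" "\<phi> p (X1 p) = 0"
    "X2 p \<in> TM p" "eta1 g c p (X2 p) = 0" "eta2 g c p (X2 p) = 1" "\<phi> p (X2 p) = 0"
  by (simp_all add: X1_def X2_def hlift_tangent[OF p] forms_hlift[OF p] eta1_eq eta2_eq FM_gram[OF p])

lemma differentiable_Pair:
  "f differentiable (at p) \<Longrightarrow> h differentiable (at p) \<Longrightarrow> (\<lambda>y. (f y, h y)) differentiable (at p)"
  unfolding differentiable_def using has_derivative_Pair by blast

lemma hlift_differentiable:
  assumes p: "p \<in> U0" and w: "w differentiable (at p)"
  shows "hlift w differentiable (at p)"
proof -
  note c = differentiable_components[of p]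
  have h: "hor w differentiable (at p)"
    unfolding hor_def[abs_def]
    by (intro differentiable_Pair differentiable_scaleR differentiable_diff differentiable_const
        dg_along[OF p] w c)
  have "(\<lambda>y. \<phi> y (hor w y)) differentiable (at p)"
    by (rule differentiable_form_field[OF open_U0 p linear_\<phi> differentiable_\<phi>[OF p] h])
  moreover have "vert differentiable (at p)"
    unfolding vert_def[abs_def] by (intro differentiable_Pair differentiable_const c)
  ultimately show ?thesis
    unfolding hlift_def[abs_def] by (intro differentiable_diff differentiable_scaleR h)
qed

lemma differentiable_X:
  assumes "p \<in> U0"
  shows "X1 differentiable (at p)" "X2 differentiable (at p)"
  unfolding X1_def X2_def by (intro hlift_differentiable assms differentiable_components)+

text \<open>Cartan's formula solved for the bracket term. \<open>f1\<close> and \<open>f2\<close>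
  need to represent \<alpha>(X1) and \<alpha>(X2) on \<open>M\<close> only, because both fields are
  tangent to \<open>M\<close>.\<close>

lemma form_lie_bracket_X:
  assumes p: "p \<in> M" and lin: "\<And>y. y \<in> U0 \<Longrightarrow> linear (\<alpha> y)"
    and d: "\<And>v. (\<lambda>y. \<alpha> y v) differentiable (at p)"
    and f1: "f1 differentiable (at p)" "\<And>y. y \<in> M \<Longrightarrow> \<alpha> y (X1 y) = f1 y"
    and f2: "f2 differentiable (at p)" "\<And>y. y \<in> M \<Longrightarrow> \<alpha> y (X2 y) = f2 y"
  shows "\<alpha> p (lie_bracket X1 X2 p) =
    differential f2 p (X1 p) - differential f1 p (X2 p) - ext_d \<alpha> p (X1 p) (X2 p)"
proof -
  note pU = FM_subset(1)[OF p]
  have "differential (\<lambda>y. \<alpha> y (X2 y)) p (X1 p) = differential f2 p (X1 p)"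
    by (rule differential_cong_tangent[OF forms_X(1)[OF p] open_UNIV UNIV_I _ f2(1)])
      (auto intro: differentiable_form_field[OF open_U0 pU lin d] differentiable_X pU simp: f2(2))
  moreover have "differential (\<lambda>y. \<alpha> y (X1 y)) p (X2 p) = differential f1 p (X2 p)"
    by (rule differential_cong_tangent[OF forms_X(5)[OF p] open_UNIV UNIV_I _ f1(1)])
      (auto intro: differentiable_form_field[OF open_U0 pU lin d] differentiable_X pU simp: f1(2))
  ultimately show ?thesis
    using ext_d_fields[OF open_U0 pU lin d differentiable_X[OF pU]] by simp
qed

text \<open>The differential of a Gram entry is closed and vanishes on tangent vectors along
  \<open>M\<close>, in particular on \<open>X1\<close> and \<open>X2\<close>; by Cartan's formula it
  vanishes on their bracket.\<close>

lemma lie_bracket_X_tangent: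
  assumes p: "p \<in> M"
  shows "lie_bracket X1 X2 p \<in> TM p"
proof -
  note pU = FM_subset(1)[OF p]
  have "differential f p (lie_bracket X1 X2 p) = 0"
    if f: "smooth_on U0 f" "\<And>y v. y \<in> M \<Longrightarrow> v \<in> TM y \<Longrightarrow> differential f y v = 0"
    for f :: "frame2 \<Rightarrow> real"
  proof -
    have "differential f p (lie_bracket X1 X2 p) =
      differential (\<lambda>_. 0) p (X1 p) - differential (\<lambda>_. 0) p (X2 p) - ext_d (differential f) p (X1 p) (X2 p)"
      by (rule form_lie_bracket_X[OF p])
        (auto simp: f forms_X pU intro: linear_differential smooth_on_differentiable[OF f(1)]
          smooth_on_differentiable[OF smooth_on_differential[OF f(1)]])
    then show ?thesis by (simp add: ext_d_differential_eq_0[OF open_U0 pU f(1)])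
  qed
  then show ?thesis using smooth_gram tangent_FM_gram by (intro tangent_FM_I[OF p]) blast+
qed

text \<open>The structure equations make the bracket of two horizontal fields vertical; its vertical
  part is the curvature, see \<open>\<phi>_lie_bracket_X\<close>.\<close>

lemma eta_lie_bracket_X:
  assumes p: "p \<in> M"
  shows "eta1 g c p (lie_bracket X1 X2 p) = 0" "eta2 g c p (lie_bracket X1 X2 p) = 0"
    "\<phi> p (lie_bracket X1 X2 p) = - ext_d \<phi> p (X1 p) (X2 p)"
proof -
  note pU = FM_subset(1)[OF p]
  have "eta1 g c p (lie_bracket X1 X2 p) =
      differential (\<lambda>_. 0) p (X1 p) - differential (\<lambda>_. 1) p (X2 p) - ext_d (eta1 g c) p (X1 p) (X2 p)"
    by (rule form_lie_bracket_X[OF p linear_eta(1) differentiable_eta(1)[OF pU]]) (auto simp: forms_X)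
  then show "eta1 g c p (lie_bracket X1 X2 p) = 0"
    using structure_eta1[OF p, of "X1 p" "X2 p"] forms_X[OF p] by (simp add: wedge_def)
  have "eta2 g c p (lie_bracket X1 X2 p) =
      differential (\<lambda>_. 1) p (X1 p) - differential (\<lambda>_. 0) p (X2 p) - ext_d (eta2 g c) p (X1 p) (X2 p)"
    by (rule form_lie_bracket_X[OF p linear_eta(2) differentiable_eta(2)[OF pU]]) (auto simp: forms_X)
  then show "eta2 g c p (lie_bracket X1 X2 p) = 0"
    using structure_eta2[OF p, of "X1 p" "X2 p"] forms_X[OF p] by (simp add: wedge_def)
  have "\<phi> p (lie_bracket X1 X2 p) =
      differential (\<lambda>_. 0) p (X1 p) - differential (\<lambda>_. 0) p (X2 p) - ext_d \<phi> p (X1 p) (X2 p)"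
    by (rule form_lie_bracket_X[OF p linear_\<phi> differentiable_\<phi>[OF pU]]) (auto simp: forms_X)
  then show "\<phi> p (lie_bracket X1 X2 p) = - ext_d \<phi> p (X1 p) (X2 p)" by simp
qed

end

section \<open>The curvature, its powers, and the condition on q in terms of them\<close>

locale curved_chart = lorentzian_chart g c \<eta>12
  for g :: "'m metric" and c :: "'m chart" and \<eta>12 :: "'m chart \<Rightarrow> (frame2, real) form1" +
  fixes K :: "'m \<Rightarrow> real" and \<epsilon> :: real
    and q1 q2 q11 q12 q21 q22 :: "frame2 \<Rightarrow> real"
  assumes smooth_K: "smooth_on (chart_image c) (\<lambda>x. K (chart_inv c x))"
    and structure_\<phi>: "\<And>p v w. p \<in> FM g c \<Longrightarrow> v \<in> tangent_space (FM g c) p \<Longrightarrow>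
      w \<in> tangent_space (FM g c) p \<Longrightarrow>
      ext_d (\<eta>12 c) p v w = - pullback_FM K c p * wedge (eta1 g c) (eta2 g c) p v w"
    and \<epsilon>: "\<epsilon> = 1 \<or> \<epsilon> = -1" "\<And>x. x \<in> chart_image c \<Longrightarrow> \<epsilon> * K (chart_inv c x) > 0"
    and smooth_q: "smooth_on (FM_ambient c) q1" "smooth_on (FM_ambient c) q2"
      "smooth_on (FM_ambient c) q11" "smooth_on (FM_ambient c) q12"
      "smooth_on (FM_ambient c) q21" "smooth_on (FM_ambient c) q22"
    and dq: "\<And>p v. p \<in> FM g c \<Longrightarrow> v \<in> tangent_space (FM g c) p \<Longrightarrow>
      differential (pullback_FM (\<lambda>x. \<bar>K x\<bar> powr (-3/4)) c) p v = q1 p * eta1 g c p v + q2 p * eta2 g c p v"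
    and dq1: "\<And>p v. p \<in> FM g c \<Longrightarrow> v \<in> tangent_space (FM g c) p \<Longrightarrow>
      differential q1 p v = q2 p * \<eta>12 c p v + q11 p * eta1 g c p v + q12 p * eta2 g c p v"
    and dq2: "\<And>p v. p \<in> FM g c \<Longrightarrow> v \<in> tangent_space (FM g c) p \<Longrightarrow>
      differential q2 p v = q1 p * \<eta>12 c p v + q21 p * eta1 g c p v + q22 p * eta2 g c p v"
begin

definition qf :: "frame2 \<Rightarrow> real" where "qf = pullback_FM (\<lambda>x. \<bar>K x\<bar> powr (-3/4)) c"
definition Kf :: "frame2 \<Rightarrow> real" where "Kf = pullback_FM K c"
text \<open>The fourth root of |K|. In terms of it sqrt |K|, q and q^(-1/3) are the integral powers
  2, -3 and 1, so that the calculations become polynomial.\<close>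

definition rf :: "frame2 \<Rightarrow> real" where "rf y = (\<epsilon> * Kf y) powr (1/4)"
definition kf :: "frame2 \<Rightarrow> real" where "kf y = sqrt \<bar>Kf y\<bar>"
text \<open>From q r^3 = 1 follows dr = - r^4 dq / 3 = r^3 (F \<eta>1 + H \<eta>2), with r for
  \<open>rf\<close>. Thus \<open>kf * F\<close> and \<open>kf * H\<close> are the coefficients A and
  B of the overview.\<close>

definition F :: "frame2 \<Rightarrow> real" where "F y = - (q1 y * rf y) / 3"
definition H :: "frame2 \<Rightarrow> real" where "H y = - (q2 y * rf y) / 3"

lemma Kf_pos: "y \<in> U0 \<Longrightarrow> \<epsilon> * Kf y > 0"
  using \<epsilon>(2) by (simp add: Kf_def pullback_FM_def case_prod_beta mem_U0)

lemma \<epsilon>_square: "\<epsilon> * \<epsilon> = 1"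
  using \<epsilon>(1) by auto

lemma abs_Kf: "y \<in> U0 \<Longrightarrow> \<bar>Kf y\<bar> = \<epsilon> * Kf y"
  using Kf_pos[of y] \<epsilon>(1) by (auto simp: abs_if)

lemma rf_pos: "y \<in> U0 \<Longrightarrow> rf y > 0"
  unfolding rf_def using Kf_pos[of y] by (metis less_irrefl powr_gt_zero)

lemma rf_powers:
  assumes y: "y \<in> U0"
  shows "kf y = rf y ^ 2" "kf y > 0" "Kf y = \<epsilon> * kf y ^ 2" "qf y * rf y ^ 3 = 1" "qf y > 0"
    "qf y powr (-1/3) = rf y" "qf y = (\<epsilon> * Kf y) powr (-3/4)"
proof -
  note p = Kf_pos[OF y]
  then have nz: "\<epsilon> \<noteq> 0" "Kf y \<noteq> 0" by auto
  have "rf y ^ 2 = (\<epsilon> * Kf y) powr (1/2)" "rf y ^ 3 = (\<epsilon> * Kf y) powr (3/4)"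
    using rf_pos[OF y] by (simp_all add: rf_def powr_powr flip: powr_numeral)
  moreover show qf: "qf y = (\<epsilon> * Kf y) powr (-3/4)"
    using abs_Kf[OF y] by (simp add: qf_def Kf_def pullback_FM_def case_prod_beta)
  ultimately show "kf y = rf y ^ 2" "qf y * rf y ^ 3 = 1"
    using p nz by (simp_all add: kf_def abs_Kf[OF y] powr_half_sqrt powr_minus)
  show "qf y > 0" "qf y powr (-1/3) = rf y"
    using nz by (simp_all add: qf rf_def powr_powr)
  show "kf y > 0" using nz by (simp add: kf_def)
  show "Kf y = \<epsilon> * kf y ^ 2"
    using p by (simp add: kf_def abs_Kf[OF y] \<epsilon>_square flip: mult.assoc)
qed

lemma smooth_Kf: "smooth_on U0 Kf"
proof -
  have "smooth_on U0 (\<lambda>y. K (chart_inv c (fst y)))"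
    by (rule smooth_on_precompose_bounded_linear[OF open_U0 bounded_linear_components(1) _ smooth_K])
      (simp add: mem_U0)
  then show ?thesis by (simp add: Kf_def pullback_FM_def case_prod_beta')
qed

lemma smooth_rf: "smooth_on U0 rf"
  unfolding rf_def[abs_def]
  by (intro smooth_on_powr smooth_on_mult smooth_on_const smooth_Kf open_U0 Kf_pos)

lemma smooth_qf: "smooth_on U0 qf"
proof -
  have "smooth_on U0 (\<lambda>y. (\<epsilon> * Kf y) powr (-3/4))"
    by (intro smooth_on_powr smooth_on_mult smooth_on_const smooth_Kf open_U0 Kf_pos)
  then show ?thesis
    by (rule smooth_on_cong[OF open_U0, rotated]) (simp only: rf_powers(7))
qed

lemma smooth_kf: "smooth_on U0 kf"
  by (rule smooth_on_cong[OF open_U0 _ smooth_on_mult[OF open_U0 smooth_rf smooth_rf]])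
    (simp add: rf_powers power2_eq_square)

lemma smooth_F: "smooth_on U0 F" and smooth_H: "smooth_on U0 H"
proof -
  have "smooth_on U0 (\<lambda>y. q1 y * rf y * (-1/3))" "smooth_on U0 (\<lambda>y. q2 y * rf y * (-1/3))"
    by (intro smooth_on_mult smooth_q smooth_rf smooth_on_const open_U0)+
  then show "smooth_on U0 F" "smooth_on U0 H" by (simp_all add: F_def[abs_def] H_def[abs_def])
qed

text \<open>\<open>F1\<close> to \<open>H2\<close> are the covariant derivatives of F and H, in the
  sense in which the q_ij are those of the q_i. The quadratic terms come from differentiating
  \<open>rf\<close>.\<close>

definition F1 :: "frame2 \<Rightarrow> real" where "F1 y = kf y * F y ^ 2 - q11 y * rf y / 3"
definition F2 :: "frame2 \<Rightarrow> real" where "F2 y = kf y * F y * H y - q12 y * rf y / 3"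
definition H1 :: "frame2 \<Rightarrow> real" where "H1 y = kf y * F y * H y - q21 y * rf y / 3"
definition H2 :: "frame2 \<Rightarrow> real" where "H2 y = kf y * H y ^ 2 - q22 y * rf y / 3"

lemma differentials:
  assumes p: "p \<in> M" and v: "v \<in> TM p"
  shows "differential kf p v = 2 * kf p ^ 2 * (F p * eta1 g c p v + H p * eta2 g c p v)" (is ?d1)
    "differential F p v = H p * \<phi> p v + F1 p * eta1 g c p v + F2 p * eta2 g c p v" (is ?d2)
    "differential H p v = F p * \<phi> p v + H1 p * eta1 g c p v + H2 p * eta2 g c p v" (is ?d3)
proof -
  note pU = FM_subset(1)[OF p] and D = smooth_on_differentiable
  note dr = D[OF smooth_rf pU] and dqf = D[OF smooth_qf pU]
  note r = rf_powers[OF pU] and r0 = rf_pos[OF pU]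
  have "differential (\<lambda>y. qf y * (rf y * (rf y * rf y))) p = differential (\<lambda>y. 1) p"
    using rf_powers(4) by (intro differential_cong_open[OF open_U0 pU]) (simp add: power3_eq_cube mult.assoc)
  then have "differential qf p v * rf p ^ 3 + 3 * qf p * rf p ^ 2 * differential rf p v = 0"
    using differential_mult[OF dqf differentiable_mult[OF dr differentiable_mult[OF dr dr]], of v]
    by (simp add: differential_mult dr power2_eq_square power3_eq_cube algebra_simps)
  then have "(differential qf p v * rf p ^ 3 + 3 * qf p * rf p ^ 2 * differential rf p v) * rf p = 0 * rf p"
    by simp
  then have "3 * (qf p * rf p ^ 3) * differential rf p v = - (differential qf p v * rf p ^ 4)"
    by (simp add: power2_eq_square power3_eq_cube power4_eq_xxxx algebra_simps)
  then have "3 * differential rf p v = - (differential qf p v * rf p ^ 4)"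
    using r(4) by simp
  then have drf: "differential rf p v = rf p ^ 3 * (F p * eta1 g c p v + H p * eta2 g c p v)"
    using dq[OF p v] by (simp add: qf_def F_def H_def power3_eq_cube power4_eq_xxxx algebra_simps)
  have "differential kf p = differential (\<lambda>y. rf y * rf y) p"
    using rf_powers(1) by (intro differential_cong_open[OF open_U0 pU]) (simp add: power2_eq_square)
  then have "differential kf p v = 2 * rf p * differential rf p v"
    by (simp add: differential_mult dr)
  then show ?d1
    unfolding drf r(1) by (simp add: power2_eq_square power3_eq_cube algebra_simps)
  have dm: "differential (\<lambda>y. - (q y * rf y) / 3) p v = - (q p * differential rf p v + differential q p v * rf p) / 3"
    if "q differentiable (at p)" for q
  proof -
    have eq: "(\<lambda>y. - (q y * rf y) / 3) = (\<lambda>y. (-1/3) * (q y * rf y))" by (simp add: fun_eq_iff)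
    show ?thesis
      unfolding eq differential_mult[OF differentiable_const differentiable_mult[OF that dr]]
        differential_mult[OF that dr] differential_const by linarith
  qed
  show ?d2
    unfolding F_def[abs_def] dm[OF D[OF smooth_q(1) pU]] drf dq1[OF p v] F1_def F2_def r(1)
    by (simp add: F_def H_def power2_eq_square power3_eq_cube field_simps)
  show ?d3
    unfolding H_def[abs_def] dm[OF D[OF smooth_q(2) pU]] drf dq2[OF p v] H1_def H2_def r(1)
    by (simp add: F_def H_def power2_eq_square power3_eq_cube field_simps)
qed

text \<open>Since dq is closed, its value on the bracket of \<open>X1\<close> and \<open>X2\<close>
  is X1 q2 - X2 q1 = q21 - q12. The bracket is vertical, and dq vanishes on vertical
  vectors.\<close>

lemma q12_eq_q21:
  assumes p: "p \<in> M"
  shows "q12 p = q21 p"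
proof -
  note pU = FM_subset(1)[OF p] and D = smooth_on_differentiable
  have "differential qf p (lie_bracket X1 X2 p) =
      differential q2 p (X1 p) - differential q1 p (X2 p) - ext_d (differential qf) p (X1 p) (X2 p)"
    by (rule form_lie_bracket_X[OF p])
      (auto simp: dq[folded qf_def] forms_X pU intro: linear_differential D[OF smooth_qf] D[OF smooth_q(1)]
        D[OF smooth_q(2)] D[OF smooth_on_differential[OF smooth_qf]])
  moreover have "differential qf p (lie_bracket X1 X2 p) = 0"
    using dq[OF p lie_bracket_X_tangent[OF p]] eta_lie_bracket_X[OF p] by (simp add: qf_def)
  ultimately show ?thesis
    using dq1[OF p forms_X(5)[OF p]] dq2[OF p forms_X(1)[OF p]] forms_X[OF p]
    by (simp add: ext_d_differential_eq_0[OF open_U0 pU smooth_qf])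
qed

lemma \<phi>_lie_bracket_X: "p \<in> M \<Longrightarrow> \<phi> p (lie_bracket X1 X2 p) = Kf p"
  using structure_\<phi>[of p "X1 p" "X2 p"] forms_X[of p] by (simp add: eta_lie_bracket_X wedge_def Kf_def)

text \<open>The quadratic terms are those in the definitions of \<open>F1\<close> to
  \<open>H2\<close>; after cancelling them, the condition on the q_ij remains, multiplied by
  \<open>rf / 3\<close>.\<close>

definition rescaled_condition :: "frame2 \<Rightarrow> bool" where
  "rescaled_condition y \<longleftrightarrow>
    F1 y = kf y * F y ^ 2 - \<epsilon> * kf y \<and> F2 y = kf y * F y * H y \<and>
    H1 y = kf y * F y * H y \<and> H2 y = kf y * H y ^ 2 + \<epsilon> * kf y"

lemma condition_iff:
  assumes p: "p \<in> M"
  shows "q11 p = - q22 p \<and> - q22 p = 3 * \<epsilon> * qf p powr (-1/3) \<and> q12 p = 0 \<and> q21 p = 0 \<longleftrightarrow>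
    rescaled_condition p"
proof -
  note pU = FM_subset(1)[OF p]
  note r = rf_powers[OF pU] and r0 = rf_pos[OF pU]
  have a: "x * rf p / 3 = \<epsilon> * kf p \<longleftrightarrow> x = 3 * \<epsilon> * rf p" for x
    unfolding r(1) using r0 by (auto simp: power2_eq_square)
  have "F1 p = kf p * F p ^ 2 - \<epsilon> * kf p \<longleftrightarrow> q11 p = 3 * \<epsilon> * rf p"
    "H2 p = kf p * H p ^ 2 + \<epsilon> * kf p \<longleftrightarrow> - q22 p = 3 * \<epsilon> * rf p"
    using a[of "q11 p"] a[of "- q22 p"] by (auto simp: F1_def H2_def)
  moreover have "F2 p = kf p * F p * H p \<longleftrightarrow> q12 p = 0" "H1 p = kf p * F p * H p \<longleftrightarrow> q21 p = 0"
    using r0 by (simp_all add: F2_def H1_def)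
  ultimately show ?thesis unfolding r(6) rescaled_condition_def by linarith
qed

end

section \<open>The condition implies Darboux integrability\<close>

lemma ext_d_pull_fst:
  assumes "\<And>v. (\<lambda>y. \<alpha> y v) differentiable (at (fst p))"
  shows "ext_d (pull_fst \<alpha>) p v w = ext_d \<alpha> (fst p) (fst v) (fst w)"
  using differential_precompose_bounded_linear(2)[OF bounded_linear_fst assms]
  by (simp add: ext_d_differential pull_fst_def)

lemma ext_d_pull_snd:
  assumes "\<And>v. (\<lambda>y. \<alpha> y v) differentiable (at (snd p))"
  shows "ext_d (pull_snd \<alpha>) p v w = ext_d \<alpha> (snd p) (snd v) (snd w)"
  using differential_precompose_bounded_linear(2)[OF bounded_linear_snd assms]
  by (simp add: ext_d_differential pull_snd_def)

context curved_chart
begin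

abbreviation "N \<equiv> FM g c \<times> FR"
abbreviation "TN \<equiv> tangent_space (FM g c \<times> FR)"

definition \<theta>3 :: "(frame2 \<times> frame3, real) form1" where
  "\<theta>3 p v = omega12 (snd p) (snd v) - \<phi> (fst p) (fst v)"

definition \<pi>1 :: "'c::real_normed_field \<Rightarrow> (frame2 \<times> frame3, 'c) form1" where
  "\<pi>1 \<kappa> p v = of_real (omega31 (snd p) (snd v)) - \<kappa> * of_real (kf (fst p) * eta2 g c (fst p) (fst v))"

definition \<pi>2 :: "'c::real_normed_field \<Rightarrow> (frame2 \<times> frame3, 'c) form1" where
  "\<pi>2 \<kappa> p v = of_real (omega32 (snd p) (snd v)) + \<kappa> * of_real (kf (fst p) * eta1 g c (fst p) (fst v))"

lemma singular_system_eq: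
  "singular_system g \<eta>12 K c \<kappa> = embedding_system g \<eta>12 c @ [\<pi>1 \<kappa>, \<pi>2 \<kappa>]"
  by (simp add: singular_system_def Let_def \<pi>1_def[abs_def] \<pi>2_def[abs_def] pull_fst_def pull_snd_def kf_def Kf_def)

lemma embedding_system_eq:
  "embedding_system g \<eta>12 c = [\<lambda>p v. of_real (omega3 (snd p) (snd v)),
      \<lambda>p v. of_real (omega1 (snd p) (snd v) - eta1 g c (fst p) (fst v)),
      \<lambda>p v. of_real (omega2 (snd p) (snd v) - eta2 g c (fst p) (fst v)),
      \<lambda>p v. of_real (\<theta>3 p v)]"
  by (simp add: embedding_system_def \<theta>3_def pull_fst_def pull_snd_def)

lemma TN_fst_snd:
  assumes "v \<in> TN p"
  shows "fst v \<in> TM (fst p)" "snd v \<in> tangent_space FR (snd p)"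
  using assms tangent_space_Times[of M FR "fst p" "snd p"] by (auto simp: mem_Times_iff)

lemma TN_I: "u \<in> TM y \<Longrightarrow> w \<in> tangent_space FR s \<Longrightarrow> (u, w) \<in> TN (y, s)"
  by (simp add: tangent_space_Times)

text \<open>The real and the \<open>\<kappa>\<close>-parts of the forms \<open>\<pi>\<^sub>1 - (F / \<kappa>) \<theta>\<^sub>3\<close> and \<open>\<pi>\<^sub>2 - (H / \<kappa>) \<theta>\<^sub>3\<close>, where
  \<open>1 / \<kappa> = - \<epsilon> \<kappa>\<close>.\<close>

definition b1 :: "(frame2 \<times> frame3, real) form1" where
  "b1 p v = (\<epsilon> * F (fst p)) * \<theta>3 p v + (- kf (fst p)) * eta2 g c (fst p) (fst v)"

definition b2 :: "(frame2 \<times> frame3, real) form1" where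
  "b2 p v = (\<epsilon> * H (fst p)) * \<theta>3 p v + kf (fst p) * eta1 g c (fst p) (fst v)"

definition \<alpha>1 :: "'c::real_normed_field \<Rightarrow> (frame2 \<times> frame3, 'c) form1" where
  "\<alpha>1 \<kappa> p v = of_real (omega31 (snd p) (snd v)) + \<kappa> * of_real (b1 p v)"

definition \<alpha>2 :: "'c::real_normed_field \<Rightarrow> (frame2 \<times> frame3, 'c) form1" where
  "\<alpha>2 \<kappa> p v = of_real (omega32 (snd p) (snd v)) + \<kappa> * of_real (b2 p v)"

abbreviation "W0 \<equiv> FM_ambient c \<times> (UNIV :: frame3 set)"

lemma open_W0: "open W0"
  using open_U0 by (simp add: open_Times)

lemma mem_W0: "p \<in> W0 \<longleftrightarrow> fst p \<in> U0"
  by (auto simp: mem_Times_iff)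

lemma smooth_fst: "smooth_on U0 f \<Longrightarrow> smooth_on W0 (\<lambda>p. f (fst p))"
  by (rule smooth_on_precompose_bounded_linear[OF open_W0 bounded_linear_fst]) (simp_all add: mem_W0)

lemma smooth_omega:
  "smooth_on W0 (\<lambda>p. omega12 (snd p) v)" "smooth_on W0 (\<lambda>p. omega31 (snd p) v)"
  "smooth_on W0 (\<lambda>p. omega32 (snd p) v)"
  by (intro smooth_on_bounded_linear bounded_linear_compose[OF _ bounded_linear_snd, of "\<lambda>s. _ s v"]
      bounded_linear_omega_at)+

lemma smooth_\<theta>3: "smooth_on W0 (\<lambda>p. \<theta>3 p v)"
  unfolding \<theta>3_def by (intro smooth_on_diff open_W0 smooth_omega smooth_fst[OF smooth_\<phi>])

lemma smooth_b: "smooth_on W0 (\<lambda>p. b1 p v)" "smooth_on W0 (\<lambda>p. b2 p v)"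
  unfolding b1_def b2_def
  by (intro smooth_on_add smooth_on_mult smooth_on_minus smooth_on_const open_W0 smooth_\<theta>3
      smooth_fst[OF smooth_F] smooth_fst[OF smooth_H] smooth_fst[OF smooth_kf]
      smooth_fst[OF smooth_eta(1)] smooth_fst[OF smooth_eta(2)])+

lemma linear_\<theta>3: "p \<in> W0 \<Longrightarrow> linear (\<theta>3 p)"
  unfolding \<theta>3_def[abs_def] using linear_omega(4) linear_\<phi>[of "fst p"]
  by (intro linearI) (simp_all add: mem_W0 linear_add linear_scale algebra_simps)

lemma linear_b: "p \<in> W0 \<Longrightarrow> linear (b1 p)" "p \<in> W0 \<Longrightarrow> linear (b2 p)"
  unfolding b1_def[abs_def] b2_def[abs_def] using linear_\<theta>3[of p] linear_eta[of "fst p"]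
  by (intro linearI; simp add: mem_W0 linear_add linear_scale algebra_simps)+

lemma smooth_form_\<alpha>: "smooth_form W0 (\<alpha>1 \<kappa>)" "smooth_form W0 (\<alpha>2 \<kappa>)"
proof -
  have l: "linear (\<lambda>v. of_real (f (snd v)) + \<kappa> * of_real (b v))"
    if "linear f" "linear b" for f :: "frame3 \<Rightarrow> real" and b :: "frame2 \<times> frame3 \<Rightarrow> real"
    using that by (intro linearI) (simp_all add: linear_add linear_scale scaleR_conv_of_real algebra_simps)
  have s: "smooth_on W0 (\<lambda>p. of_real (f p) + \<kappa> * of_real (b p))"
    if "smooth_on W0 f" "smooth_on W0 b" for f b :: "frame2 \<times> frame3 \<Rightarrow> real"
    by (intro smooth_on_add smooth_on_mult smooth_on_const open_W0
        smooth_on_compose_bounded_linear[OF open_W0 bounded_linear_of_real] that)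
  show "smooth_form W0 (\<alpha>1 \<kappa>)" "smooth_form W0 (\<alpha>2 \<kappa>)"
    unfolding smooth_form_def \<alpha>1_def[abs_def] \<alpha>2_def[abs_def]
    by (intro conjI ballI allI l s linear_omega linear_b smooth_omega smooth_b; assumption)+
qed

lemma ext_d_\<theta>3:
  assumes p: "p \<in> N" and v: "v \<in> TN p" and w: "w \<in> TN p"
  shows "ext_d \<theta>3 p v w = - wedge omega31 omega32 (snd p) (snd v) (snd w)
    + Kf (fst p) * wedge (eta1 g c) (eta2 g c) (fst p) (fst v) (fst w)"
proof -
  have pM: "fst p \<in> M" and pF: "snd p \<in> FR" using p by auto
  note pU = FM_subset(1)[OF pM]
  have d1: "(\<lambda>y. pull_snd omega12 y u) differentiable (at p)" for u
    unfolding pull_snd_def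
    by (rule bounded_linear_imp_differentiable[OF bounded_linear_compose[OF bounded_linear_omega_at(4) bounded_linear_snd]])
  have d2: "(\<lambda>y. pull_fst \<phi> y u) differentiable (at p)" for u
    unfolding pull_fst_def by (rule differentiable_fst[OF differentiable_\<phi>[OF pU]])
  have "\<theta>3 = (\<lambda>y u. pull_snd omega12 y u - pull_fst \<phi> y u)"
    by (simp add: fun_eq_iff \<theta>3_def pull_snd_def pull_fst_def)
  then have "ext_d \<theta>3 p v w = ext_d (pull_snd omega12) p v w - ext_d (pull_fst \<phi>) p v w"
    by (simp add: ext_d_differential differential_diff[OF d1 d2])
  also have "ext_d (pull_snd omega12) p v w = ext_d omega12 (snd p) (snd v) (snd w)"
    by (rule ext_d_pull_snd) (rule bounded_linear_imp_differentiable[OF bounded_linear_omega_at(4)])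
  also have "ext_d (pull_fst \<phi>) p v w = ext_d \<phi> (fst p) (fst v) (fst w)"
    by (rule ext_d_pull_fst[OF differentiable_\<phi>[OF pU]])
  finally show ?thesis
    using omega_structure_equations(3)[OF pF TN_fst_snd(2)[OF v] TN_fst_snd(2)[OF w]]
      structure_\<phi>[OF pM TN_fst_snd(1)[OF v] TN_fst_snd(1)[OF w]] by (simp add: Kf_def)
qed

text \<open>The real part of the computation, free of \<kappa>, so that it serves both signs of the
  curvature. The condition enters through the values of \<open>F1\<close> to \<open>H2\<close>; the
  rest is a polynomial identity modulo \<epsilon>^2 = 1.\<close>

lemma ext_d_b:
  assumes p: "p \<in> N" and v: "v \<in> TN p" and w: "w \<in> TN p"
    and cond: "rescaled_condition (fst p)"
  shows "ext_d b1 p v w = \<epsilon> * F (fst p) * wedge omega32 omega31 (snd p) (snd v) (snd w)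
      + wedge (\<lambda>_ u. omega12 (snd p) (snd u) - F (fst p) * b1 p u) b2 p v w" (is ?d1)
    and "ext_d b2 p v w = \<epsilon> * H (fst p) * wedge omega32 omega31 (snd p) (snd v) (snd w)
      + wedge (\<lambda>_ u. omega12 (snd p) (snd u)) b1 p v w - H (fst p) * wedge b1 b2 p v w" (is ?d2)
proof -
  have pM: "fst p \<in> M" using p by auto
  note pU = FM_subset(1)[OF pM] and D = smooth_on_differentiable
  have pW: "p \<in> W0" using pU by (simp add: mem_W0)
  note d\<theta> = D[OF smooth_\<theta>3 pW]
  have de: "(\<lambda>y. pull_fst (eta1 g c) y u) differentiable (at p)"
    "(\<lambda>y. pull_fst (eta2 g c) y u) differentiable (at p)" for u
    unfolding pull_fst_def using D[OF smooth_fst[OF smooth_eta(1)] pW] D[OF smooth_fst[OF smooth_eta(2)] pW] by auto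
  have dF: "(\<lambda>p. F (fst p)) differentiable (at p)" and dH: "(\<lambda>p. H (fst p)) differentiable (at p)"
    and dk: "(\<lambda>p. kf (fst p)) differentiable (at p)"
    using D[OF smooth_fst[OF smooth_F] pW] D[OF smooth_fst[OF smooth_H] pW] D[OF smooth_fst[OF smooth_kf] pW] .
  have fs: "differential (\<lambda>p. f (fst p)) p u = differential f (fst p) (fst u)" if "smooth_on U0 f" for f :: "frame2 \<Rightarrow> real" and u
    by (rule differential_precompose_bounded_linear(2)[OF bounded_linear_fst D[OF that pU]])
  have m: "differential (\<lambda>p. \<epsilon> * f p) p u = \<epsilon> * differential f p u" if "f differentiable (at p)" for f u
    using differential_mult[OF differentiable_const that, of \<epsilon> u] by simp
  have diffs: "differential (\<lambda>p. \<epsilon> * F (fst p)) p u = \<epsilon> * (H (fst p) * \<phi> (fst p) (fst u) + F1 (fst p) * eta1 g c (fst p) (fst u) + F2 (fst p) * eta2 g c (fst p) (fst u))"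
    "differential (\<lambda>p. \<epsilon> * H (fst p)) p u = \<epsilon> * (F (fst p) * \<phi> (fst p) (fst u) + H1 (fst p) * eta1 g c (fst p) (fst u) + H2 (fst p) * eta2 g c (fst p) (fst u))"
    "differential (\<lambda>p. kf (fst p)) p u = 2 * kf (fst p) ^ 2 * (F (fst p) * eta1 g c (fst p) (fst u) + H (fst p) * eta2 g c (fst p) (fst u))"
    "differential (\<lambda>p. - kf (fst p)) p u = - (2 * kf (fst p) ^ 2 * (F (fst p) * eta1 g c (fst p) (fst u) + H (fst p) * eta2 g c (fst p) (fst u)))"
    if "u \<in> TN p" for u
    using differentials[OF pM TN_fst_snd(1)[OF that]]
    by (simp_all add: m[OF dF] m[OF dH] differential_minus[OF dk] fs smooth_F smooth_H smooth_kf)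
  have deta: "ext_d (pull_fst (eta1 g c)) p v w = - wedge \<phi> (eta2 g c) (fst p) (fst v) (fst w)"
    "ext_d (pull_fst (eta2 g c)) p v w = - wedge \<phi> (eta1 g c) (fst p) (fst v) (fst w)"
    using ext_d_pull_fst[of "eta1 g c" p v w, OF differentiable_eta(1)[OF pU]]
      ext_d_pull_fst[of "eta2 g c" p v w, OF differentiable_eta(2)[OF pU]]
      structure_eta1[OF pM TN_fst_snd(1)[OF v] TN_fst_snd(1)[OF w]]
      structure_eta2[OF pM TN_fst_snd(1)[OF v] TN_fst_snd(1)[OF w]] by simp_all
  have b1': "b1 = (\<lambda>y u. (\<epsilon> * F (fst y)) * \<theta>3 y u + (- kf (fst y)) * pull_fst (eta2 g c) y u)"
    and b2': "b2 = (\<lambda>y u. (\<epsilon> * H (fst y)) * \<theta>3 y u + kf (fst y) * pull_fst (eta1 g c) y u)"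
    by (simp_all add: fun_eq_iff b1_def b2_def pull_fst_def)
  note Kk = rf_powers(3)[OF pU]
  note cond2 = cond[unfolded rescaled_condition_def, THEN conjunct2, THEN conjunct1]
    cond[unfolded rescaled_condition_def, THEN conjunct2, THEN conjunct2, THEN conjunct1]
    cond[unfolded rescaled_condition_def, THEN conjunct2, THEN conjunct2, THEN conjunct2]
  have "ext_d b1 p v w = wedge (\<lambda>_. differential (\<lambda>p. \<epsilon> * F (fst p)) p) \<theta>3 p v w
      + wedge (\<lambda>_. differential (\<lambda>p. - kf (fst p)) p) (pull_fst (eta2 g c)) p v w
      + (\<epsilon> * F (fst p)) * ext_d \<theta>3 p v w + (- kf (fst p)) * ext_d (pull_fst (eta2 g c)) p v w"
    unfolding b1' by (rule ext_d_combination[OF _ _ d\<theta> de(2)]) (auto intro: differentiable_mult differentiable_minus dF dk)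
  then show ?d1
    unfolding wedge_def ext_d_\<theta>3[OF p v w] deta diffs[OF v] diffs[OF w] b1_def b2_def pull_fst_def \<theta>3_def Kk
      cond[unfolded rescaled_condition_def, THEN conjunct1] cond2
    using \<epsilon>_square by algebra
  have "ext_d b2 p v w = wedge (\<lambda>_. differential (\<lambda>p. \<epsilon> * H (fst p)) p) \<theta>3 p v w
      + wedge (\<lambda>_. differential (\<lambda>p. kf (fst p)) p) (pull_fst (eta1 g c)) p v w
      + (\<epsilon> * H (fst p)) * ext_d \<theta>3 p v w + kf (fst p) * ext_d (pull_fst (eta1 g c)) p v w"
    unfolding b2' by (rule ext_d_combination[OF _ _ d\<theta> de(1)]) (auto intro: differentiable_mult dH dk)
  then show ?d2
    unfolding wedge_def ext_d_\<theta>3[OF p v w] deta diffs[OF v] diffs[OF w] b1_def b2_def pull_fst_def \<theta>3_def Kk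
      cond[unfolded rescaled_condition_def, THEN conjunct1] cond2
    using \<epsilon>_square by algebra
qed

text \<open>The structure equations of Minkowski space give the first parts of the forms,
  \<open>ext_d_b\<close> the \<kappa>-parts. The square of \<kappa> is all that is known about it,
  so the result covers 1, -1, \<i> and -\<i> together.\<close>

lemma ext_d_\<alpha>:
  fixes \<kappa> :: "'c::real_normed_field"
  assumes p: "p \<in> N" and v: "v \<in> TN p" and w: "w \<in> TN p"
    and cond: "rescaled_condition (fst p)"
    and \<kappa>: "\<kappa> * \<kappa> = - of_real \<epsilon>"
  shows "ext_d (\<alpha>1 \<kappa>) p v w =
      wedge (\<lambda>_ u. \<kappa> * of_real (\<epsilon> * F (fst p) * omega32 (snd p) (snd u))) (\<alpha>1 \<kappa>) p v w
      + wedge (\<lambda>_ u. of_real (omega12 (snd p) (snd u) - F (fst p) * b1 p u)) (\<alpha>2 \<kappa>) p v w" (is ?d1)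
    and "ext_d (\<alpha>2 \<kappa>) p v w =
      wedge (\<lambda>_ u. of_real (omega12 (snd p) (snd u)) + \<kappa> * of_real (\<epsilon> * H (fst p) * omega32 (snd p) (snd u))) (\<alpha>1 \<kappa>) p v w
      + wedge (\<lambda>_ u. - of_real (H (fst p) * b1 p u)) (\<alpha>2 \<kappa>) p v w" (is ?d2)
proof -
  have pM: "fst p \<in> M" and pF: "snd p \<in> FR" using p by auto
  have pW: "p \<in> W0" using FM_subset(1)[OF pM] by (simp add: mem_W0)
  note D = smooth_on_differentiable
  have split: "ext_d (\<lambda>p v. of_real (f p v) + \<kappa> * of_real (b p v)) p v w = of_real (ext_d f p v w) + \<kappa> * of_real (ext_d b p v w)"
    if f: "\<And>v. smooth_on W0 (\<lambda>p. f p v)" and b: "\<And>v. smooth_on W0 (\<lambda>p. b p v)" for f b :: "(frame2 \<times> frame3, real) form1"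
  proof -
    have d: "differential (\<lambda>p. of_real (f p v) + \<kappa> * of_real (b p v)) p w
        = of_real (differential (\<lambda>p. f p v) p w) + \<kappa> * of_real (differential (\<lambda>p. b p v) p w)" for v w
    proof -
      note df = D[OF f[of v] pW] and db = D[OF b[of v] pW]
      note dof = differentiable_of_real[OF df] and dob = differentiable_of_real[OF db]
      show ?thesis
        unfolding differential_add[OF dof differentiable_mult[OF differentiable_const dob]]
          differential_mult[OF differentiable_const dob] differential_const
          differential_compose_bounded_linear[OF bounded_linear_of_real df]
          differential_compose_bounded_linear[OF bounded_linear_of_real db] by simp
    qed
    show ?thesis by (simp add: ext_d_differential d algebra_simps)
  qed
  have o: "ext_d (\<lambda>p v. omega31 (snd p) (snd v)) p v w = - wedge omega32 omega12 (snd p) (snd v) (snd w)"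
    "ext_d (\<lambda>p v. omega32 (snd p) (snd v)) p v w = - wedge omega31 omega12 (snd p) (snd v) (snd w)"
    using ext_d_pull_snd[of omega31 p v w, OF bounded_linear_imp_differentiable[OF bounded_linear_omega_at(5)]]
      ext_d_pull_snd[of omega32 p v w, OF bounded_linear_imp_differentiable[OF bounded_linear_omega_at(6)]]
      omega_structure_equations(1,2)[OF pF TN_fst_snd(2)[OF v] TN_fst_snd(2)[OF w]]
    by (simp_all add: pull_snd_def[abs_def])
  note db = ext_d_b[OF p v w cond]
  have \<epsilon>2: "of_real \<epsilon> * of_real \<epsilon> = (1 :: 'c)"
    using \<epsilon>_square by (simp flip: of_real_mult)
  show ?d1
    unfolding \<alpha>1_def[abs_def] \<alpha>2_def[abs_def] split[OF smooth_omega(2) smooth_b(1)] o db(1)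
      wedge_def of_real_mult of_real_add of_real_diff of_real_minus
    using \<kappa> \<epsilon>2 by algebra
  show ?d2
    unfolding \<alpha>1_def[abs_def] \<alpha>2_def[abs_def] split[OF smooth_omega(3) smooth_b(2)] o db(2)
      wedge_def of_real_mult of_real_add of_real_diff of_real_minus
    using \<kappa> \<epsilon>2 by algebra
qed

lemma contains_transverse_Frobenius_if_condition:
  fixes \<kappa> :: "'c::real_normed_field"
  assumes cond: "\<And>y. y \<in> M \<Longrightarrow> rescaled_condition y"
    and \<kappa>: "\<kappa> * \<kappa> = - of_real \<epsilon>" and p: "p \<in> N"
  shows "contains_transverse_Frobenius N (embedding_system g \<eta>12 c) (singular_system g \<eta>12 K c \<kappa>) p"
  unfolding contains_transverse_Frobenius_def
proof (rule exI[of _ 2], rule exI[of _ W0], rule exI[of _ "\<lambda>i. if i = 0 then \<alpha>1 \<kappa> else \<alpha>2 \<kappa>"], intro conjI ballI)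
  let ?\<alpha> = "\<lambda>i::nat. if i = 0 then \<alpha>1 \<kappa> else \<alpha>2 \<kappa>"
  have sum2: "(\<Sum>i<2. f i) = f 0 + f 1" for f :: "nat \<Rightarrow> 'c"
    by (simp add: numeral_2_eq_2)
  have all2: "(\<forall>i<2. P i) \<longleftrightarrow> P 0 \<and> P 1" for P :: "nat \<Rightarrow> bool"
    by (auto simp: less_2_cases_iff)
  show "(2::nat) \<le> 2" "open W0" by (simp_all add: open_W0)
  show "p \<in> W0" using p FM_subset(1) by (auto simp: mem_W0)
  show "\<forall>i<2. smooth_form W0 (?\<alpha> i)" by (simp add: all2 smooth_form_\<alpha>)
  fix y assume y: "y \<in> N \<inter> W0"
  have yN: "y \<in> N" and yM: "fst y \<in> M" and yF: "snd y \<in> FR" using y by auto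
  have yU: "fst y \<in> U0" using FM_subset(1)[OF yM] .
  \<comment> \<open>On these two vectors every \<theta> vanishes and the two \<alpha>'s form the
    identity matrix, which gives independence and transversality at once.\<close>
  let ?u = "(0, fr_31 (snd y)) :: frame2 \<times> frame3" and ?w = "(0, fr_32 (snd y)) :: frame2 \<times> frame3"
  have T: "?u \<in> TN y" "?w \<in> TN y"
    using TN_I[OF zero_in_tangent_space[OF yM] fr_tangent(5)[OF yF]]
      TN_I[OF zero_in_tangent_space[OF yM] fr_tangent(6)[OF yF]] by simp_all
  have z: "\<phi> (fst y) 0 = 0" "eta1 g c (fst y) 0 = 0" "eta2 g c (fst y) 0 = 0"
    using linear_0[OF linear_\<phi>[OF yU]] linear_0[OF linear_eta(1)[OF yU]] linear_0[OF linear_eta(2)[OF yU]] by auto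
  have val: "\<alpha>1 \<kappa> y ?u = 1" "\<alpha>1 \<kappa> y ?w = 0" "\<alpha>2 \<kappa> y ?u = 0" "\<alpha>2 \<kappa> y ?w = 1"
    by (simp_all add: \<alpha>1_def \<alpha>2_def b1_def b2_def \<theta>3_def z omega_fr[OF yF])
  show "\<forall>a. (\<forall>v\<in>TN y. (\<Sum>i<2. a i * ?\<alpha> i y v) = 0) \<longrightarrow> (\<forall>i<2. a i = 0)"
  proof (intro allI impI)
    fix a :: "nat \<Rightarrow> 'c" assume "\<forall>v\<in>TN y. (\<Sum>i<2. a i * ?\<alpha> i y v) = 0"
    then have "(\<Sum>i<2. a i * ?\<alpha> i y ?u) = 0" "(\<Sum>i<2. a i * ?\<alpha> i y ?w) = 0" using T by blast+
    then have "\<forall>i<2. a i = 0" unfolding all2 sum2 by (simp add: val)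
    then show "a i = 0" if "i < 2" for i using that by blast
  qed
  show "\<forall>i<2. \<exists>a. \<forall>v\<in>TN y. ?\<alpha> i y v =
      (\<Sum>j<length (singular_system g \<eta>12 K c \<kappa>). a j * (singular_system g \<eta>12 K c \<kappa> ! j) y v)"
  proof -
    have six: "(\<Sum>j<length (singular_system g \<eta>12 K c \<kappa>). a j * (singular_system g \<eta>12 K c \<kappa> ! j) y v)
      = a 0 * of_real (omega3 (snd y) (snd v))
        + a 1 * of_real (omega1 (snd y) (snd v) - eta1 g c (fst y) (fst v))
        + a 2 * of_real (omega2 (snd y) (snd v) - eta2 g c (fst y) (fst v))
        + a 3 * of_real (\<theta>3 y v) + a 4 * \<pi>1 \<kappa> y v + a 5 * \<pi>2 \<kappa> y v" for a v
      unfolding singular_system_eq embedding_system_eq by (simp add: eval_nat_numeral)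
    have "\<alpha>1 \<kappa> y v = \<kappa> * of_real (\<epsilon> * F (fst y)) * of_real (\<theta>3 y v) + \<pi>1 \<kappa> y v"
      "\<alpha>2 \<kappa> y v = \<kappa> * of_real (\<epsilon> * H (fst y)) * of_real (\<theta>3 y v) + \<pi>2 \<kappa> y v" for v
      by (simp_all add: \<alpha>1_def \<alpha>2_def \<pi>1_def \<pi>2_def b1_def b2_def algebra_simps)
    \<comment> \<open>The indices 3, 4 and 5 of the list belong to \<theta>3, \<pi>1 and
      \<pi>2.\<close>
    then show ?thesis
      unfolding all2 six
      by (intro conjI exI[of _ "\<lambda>j. if j = 3 then \<kappa> * of_real (\<epsilon> * F (fst y)) else if j = 4 then 1 else 0"]
          exI[of _ "\<lambda>j. if j = 3 then \<kappa> * of_real (\<epsilon> * H (fst y)) else if j = 5 then 1 else 0"] ballI) simp_all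
  qed
  show "\<forall>a b. (\<forall>v\<in>TN y. (\<Sum>i<2. a i * ?\<alpha> i y v) =
        (\<Sum>j<length (embedding_system g \<eta>12 c). b j * (embedding_system g \<eta>12 c ! j) y v)) \<longrightarrow>
      (\<forall>v\<in>TN y. (\<Sum>i<2. a i * ?\<alpha> i y v) = 0)"
  proof (intro allI impI)
    fix a b :: "nat \<Rightarrow> 'c"
    assume eq: "\<forall>v\<in>TN y. (\<Sum>i<2. a i * ?\<alpha> i y v) =
        (\<Sum>j<length (embedding_system g \<eta>12 c). b j * (embedding_system g \<eta>12 c ! j) y v)"
    have "(\<Sum>j<length (embedding_system g \<eta>12 c). b j * (embedding_system g \<eta>12 c ! j) y ?u) = 0"
      "(\<Sum>j<length (embedding_system g \<eta>12 c). b j * (embedding_system g \<eta>12 c ! j) y ?w) = 0"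
      unfolding embedding_system_eq by (simp_all add: eval_nat_numeral \<theta>3_def z omega_fr[OF yF])
    then have "(\<Sum>i<2. a i * ?\<alpha> i y ?u) = 0" "(\<Sum>i<2. a i * ?\<alpha> i y ?w) = 0"
      using bspec[OF eq T(1)] bspec[OF eq T(2)] by (simp_all only:)
    then have "a 0 = 0" "a 1 = 0" unfolding sum2 by (simp_all add: val)
    then show "\<forall>v\<in>TN y. (\<Sum>i<2. a i * ?\<alpha> i y v) = 0" unfolding sum2 by simp
  qed
  have yW: "y \<in> W0" using yU by (simp add: mem_W0)
  have l1: "linear (\<lambda>u. \<kappa> * of_real (r * omega32 (snd y) (snd u)))" for r
    using linear_omega(6) by (intro linearI) (simp_all add: linear_add linear_scale scaleR_conv_of_real algebra_simps)
  have l2: "linear (\<lambda>u. of_real (omega12 (snd y) (snd u) - r * b1 y u) :: 'c)" for r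
    using linear_omega(4) linear_b(1)[OF yW]
    by (intro linearI) (simp_all add: linear_add linear_scale scaleR_conv_of_real algebra_simps)
  have l3: "linear (\<lambda>u. of_real (omega12 (snd y) (snd u)) + \<kappa> * of_real (r * omega32 (snd y) (snd u)))" for r
    using linear_omega(4,6) by (intro linearI) (simp_all add: linear_add linear_scale scaleR_conv_of_real algebra_simps)
  have l4: "linear (\<lambda>u. - of_real (r * b1 y u) :: 'c)" for r
    using linear_b(1)[OF yW] by (intro linearI) (simp_all add: linear_add linear_scale scaleR_conv_of_real algebra_simps)
  have ex: "\<exists>\<beta>. (\<forall>j<2. linear (\<beta> j)) \<and> (\<forall>v\<in>TN y. \<forall>w\<in>TN y. ext_d \<alpha> y v w = (\<Sum>j<2. wedge (\<lambda>_. \<beta> j) (?\<alpha> j) y v w))"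
    if "linear \<beta>1" "linear \<beta>2"
      "\<And>v w. v \<in> TN y \<Longrightarrow> w \<in> TN y \<Longrightarrow>
        ext_d \<alpha> y v w = wedge (\<lambda>_. \<beta>1) (\<alpha>1 \<kappa>) y v w + wedge (\<lambda>_. \<beta>2) (\<alpha>2 \<kappa>) y v w" for \<alpha> \<beta>1 \<beta>2
    unfolding all2 sum2 using that
    by (intro exI[of _ "\<lambda>j. if j = 0 then \<beta>1 else \<beta>2"]) simp
  show "\<forall>i<2. \<exists>\<beta>. (\<forall>j<2. linear (\<beta> j)) \<and>
      (\<forall>v\<in>TN y. \<forall>w\<in>TN y. ext_d (?\<alpha> i) y v w = (\<Sum>j<2. wedge (\<lambda>_. \<beta> j) (?\<alpha> j) y v w))" (is "\<forall>i<2. ?Q i")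
  proof (intro allI impI)
    fix i :: nat assume "i < 2"
    then consider "i = 0" | "i = 1" by linarith
    then show "?Q i"
    proof cases
      case 1
      have "?\<alpha> i = \<alpha>1 \<kappa>" using 1 by simp
      then show ?thesis using ex[OF l1 l2 ext_d_\<alpha>(1)[OF yN _ _ cond[OF yM] \<kappa>]] by (simp only:)
    next
      case 2
      have "?\<alpha> i = \<alpha>2 \<kappa>" using 2 by simp
      then show ?thesis using ex[OF l3 l4 ext_d_\<alpha>(2)[OF yN _ _ cond[OF yM] \<kappa>]] by (simp only:)
    qed
  qed
qed

end

section \<open>Darboux integrability implies the condition\<close>

lemma lie_bracket_product:
  fixes L1 L2 :: "'b::euclidean_space \<Rightarrow> 'b" and A1 A2 :: "'a::real_normed_vector \<Rightarrow> 'a"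
  assumes "linear L1" "linear L2" "A1 differentiable (at (fst y))" "A2 differentiable (at (fst y))"
  shows "lie_bracket (\<lambda>y. (A1 (fst y), L1 (snd y))) (\<lambda>y. (A2 (fst y), L2 (snd y))) y =
    (lie_bracket A1 A2 (fst y), L2 (L1 (snd y)) - L1 (L2 (snd y)))"
proof -
  have D: "((\<lambda>y. (A (fst y), L (snd y))) has_derivative (\<lambda>h. (differential A (fst y) (fst h), L (snd h)))) (at y)"
    if "linear L" "A differentiable (at (fst y))" for L :: "'b \<Rightarrow> 'b" and A :: "'a \<Rightarrow> 'a"
  proof (rule has_derivative_Pair)
    show "((\<lambda>y. A (fst y)) has_derivative (\<lambda>h. differential A (fst y) (fst h))) (at y)"
      using has_derivative_compose[OF bounded_linear_imp_has_derivative[OF bounded_linear_fst]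
          has_derivative_differential[OF that(2)]] .
    show "((\<lambda>y. L (snd y)) has_derivative (\<lambda>h. L (snd h))) (at y)"
      using that(1) linear_conv_bounded_linear
      by (intro bounded_linear_imp_has_derivative bounded_linear_compose[OF _ bounded_linear_snd]) blast
  qed
  show ?thesis
    unfolding lie_bracket_def differential_eqI[OF D[OF assms(1,3)]] differential_eqI[OF D[OF assms(2,4)]]
    by simp
qed

context curved_chart
begin

definition vf :: "(frame3 \<Rightarrow> frame3) \<Rightarrow> frame2 \<times> frame3 \<Rightarrow> frame2 \<times> frame3" where
  "vf L y = (0, L (snd y))"

text \<open>The two components are matched so that \<eta>1 agrees with \<omega>1, \<eta>2 with
  \<omega>2, and both connection forms vanish; hence all \<theta>'s vanish on \<open>Y1\<close> and
  \<open>Y2\<close>.\<close>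

definition Y1 :: "frame2 \<times> frame3 \<Rightarrow> frame2 \<times> frame3" where "Y1 y = (X1 (fst y), fr_e1 (snd y))"
definition Y2 :: "frame2 \<times> frame3 \<Rightarrow> frame2 \<times> frame3" where "Y2 y = (X2 (fst y), fr_e2 (snd y))"

lemma differentiable_vf: "linear L \<Longrightarrow> vf L differentiable (at y)"
  unfolding vf_def[abs_def] linear_conv_bounded_linear
  by (intro differentiable_Pair differentiable_const bounded_linear_imp_differentiable
      bounded_linear_compose[OF _ bounded_linear_snd])

lemma differentiable_Y:
  assumes "y \<in> W0"
  shows "Y1 differentiable (at y)" "Y2 differentiable (at y)"
  unfolding Y1_def[abs_def] Y2_def[abs_def]
  using differentiable_X[of "fst y"] assms linear_fr(1,2)[unfolded linear_conv_bounded_linear]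
  by (intro differentiable_Pair[OF differentiable_fst bounded_linear_imp_differentiable]
      bounded_linear_compose[OF _ bounded_linear_snd]; simp add: mem_W0)+

lemma tangent_vf: "y \<in> N \<Longrightarrow> L (snd y) \<in> tangent_space FR (snd y) \<Longrightarrow> vf L y \<in> TN y"
  using TN_I[OF zero_in_tangent_space, of "fst y" "L (snd y)" "snd y"] by (auto simp: vf_def)

lemma tangent_Y:
  assumes "y \<in> N"
  shows "Y1 y \<in> TN y" "Y2 y \<in> TN y"
  using TN_I[OF forms_X(1) fr_tangent(1), of "fst y" "snd y"] TN_I[OF forms_X(5) fr_tangent(2), of "fst y" "snd y"] assms
  by (auto simp: Y1_def Y2_def mem_Times_iff)

lemma lie_bracket_vf:
  "linear L \<Longrightarrow> linear L' \<Longrightarrow> lie_bracket (vf L) (vf L') y = vf (\<lambda>s. L' (L s) - L (L' s)) y"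
  using lie_bracket_product[of L L' "\<lambda>_. 0" y "\<lambda>_. 0"] by (simp add: vf_def[abs_def] lie_bracket_def)

lemma lie_bracket_Y_vf:
  assumes "y \<in> W0" "linear L"
  shows "lie_bracket Y1 (vf L) y = vf (\<lambda>s. L (fr_e1 s) - fr_e1 (L s)) y"
    "lie_bracket Y2 (vf L) y = vf (\<lambda>s. L (fr_e2 s) - fr_e2 (L s)) y"
  using lie_bracket_product[OF linear_fr(1) assms(2) differentiable_X(1) differentiable_const, of y 0]
    lie_bracket_product[OF linear_fr(2) assms(2) differentiable_X(2) differentiable_const, of y 0] assms
    linear_0[OF linear_differential[OF differentiable_X(1)], of "fst y"]
    linear_0[OF linear_differential[OF differentiable_X(2)], of "fst y"]
  by (simp_all add: vf_def[abs_def] Y1_def[abs_def] Y2_def[abs_def] lie_bracket_def mem_W0)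

lemma lie_bracket_Y:
  assumes "y \<in> W0"
  shows "lie_bracket Y1 Y2 y = (lie_bracket X1 X2 (fst y), 0)"
  using lie_bracket_product[OF linear_fr(1,2) differentiable_X(1,2), of y] assms
  by (simp add: Y1_def[abs_def] Y2_def[abs_def] mem_W0 fr_commutators)

text \<open>Although the conclusion concerns one point, the hypothesis provides the equations on a
  neighbourhood in \<open>N\<close>, and they are differentiated there. The reduction expresses the
  Frobenius condition by values on explicit fields, to which the algebraic lemma applies.\<close>

lemma condition_if_contains_transverse_Frobenius:
  fixes \<kappa> :: "'c::real_normed_field"
  assumes con: "contains_transverse_Frobenius N (embedding_system g \<eta>12 c) (singular_system g \<eta>12 K c \<kappa>) p"
    and \<kappa>: "\<kappa> * \<kappa> = - of_real \<epsilon>" and p: "p \<in> N"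
  shows "rescaled_condition (fst p)"
proof -
  let ?\<Theta> = "embedding_system g \<eta>12 c :: (frame2 \<times> frame3, 'c) form1 list"
  have zero: "\<phi> (fst y) 0 = 0" "eta1 g c (fst y) 0 = 0" "eta2 g c (fst y) 0 = 0" if "y \<in> N" for y :: "frame2 \<times> frame3"
  proof -
    have yU: "fst y \<in> U0" using FM_subset(1) that by auto
    show "\<phi> (fst y) 0 = 0" "eta1 g c (fst y) 0 = 0" "eta2 g c (fst y) 0 = 0"
      using linear_0[OF linear_\<phi>[OF yU]] linear_0[OF linear_eta(1)[OF yU]] linear_0[OF linear_eta(2)[OF yU]] by auto
  qed
  obtain U \<alpha>1 \<alpha>2 where U: "open U" "p \<in> U" "U \<subseteq> W0"
    and lin: "\<And>y \<alpha>. y \<in> U \<Longrightarrow> \<alpha> \<in> {\<alpha>1, \<alpha>2} \<Longrightarrow> linear (\<alpha> y)"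
    and dif: "\<And>y \<alpha> v. y \<in> U \<Longrightarrow> \<alpha> \<in> {\<alpha>1, \<alpha>2} \<Longrightarrow> (\<lambda>y. \<alpha> y v) differentiable (at y)"
    and nf: "\<And>y. y \<in> N \<inter> U \<Longrightarrow> \<alpha>1 y (vf fr_31 y) = 1 \<and> \<alpha>1 y (vf fr_32 y) = 0 \<and> \<alpha>2 y (vf fr_31 y) = 0 \<and> \<alpha>2 y (vf fr_32 y) = 1"
    and span: "\<And>y \<alpha>. y \<in> N \<inter> U \<Longrightarrow> \<alpha> \<in> {\<alpha>1, \<alpha>2} \<Longrightarrow>
       \<exists>a x z. \<forall>v\<in>TN y. \<alpha> y v = (\<Sum>j<length ?\<Theta>. a j * (?\<Theta> ! j) y v) + x * \<pi>1 \<kappa> y v + z * \<pi>2 \<kappa> y v"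
    and frob: "\<And>y \<alpha>. y \<in> N \<inter> U \<Longrightarrow> \<alpha> \<in> {\<alpha>1, \<alpha>2} \<Longrightarrow>
       \<exists>\<beta>1 \<beta>2. linear \<beta>1 \<and> linear \<beta>2 \<and> (\<forall>v\<in>TN y. \<forall>w\<in>TN y.
         ext_d \<alpha> y v w = wedge (\<lambda>_. \<beta>1) \<alpha>1 y v w + wedge (\<lambda>_. \<beta>2) \<alpha>2 y v w)"
  proof (rule transverse_Frobenius_normal_form[OF con[unfolded singular_system_eq] p, of W0 "vf fr_31" "vf fr_32"])
    show "vf fr_31 differentiable (at y)" "vf fr_32 differentiable (at y)" for y
      by (intro differentiable_vf linear_fr)+
    show "open W0" by (rule open_W0)
    show "p \<in> W0" using p FM_subset(1) by (auto simp: mem_W0)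
    fix y assume y: "y \<in> N"
    then have yF: "snd y \<in> FR" by auto
    show "vf fr_31 y \<in> TN y" "vf fr_32 y \<in> TN y"
      by (intro tangent_vf y fr_tangent yF)+
    show "\<theta> y (vf fr_31 y) = 0 \<and> \<theta> y (vf fr_32 y) = 0" if "\<theta> \<in> set ?\<Theta>" for \<theta>
      using that unfolding embedding_system_eq by (auto simp: vf_def \<theta>3_def omega_fr[OF yF] zero[OF y])
    show "\<pi>1 \<kappa> y (vf fr_31 y) = 1 \<and> \<pi>1 \<kappa> y (vf fr_32 y) = 0 \<and> \<pi>2 \<kappa> y (vf fr_31 y) = 0 \<and> \<pi>2 \<kappa> y (vf fr_32 y) = 1"
      by (simp add: vf_def \<pi>1_def \<pi>2_def omega_fr[OF yF] zero[OF y])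
  qed (rule that)
  let ?\<A> = "{\<alpha>1, \<alpha>2}"
  \<comment> \<open>Equalities on \<open>S\<close> do not extend to an open set; \<open>TS\<close>
    below carries them over to derivatives along tangent vectors.\<close>
  define S where "S = N \<inter> U"
  have S: "y \<in> N" "y \<in> U" "y \<in> W0" "fst y \<in> M" "snd y \<in> FR" "fst y \<in> U0" if "y \<in> S" for y
    using that U(3) FM_subset(1) by (auto simp: S_def)
  define k where "k = (\<lambda>y::frame2 \<times> frame3. \<kappa> * of_real (kf (fst y)))"
  have k2: "k y * k y = - of_real (Kf (fst y))" and k0: "k y \<noteq> 0" if "y \<in> S" for y
  proof -
    note r = rf_powers(2,3)[OF S(6)[OF that]]
    have "k y * k y = (\<kappa> * \<kappa>) * of_real (kf (fst y) * kf (fst y))" by (simp add: k_def)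
    also have "\<dots> = - of_real (Kf (fst y))" unfolding \<kappa> r(2) by (simp add: power2_eq_square)
    finally show "k y * k y = - of_real (Kf (fst y))" .
    have "Kf (fst y) \<noteq> 0" using Kf_pos[OF S(6)[OF that]] by auto
    then show "k y \<noteq> 0" using \<open>k y * k y = - of_real (Kf (fst y))\<close> by auto
  qed
  \<comment> \<open>Each of the six Minkowski frame fields is dual to one generator of the singular
    system, so the coefficients are the values of \<alpha> on these fields.\<close>
  have span': "\<alpha> y v = \<alpha> y (vf fr_e3 y) * of_real (omega3 (snd y) (snd v))
      + \<alpha> y (vf fr_e1 y) * of_real (omega1 (snd y) (snd v) - eta1 g c (fst y) (fst v))
      + \<alpha> y (vf fr_e2 y) * of_real (omega2 (snd y) (snd v) - eta2 g c (fst y) (fst v))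
      + \<alpha> y (vf fr_12 y) * of_real (\<theta>3 y v)
      + \<alpha> y (vf fr_31 y) * \<pi>1 \<kappa> y v + \<alpha> y (vf fr_32 y) * \<pi>2 \<kappa> y v"
    if y: "y \<in> S" and \<alpha>: "\<alpha> \<in> ?\<A>" and v: "v \<in> TN y" for y \<alpha> v
  proof -
    note yN = S(1)[OF y] and yF = S(5)[OF y]
    obtain a x z where *: "\<forall>v\<in>TN y. \<alpha> y v = (\<Sum>j<length ?\<Theta>. a j * (?\<Theta> ! j) y v) + x * \<pi>1 \<kappa> y v + z * \<pi>2 \<kappa> y v"
      using span[OF y[unfolded S_def] \<alpha>] by blast
    have **: "\<alpha> y v = a 0 * of_real (omega3 (snd y) (snd v))
        + a 1 * of_real (omega1 (snd y) (snd v) - eta1 g c (fst y) (fst v))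
        + a 2 * of_real (omega2 (snd y) (snd v) - eta2 g c (fst y) (fst v))
        + a 3 * of_real (\<theta>3 y v) + x * \<pi>1 \<kappa> y v + z * \<pi>2 \<kappa> y v" if "v \<in> TN y" for v
      using bspec[OF * that] unfolding embedding_system_eq by (simp add: eval_nat_numeral)
    have t: "vf L y \<in> TN y" if "L \<in> fr_fields" for L
      using that fr_tangent[OF yF] by (auto intro!: tangent_vf[OF yN])
    note simps = vf_def \<theta>3_def \<pi>1_def \<pi>2_def omega_fr[OF yF] zero[OF yN]
    have "\<alpha> y (vf fr_e3 y) = a 0" "\<alpha> y (vf fr_e1 y) = a 1" "\<alpha> y (vf fr_e2 y) = a 2"
      "\<alpha> y (vf fr_12 y) = a 3" "\<alpha> y (vf fr_31 y) = x" "\<alpha> y (vf fr_32 y) = z"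
      by (subst **[OF t]; simp add: simps)+
    then show ?thesis using **[OF v] by simp
  qed
  \<comment> \<open>Among the generators only \<pi>2 is nonzero on \<open>Y1\<close> and only \<pi>1
    on \<open>Y2\<close>. The bracket is seen by \<theta>3 alone, through the curvature.\<close>
  have \<alpha>Y: "\<alpha> y (Y1 y) = \<alpha> y (vf fr_32 y) * k y" "\<alpha> y (Y2 y) = - \<alpha> y (vf fr_31 y) * k y"
    "\<alpha> y (lie_bracket Y1 Y2 y) = - \<alpha> y (vf fr_12 y) * of_real (Kf (fst y))"
    if y: "y \<in> S" and \<alpha>: "\<alpha> \<in> ?\<A>" for y \<alpha>
  proof -
    note yN = S(1)[OF y] and yF = S(5)[OF y] and yM = S(4)[OF y]
    show "\<alpha> y (Y1 y) = \<alpha> y (vf fr_32 y) * k y"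
      by (subst span'[OF y \<alpha> tangent_Y(1)[OF yN]])
        (simp add: Y1_def \<theta>3_def \<pi>1_def \<pi>2_def omega_fr[OF yF] forms_X[OF yM] k_def)
    show "\<alpha> y (Y2 y) = - \<alpha> y (vf fr_31 y) * k y"
      by (subst span'[OF y \<alpha> tangent_Y(2)[OF yN]])
        (simp add: Y2_def \<theta>3_def \<pi>1_def \<pi>2_def omega_fr[OF yF] forms_X[OF yM] k_def)
    have "lie_bracket Y1 Y2 y \<in> TN y"
      unfolding lie_bracket_Y[OF S(3)[OF y]]
      using TN_I[OF lie_bracket_X_tangent[OF yM] zero_in_tangent_space[OF yF]] by simp
    then show "\<alpha> y (lie_bracket Y1 Y2 y) = - \<alpha> y (vf fr_12 y) * of_real (Kf (fst y))"
      by (subst span'[OF y \<alpha>])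
        (simp_all add: lie_bracket_Y[OF S(3)[OF y]] \<theta>3_def \<pi>1_def \<pi>2_def eta_lie_bracket_X(1,2)[OF yM]
          \<phi>_lie_bracket_X[OF yM] linear_0 linear_omega)
  qed
  note nf' = nf[folded S_def]
  have TS: "differential f y v = differential h y v"
    if "y \<in> S" "v \<in> TN y" "f differentiable (at y)" "h differentiable (at y)" "\<And>z. z \<in> S \<Longrightarrow> f z = h z"
    for y v and f h :: "frame2 \<times> frame3 \<Rightarrow> 'c"
    using differential_cong_tangent[OF that(2) U(1) S(2)[OF that(1)] that(3,4)] that(5) by (simp add: S_def)
  have dfield: "(\<lambda>y. \<alpha> y (X y)) differentiable (at y)"
    if "y \<in> S" "\<alpha> \<in> ?\<A>" "X differentiable (at y)" for \<alpha> X y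
    using differentiable_form_field[OF U(1) S(2)[OF that(1)] lin[OF _ that(2)] dif[OF S(2)[OF that(1)] that(2)] that(3)] .
  \<comment> \<open>Cartan's formula in which \<alpha>(X) and \<alpha>(Y) may be replaced by any
    functions that equal them on \<open>S\<close>.\<close>
  have ext: "ext_d \<alpha> y (X y) (Y y) = differential fY y (X y) - differential fX y (Y y) - \<alpha> y (lie_bracket X Y y)"
    if y: "y \<in> S" and \<alpha>: "\<alpha> \<in> ?\<A>" and X: "X differentiable (at y)" "X y \<in> TN y" and Y: "Y differentiable (at y)" "Y y \<in> TN y"
      and fX: "fX differentiable (at y)" "\<And>z. z \<in> S \<Longrightarrow> \<alpha> z (X z) = fX z"
      and fY: "fY differentiable (at y)" "\<And>z. z \<in> S \<Longrightarrow> \<alpha> z (Y z) = fY z"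
    for y \<alpha> X Y fX fY
  proof -
    have "differential (\<lambda>z. \<alpha> z (Y z)) y (X y) = differential fY y (X y)"
      by (rule TS[OF y X(2) dfield[OF y \<alpha> Y(1)] fY])
    moreover have "differential (\<lambda>z. \<alpha> z (X z)) y (Y y) = differential fX y (Y y)"
      by (rule TS[OF y Y(2) dfield[OF y \<alpha> X(1)] fX])
    ultimately show ?thesis
      using ext_d_fields[OF U(1) S(2)[OF y] lin[OF _ \<alpha>] dif[OF S(2)[OF y] \<alpha>] X(1) Y(1)] by simp
  qed
  have fst_der: "(\<lambda>y::frame2 \<times> frame3. of_real (f (fst y)) :: 'c) differentiable (at y)"
    "differential (\<lambda>y::frame2 \<times> frame3. of_real (f (fst y)) :: 'c) y v = of_real (differential f (fst y) (fst v))"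
    if "smooth_on U0 f" "y \<in> W0" for f y v
  proof -
    have d: "f differentiable (at (fst y))" using smooth_on_differentiable[OF that(1)] that(2) by (simp add: mem_W0)
    note d' = differential_precompose_bounded_linear[OF bounded_linear_fst d]
    show "(\<lambda>y::frame2 \<times> frame3. of_real (f (fst y)) :: 'c) differentiable (at y)"
      by (rule differentiable_of_real[OF d'(1)])
    show "differential (\<lambda>y::frame2 \<times> frame3. of_real (f (fst y)) :: 'c) y v = of_real (differential f (fst y) (fst v))"
      using differential_compose_bounded_linear[OF bounded_linear_of_real d'(1)] d'(2) by metis
  qed
  have dk: "k differentiable (at y)" "differential k y v = \<kappa> * of_real (differential kf (fst y) (fst v))"
    if "y \<in> W0" for y v
    unfolding k_def using fst_der[OF smooth_kf that]
    by (simp_all add: differentiable_mult differential_mult)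
  \<comment> \<open>Since \<alpha>2(Y1) = k and \<alpha>1(Y2) = -k, these multiples of the fields
    dual to the \<alpha>'s move \<open>Y1\<close> and \<open>Y2\<close> into the common kernel of
    \<alpha>1 and \<alpha>2.\<close>
  define Z1 where "Z1 = (\<lambda>(f :: frame2 \<times> frame3 \<Rightarrow> 'c) y. differential f y (Y1 y) - k y * differential f y (vf fr_32 y))"
  define Z2 where "Z2 = (\<lambda>(f :: frame2 \<times> frame3 \<Rightarrow> 'c) y. differential f y (Y2 y) + k y * differential f y (vf fr_31 y))"
  define D where "D = {f :: frame2 \<times> frame3 \<Rightarrow> 'c. \<forall>y\<in>S. f differentiable (at y)}"
  have tvf: "vf L y \<in> TN y" if "y \<in> S" "L \<in> fr_fields" for L y
    using that fr_tangent[OF S(5)[OF that(1)]] by (auto intro!: tangent_vf S(1))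
  have tY: "Y1 y \<in> TN y" "Y2 y \<in> TN y" if "y \<in> S" for y
    using tangent_Y S(1) that by blast+
  have lfr: "linear L" if "L \<in> fr_fields" for L
    using that linear_fr by auto
  have Zd: "derivation_on S D Z1" "derivation_on S D Z2"
    unfolding derivation_on_def
  proof (safe)
    fix f h assume "f \<in> D" "h \<in> D"
    then have fh: "f differentiable (at y)" "h differentiable (at y)" if "y \<in> S" for y
      using that by (auto simp: D_def)
    show "(\<lambda>y. f y - h y) \<in> D" "(\<lambda>y. f y * h y) \<in> D" "(\<lambda>y. f y - h y) \<in> D" "(\<lambda>y. f y * h y) \<in> D"
      by (auto simp: D_def fh intro: differentiable_diff differentiable_mult)
    fix y assume y: "y \<in> S"
    show "Z1 (\<lambda>y. f y - h y) y = Z1 f y - Z1 h y" "Z2 (\<lambda>y. f y - h y) y = Z2 f y - Z2 h y"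
      "Z1 (\<lambda>y. f y * h y) y = f y * Z1 h y + Z1 f y * h y" "Z2 (\<lambda>y. f y * h y) y = f y * Z2 h y + Z2 f y * h y"
      by (simp_all add: Z1_def Z2_def differential_diff differential_mult fh[OF y] algebra_simps)
    assume eq: "\<forall>y\<in>S. f y = h y"
    have "differential f y v = differential h y v" if "v \<in> TN y" for v
      using TS[OF y that fh[OF y]] eq by blast
    then show "Z1 f y = Z1 h y" "Z2 f y = Z2 h y"
      using tY[OF y] tvf[OF y, of fr_31] tvf[OF y, of fr_32] by (simp_all add: Z1_def Z2_def)
  qed
  \<comment> \<open>Functions pulled back from the surface do not vary along the Minkowski factor;
    hence \<open>Z1\<close> and \<open>Z2\<close> act on them as \<open>X1\<close> and
    \<open>X2\<close>, see \<open>Zf\<close>.\<close>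
  have base: "differential (\<lambda>y::frame2 \<times> frame3. of_real (f (fst y)) :: 'c) y (vf L y) = 0" if "smooth_on U0 f" "y \<in> S" for f L y
    using fst_der(2)[OF that(1) S(3)[OF that(2)]]
      linear_0[OF linear_differential[OF smooth_on_differentiable[OF that(1) S(6)[OF that(2)]]]]
    by (simp add: vf_def)
  have dkvf: "differential k y (vf L y) = 0" if "y \<in> S" for y L
    using base[OF smooth_kf that, of L] dk(2)[OF S(3)[OF that]] fst_der(2)[OF smooth_kf S(3)[OF that]] by simp
  define A where "A = (\<lambda>y::frame2 \<times> frame3. of_real (kf (fst y) * F (fst y)) :: 'c)"
  define B where "B = (\<lambda>y::frame2 \<times> frame3. of_real (kf (fst y) * H (fst y)) :: 'c)"
  have dkY: "differential k y (Y1 y) = 2 * A y * k y" "differential k y (Y2 y) = 2 * B y * k y" if "y \<in> S" for y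
    using differentials(1)[OF S(4)[OF that] forms_X(1)[OF S(4)[OF that]]]
      differentials(1)[OF S(4)[OF that] forms_X(5)[OF S(4)[OF that]]] forms_X[OF S(4)[OF that]]
    unfolding dk(2)[OF S(3)[OF that]]
    by (simp_all add: Y1_def Y2_def A_def B_def k_def power2_eq_square)
  \<comment> \<open>The pair (e1, e2) is (1, 0) for \<alpha>1 and (0, 1) for \<alpha>2. As constants
    they drop out when differentiated, so both forms can be treated at once.\<close>
  have normal_values: "\<exists>e1 e2. (e1 = 0 \<or> e1 = 1) \<and> (\<forall>z\<in>S. \<alpha> z (vf fr_31 z) = e1 \<and> \<alpha> z (vf fr_32 z) = e2 \<and>
      \<alpha> z (Y1 z) = e2 * k z \<and> \<alpha> z (Y2 z) = - e1 * k z)" if \<alpha>: "\<alpha> \<in> ?\<A>" for \<alpha>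
  proof -
    consider "\<alpha> = \<alpha>1" | "\<alpha> = \<alpha>2" using \<alpha> by blast
    then show ?thesis
    proof cases
      case 1
      show ?thesis
        by (rule exI[of _ 1], rule exI[of _ 0]) (use nf' \<alpha>Y[OF _ \<alpha>] 1 in auto)
    next
      case 2
      show ?thesis
        by (rule exI[of _ 0], rule exI[of _ 1]) (use nf' \<alpha>Y[OF _ \<alpha>] 2 in auto)
    qed
  qed
  have vals: "\<alpha>1 y (Y1 y) = 0" "\<alpha>2 y (Y1 y) = k y" "\<alpha>1 y (Y2 y) = - k y" "\<alpha>2 y (Y2 y) = 0" if "y \<in> S" for y
    using \<alpha>Y(1,2)[OF that, of \<alpha>1] \<alpha>Y(1,2)[OF that, of \<alpha>2] nf'[OF that] by simp_all
  have vf_neg: "\<alpha> y (vf (\<lambda>s. - L s) y) = - \<alpha> y (vf L y)" "\<alpha> y (vf (\<lambda>s. 0) y) = 0"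
    if "y \<in> S" "\<alpha> \<in> ?\<A>" for y \<alpha> L
  proof -
    note l = lin[OF S(2)[OF that(1)] that(2)]
    have "vf (\<lambda>s. - L s) y = - vf L y" "vf (\<lambda>s. 0) y = 0" by (simp_all add: vf_def zero_prod_def)
    then show "\<alpha> y (vf (\<lambda>s. - L s) y) = - \<alpha> y (vf L y)" "\<alpha> y (vf (\<lambda>s. 0) y) = 0"
      using linear_neg[OF l] linear_0[OF l] by simp_all
  qed
  \<comment> \<open>As both \<alpha>'s vanish on the fields Z, the Frobenius condition gives
    \<open>d \<alpha>\<close>(Z, L) = \<alpha>1(L) \<open>d \<alpha>\<close>(Z, fr_31) +
    \<alpha>2(L) \<open>d \<alpha>\<close>(Z, fr_32), which no longer contains the unknown 1-forms.
    The third equation is \<open>d \<alpha>\<close>(Z1, Z2) = 0.\<close>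
  have eqs: "Z1 (\<lambda>z. \<alpha> z (vf L z)) y = \<alpha> y (vf (\<lambda>s. L (fr_e1 s) - fr_e1 (L s)) y)
        - k y * \<alpha> y (vf (\<lambda>s. L (fr_32 s) - fr_32 (L s)) y)
        + \<alpha>1 y (vf L y) * \<alpha> y (vf fr_e3 y) - k y * \<alpha>1 y (vf L y) * \<alpha> y (vf fr_12 y)" (is ?e1)
      "Z2 (\<lambda>z. \<alpha> z (vf L z)) y = \<alpha> y (vf (\<lambda>s. L (fr_e2 s) - fr_e2 (L s)) y)
        + k y * \<alpha> y (vf (\<lambda>s. L (fr_31 s) - fr_31 (L s)) y)
        + \<alpha>2 y (vf L y) * \<alpha> y (vf fr_e3 y) - k y * \<alpha>2 y (vf L y) * \<alpha> y (vf fr_12 y)" (is ?e2)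
      "- \<alpha> y (vf fr_31 y) * (2 * A y * k y) - \<alpha> y (vf fr_32 y) * (2 * B y * k y)
        + 2 * k y * \<alpha> y (vf fr_e3 y) - 2 * k y * k y * \<alpha> y (vf fr_12 y) = 0" (is ?e3)
    if y: "y \<in> S" and \<alpha>: "\<alpha> \<in> ?\<A>" and L: "L \<in> {fr_e1, fr_e2, fr_e3, fr_12}" for y \<alpha> L
  proof -
    \<comment> \<open>A separate constant for - e1 lets \<open>dek\<close> differentiate both
      multiples of \<open>k\<close> by the same rule.\<close>
    obtain e1 e2 e3 where e3: "e3 = - e1" and e: "\<And>z. z \<in> S \<Longrightarrow> \<alpha> z (vf fr_31 z) = e1" "\<And>z. z \<in> S \<Longrightarrow> \<alpha> z (vf fr_32 z) = e2"
      "\<And>z. z \<in> S \<Longrightarrow> \<alpha> z (Y1 z) = e2 * k z" "\<And>z. z \<in> S \<Longrightarrow> \<alpha> z (Y2 z) = e3 * k z"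
      using normal_values[OF \<alpha>] by blast
    have L': "L \<in> fr_fields" using L by blast
    have six: "fr_31 \<in> fr_fields" "fr_32 \<in> fr_fields"
      by blast+
    obtain \<beta>1 \<beta>2 where fr: "\<And>v w. v \<in> TN y \<Longrightarrow> w \<in> TN y \<Longrightarrow> ext_d \<alpha> y v w =
        \<beta>1 v * \<alpha>1 y w - \<beta>1 w * \<alpha>1 y v + (\<beta>2 v * \<alpha>2 y w - \<beta>2 w * \<alpha>2 y v)"
      using frob[OF y[unfolded S_def] \<alpha>] unfolding wedge_def by blast
    note yW = S(3)[OF y]
    note dY = differentiable_Y[OF yW] and dL = differentiable_vf[OF lfr[OF L']]
      and d31 = differentiable_vf[OF lfr[OF six(1)]] and d32 = differentiable_vf[OF lfr[OF six(2)]]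
    note tL = tvf[OF y L'] and t31 = tvf[OF y six(1)] and t32 = tvf[OF y six(2)] and tY' = tY[OF y]
    have dek: "(\<lambda>z. e * k z) differentiable (at y)" "differential (\<lambda>z. e * k z) y v = e * differential k y v" for e v
      using dk(1)[OF yW] by (simp_all add: differentiable_mult differential_mult)
    note br = lie_bracket_vf lie_bracket_Y_vf[OF yW] lfr[OF L'] lfr[OF six(1)] lfr[OF six(2)]
    note nm = vf_neg[OF y \<alpha>] fr_commutators
    let ?f = "\<lambda>z. \<alpha> z (vf L z)"
    note df = dfield[OF y \<alpha> dL]
    have Y1L: "ext_d \<alpha> y (Y1 y) (vf L y) = differential ?f y (Y1 y) - \<alpha> y (vf (\<lambda>s. L (fr_e1 s) - fr_e1 (L s)) y)"
      using ext[OF y \<alpha> dY(1) tY'(1) dL tL dek(1) e(3) df refl] by (simp add: dek dkvf[OF y] br)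
    have Y2L: "ext_d \<alpha> y (Y2 y) (vf L y) = differential ?f y (Y2 y) - \<alpha> y (vf (\<lambda>s. L (fr_e2 s) - fr_e2 (L s)) y)"
      using ext[OF y \<alpha> dY(2) tY'(2) dL tL dek(1) e(4) df refl] by (simp add: dek dkvf[OF y] br)
    have Y131: "ext_d \<alpha> y (Y1 y) (vf fr_31 y) = \<alpha> y (vf fr_e3 y)"
      using ext[OF y \<alpha> dY(1) tY'(1) d31 t31 dek(1) e(3) differentiable_const e(1)] by (simp add: dek dkvf[OF y] br nm)
    have Y132: "ext_d \<alpha> y (Y1 y) (vf fr_32 y) = 0"
      using ext[OF y \<alpha> dY(1) tY'(1) d32 t32 dek(1) e(3) differentiable_const e(2)] by (simp add: dek dkvf[OF y] br nm)
    have Y231: "ext_d \<alpha> y (Y2 y) (vf fr_31 y) = 0"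
      using ext[OF y \<alpha> dY(2) tY'(2) d31 t31 dek(1) e(4) differentiable_const e(1)] by (simp add: dek dkvf[OF y] br nm)
    have Y232: "ext_d \<alpha> y (Y2 y) (vf fr_32 y) = \<alpha> y (vf fr_e3 y)"
      using ext[OF y \<alpha> dY(2) tY'(2) d32 t32 dek(1) e(4) differentiable_const e(2)] by (simp add: dek dkvf[OF y] br nm)
    have L31: "ext_d \<alpha> y (vf fr_31 y) (vf L y) = differential ?f y (vf fr_31 y) - \<alpha> y (vf (\<lambda>s. L (fr_31 s) - fr_31 (L s)) y)"
      using ext[OF y \<alpha> d31 t31 dL tL differentiable_const e(1) df refl] by (simp add: br)
    have L32: "ext_d \<alpha> y (vf fr_32 y) (vf L y) = differential ?f y (vf fr_32 y) - \<alpha> y (vf (\<lambda>s. L (fr_32 s) - fr_32 (L s)) y)"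
      using ext[OF y \<alpha> d32 t32 dL tL differentiable_const e(2) df refl] by (simp add: br)
    have l3132: "ext_d \<alpha> y (vf fr_31 y) (vf fr_32 y) = - \<alpha> y (vf fr_12 y)"
      using ext[OF y \<alpha> d31 t31 d32 t32 differentiable_const e(1) differentiable_const e(2)] by (simp add: br nm)
    have Y12: "ext_d \<alpha> y (Y1 y) (Y2 y) = - e1 * (2 * A y * k y) - e2 * (2 * B y * k y) - \<alpha> y (vf fr_12 y) * (k y * k y)"
      using ext[OF y \<alpha> dY(1) tY'(1) dY(2) tY'(2) dek(1) e(3) dek(1) e(4)]
      unfolding dek dkY[OF y] \<alpha>Y(3)[OF y \<alpha>] k2[OF y] e3 by simp
    note v = vals[OF y] and n = nf'[OF y]
    \<comment> \<open>The same values of \<open>d \<alpha>\<close>, now from the Frobenius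
      condition. After insertion of the normalised values the equations are linear in the values of
      \<beta>1 and \<beta>2, which are eliminated.\<close>
    note F = fr[OF tY'(1) tL] fr[OF tY'(2) tL] fr[OF tY'(1) t31] fr[OF tY'(1) t32] fr[OF tY'(2) t31] fr[OF tY'(2) t32]
      fr[OF t31 tL] fr[OF t32 tL] fr[OF t31 t32] fr[OF tY'(1) tY'(2)]
    note F' = F[unfolded v n[THEN conjunct1] n[THEN conjunct2, THEN conjunct1]
        n[THEN conjunct2, THEN conjunct2, THEN conjunct1] n[THEN conjunct2, THEN conjunct2, THEN conjunct2]
        Y1L Y2L Y131 Y132 Y231 Y232 L31 L32 l3132 Y12]
    show ?e1
      unfolding Z1_def using F'(1,3,4,8,9) by algebra
    show ?e2
      unfolding Z2_def using F'(2,5,6,7,9) by algebra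
    show ?e3
      unfolding e(1,2)[OF y] using F'(3,6,9,10) by algebra
  qed
  have pS: "p \<in> S" using p U(2) by (simp add: S_def)
  have memD: "(\<lambda>z. \<alpha> z (vf L z)) \<in> D" if "\<alpha> \<in> ?\<A>" "L \<in> {fr_e1, fr_e2, fr_e3, fr_12}" for \<alpha> L
    unfolding D_def using that dfield[OF _ that(1) differentiable_vf[OF lfr]] by blast
  have Zf: "Z1 (\<lambda>y. of_real (f (fst y))) y = of_real (differential f (fst y) (X1 (fst y)))"
    "Z2 (\<lambda>y. of_real (f (fst y))) y = of_real (differential f (fst y) (X2 (fst y)))"
    if "smooth_on U0 f" "y \<in> S" for f y
    using base[OF that] fst_der(2)[OF that(1) S(3)[OF that(2)]]
    by (simp_all add: Z1_def Z2_def Y1_def Y2_def)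
  have smA: "smooth_on U0 (\<lambda>x. kf x * F x)" and smB: "smooth_on U0 (\<lambda>x. kf x * H x)"
    by (intro smooth_on_mult open_U0 smooth_kf smooth_F smooth_H)+
  define A11 where "A11 = (\<lambda>y::frame2 \<times> frame3. of_real (kf (fst y) * F1 (fst y) + 2 * kf (fst y) ^ 2 * F (fst y) * F (fst y)) :: 'c)"
  define A12 where "A12 = (\<lambda>y::frame2 \<times> frame3. of_real (kf (fst y) * F2 (fst y) + 2 * kf (fst y) ^ 2 * F (fst y) * H (fst y)) :: 'c)"
  define A22 where "A22 = (\<lambda>y::frame2 \<times> frame3. of_real (kf (fst y) * H2 (fst y) + 2 * kf (fst y) ^ 2 * H (fst y) * H (fst y)) :: 'c)"
  \<comment> \<open>By this symmetry a single \<open>A12\<close> serves as \<open>Z2 A\<close> and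
    as \<open>Z1 B\<close>, as the algebraic lemma requires.\<close>
  have F2H1: "H1 x = F2 x" if "x \<in> M" for x
    using q12_eq_q21[OF that] by (simp add: F2_def H1_def)
  have dAB: "Z1 A y = A11 y" "Z2 A y = A12 y" "Z1 B y = A12 y" "Z2 B y = A22 y" if y: "y \<in> S" for y
  proof -
    note M = S(4)[OF y] and D = smooth_on_differentiable[OF _ S(6)[OF y]]
    note d = differential_mult[OF D[OF smooth_kf] D[OF smooth_F]] differential_mult[OF D[OF smooth_kf] D[OF smooth_H]]
      differentials[OF M forms_X(1)[OF M]] differentials[OF M forms_X(5)[OF M]] forms_X[OF M] F2H1[OF M]
    show "Z1 A y = A11 y" "Z2 A y = A12 y" "Z1 B y = A12 y" "Z2 B y = A22 y"
      unfolding A_def B_def A11_def A12_def A22_def Zf[OF smA y] Zf[OF smB y] d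
      by (simp_all add: algebra_simps)
  qed
  have D': "A \<in> D" "B \<in> D" "k \<in> D"
    using fst_der(1)[OF smA] fst_der(1)[OF smB] dk(1) S(3) by (auto simp: D_def A_def B_def)
  define a0 where "a0 = (\<lambda>z. \<alpha>1 z (vf fr_e3 z))"
  define a1 where "a1 = (\<lambda>z. \<alpha>1 z (vf fr_e1 z))"
  define a2 where "a2 = (\<lambda>z. \<alpha>1 z (vf fr_e2 z))"
  define a3 where "a3 = (\<lambda>z. \<alpha>1 z (vf fr_12 z))"
  define b0 where "b0 = (\<lambda>z. \<alpha>2 z (vf fr_e3 z))"
  define b1 where "b1 = (\<lambda>z. \<alpha>2 z (vf fr_e1 z))"
  define b2 where "b2 = (\<lambda>z. \<alpha>2 z (vf fr_e2 z))"
  define b3 where "b3 = (\<lambda>z. \<alpha>2 z (vf fr_12 z))"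
  note ab = a0_def a1_def a2_def a3_def b0_def b1_def b2_def b3_def
  have abD: "a0 \<in> D" "a1 \<in> D" "a2 \<in> D" "a3 \<in> D" "b0 \<in> D" "b1 \<in> D" "b2 \<in> D" "b3 \<in> D"
    unfolding ab by (rule memD; simp)+
  have m: "\<alpha>1 \<in> ?\<A>" "\<alpha>2 \<in> ?\<A>"
    "fr_e1 \<in> {fr_e1, fr_e2, fr_e3, fr_12}" "fr_e2 \<in> {fr_e1, fr_e2, fr_e3, fr_12}"
    "fr_e3 \<in> {fr_e1, fr_e2, fr_e3, fr_12}" "fr_12 \<in> {fr_e1, fr_e2, fr_e3, fr_12}" by blast+
  have AB: "A y = a0 y - k y * a3 y" "B y = b0 y - k y * b3 y" if y: "y \<in> S" for y
  proof -
    have "2 * k y * (a0 y - k y * a3 y - A y) = 0" "2 * k y * (b0 y - k y * b3 y - B y) = 0"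
      using eqs(3)[OF y m(1,3)] eqs(3)[OF y m(2,3)] nf'[OF y] by (simp_all add: ab algebra_simps)
    then show "A y = a0 y - k y * a3 y" "B y = b0 y - k y * b3 y" using k0[OF y] by auto
  qed
  have Zab: "Z1 a0 y = A y * a0 y + k y * a2 y" "Z1 a1 y = A y * a1 y"
      "Z1 a2 y = A y * a2 y - k y * a0 y" "Z1 a3 y = A y * a3 y - k y - a2 y"
      "Z1 b0 y = B y * a0 y + k y * b2 y" "Z1 b1 y = B y * a1 y"
      "Z1 b2 y = B y * a2 y - k y * b0 y" "Z1 b3 y = B y * a3 y - b2 y"
      "Z2 a0 y = A y * b0 y + k y * a1 y" "Z2 a1 y = A y * b1 y + k y * a0 y"
      "Z2 a2 y = A y * b2 y" "Z2 a3 y = A y * b3 y - a1 y"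
      "Z2 b0 y = B y * b0 y + k y * b1 y" "Z2 b1 y = B y * b1 y + k y * b0 y"
      "Z2 b2 y = B y * b2 y" "Z2 b3 y = B y * b3 y + k y - b1 y" if y: "y \<in> S" for y
    unfolding AB[OF y]
    using eqs(1,2)[OF y m(1,5)] eqs(1,2)[OF y m(1,3)] eqs(1,2)[OF y m(1,4)] eqs(1,2)[OF y m(1,6)]
      eqs(1,2)[OF y m(2,5)] eqs(1,2)[OF y m(2,3)] eqs(1,2)[OF y m(2,4)] eqs(1,2)[OF y m(2,6)]
    by (simp_all add: ab fr_commutators vf_neg[OF y] nf'[OF y] algebra_simps)
  have dkZ: "Z1 k y = 2 * A y * k y" "Z2 k y = 2 * B y * k y" if "y \<in> S" for y
    using dkY[OF that] dkvf[OF that] by (simp_all add: Z1_def Z2_def)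
  let ?x = "fst p"
  note final = Frobenius_equations_imp_second_derivatives[OF Zd abD D' k0 AB dkZ dAB Zab pS]
  note pM = S(4)[OF pS] and r = rf_powers(2,3)[OF S(6)[OF pS]]
  \<comment> \<open>The sign of the curvature comes in here, through \<kappa>^2 = -
    \<epsilon>.\<close>
  have kk: "(k p)\<^sup>2 = of_real (- (\<epsilon> * kf ?x ^ 2))"
    using k2[OF pS] unfolding r(2) power2_eq_square[of "k p"] by simp
  have "of_real (kf ?x * F1 ?x + 2 * kf ?x ^ 2 * F ?x * F ?x) =
      (of_real (3 * (kf ?x * F ?x)\<^sup>2 + - (\<epsilon> * kf ?x ^ 2)) :: 'c)"
    using final(1) unfolding kk A11_def A_def by simp
  then have "kf ?x * F1 ?x = kf ?x * (kf ?x * F ?x ^ 2 - \<epsilon> * kf ?x)"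
    unfolding of_real_eq_iff by (simp add: power2_eq_square algebra_simps)
  then have F1: "F1 ?x = kf ?x * F ?x ^ 2 - \<epsilon> * kf ?x" using r(1) by simp
  have "of_real (kf ?x * F2 ?x + 2 * kf ?x ^ 2 * F ?x * H ?x) =
      (of_real (3 * (kf ?x * F ?x) * (kf ?x * H ?x)) :: 'c)"
    using final(2) unfolding A12_def A_def B_def by simp
  then have "kf ?x * F2 ?x = kf ?x * (kf ?x * F ?x * H ?x)"
    unfolding of_real_eq_iff by (simp add: power2_eq_square algebra_simps)
  then have F2: "F2 ?x = kf ?x * F ?x * H ?x" using r(1) by simp
  have "of_real (kf ?x * H2 ?x + 2 * kf ?x ^ 2 * H ?x * H ?x) =
      (of_real (3 * (kf ?x * H ?x)\<^sup>2 - - (\<epsilon> * kf ?x ^ 2)) :: 'c)"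
    using final(3) unfolding kk A22_def B_def by simp
  then have "kf ?x * H2 ?x = kf ?x * (kf ?x * H ?x ^ 2 + \<epsilon> * kf ?x)"
    unfolding of_real_eq_iff by (simp add: power2_eq_square algebra_simps)
  then have "H2 ?x = kf ?x * H ?x ^ 2 + \<epsilon> * kf ?x" using r(1) by simp
  then show ?thesis using F1 F2 F2H1[OF pM] by (simp add: rescaled_condition_def)
qed

end

section \<open>From single charts to the surface\<close>

lemma FR_nonempty: "\<exists>s. s \<in> FR"
proof -
  have "mink (axis 1 1) (axis 1 1) = 1" "mink (axis 2 1) (axis 2 1) = -1" "mink (axis 3 1) (axis 3 1) = -1"
    "mink (axis 1 1) (axis 2 1) = 0" "mink (axis 1 1) (axis 3 1) = 0" "mink (axis 2 1) (axis 3 1) = 0"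
    by (simp_all add: mink_def axis_def)
  then have "(0, axis 1 1, axis 2 1, axis 3 1) \<in> FR" by (simp add: FR_def)
  then show ?thesis by blast
qed

text \<open>All data except \<kappa> are real, so conjugation only replaces \<i> by -\<i>, and the
  conjugate system is another instance of the same family.\<close>

lemma conj_singular_system:
  "conj_system (singular_system g \<eta>12 K c \<i>) = singular_system g \<eta>12 K c (- \<i>)"
  by (simp add: conj_system_def singular_system_def embedding_system_def Let_def)

theorem theorem9:
  fixes X :: "'m topology"
    and A :: "'m chart set"
    and g :: "'m metric"
    and \<eta>12 :: "'m chart \<Rightarrow> (frame2, real) form1"
    and K q :: "'m \<Rightarrow> real"
    and q1 q2 q11 q12 q21 q22 :: "'m chart \<Rightarrow> frame2 \<Rightarrow> real"
    and \<epsilon> :: real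
  assumes "smooth_surface X A"
    and "Lorentzian_metric A g"
    and "connection_form A g \<eta>12"
    and "Gauss_curvature A g \<eta>12 K"
    and "((\<forall>x\<in>topspace X. K x > 0) \<and> \<epsilon> = 1) \<or> ((\<forall>x\<in>topspace X. K x < 0) \<and> \<epsilon> = -1)"
    and "q = (\<lambda>x. \<bar>K x\<bar> powr (-3/4))"
    and "covariant_derivatives A g \<eta>12 q q1 q2 q11 q12 q21 q22"
  shows "Darboux_integrable A g \<eta>12 K \<longleftrightarrow>
    (\<forall>c\<in>A. \<forall>p\<in>FM g c.
       q11 c p = - q22 c p \<and>
       - q22 c p = 3 * \<epsilon> * pullback_FM q c p powr (-1/3) \<and>
       q12 c p = 0 \<and> q21 c p = 0)"
proof -
  have top: "topspace X = (\<Union>c\<in>A. fst c)" and op: "\<And>c. c \<in> A \<Longrightarrow> open (chart_image c)"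
    using assms(1) unfolding smooth_surface_def by blast+
  have inv: "chart_inv c x \<in> topspace X" if "c \<in> A" "x \<in> chart_image c" for c x
    using that inv_into_into[of x "snd c" "fst c"] unfolding top chart_inv_def chart_image_def by blast
  have \<epsilon>K: "\<epsilon> = 1 \<or> \<epsilon> = -1" "\<And>x. x \<in> topspace X \<Longrightarrow> \<epsilon> * K x > 0"
    using assms(5) by auto
  have chart: "curved_chart g c \<eta>12 K \<epsilon> (q1 c) (q2 c) (q11 c) (q12 c) (q21 c) (q22 c)" if c: "c \<in> A" for c
  proof
    show "open (chart_image c)" by (rule op[OF c])
    show "bilinear (g c x)" "g c x u v = g c x v u" if "x \<in> chart_image c" for x u v
      using assms(2) c that unfolding Lorentzian_metric_def by blast+
    show "smooth_on (chart_image c) (\<lambda>x. g c x u v)" for u v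
      using assms(2) c unfolding Lorentzian_metric_def by blast
    show "smooth_form (FM_ambient c) (\<eta>12 c)"
      using assms(3) c unfolding connection_form_def by blast
    show "ext_d (eta1 g c) p v w = - wedge (\<eta>12 c) (eta2 g c) p v w"
      "ext_d (eta2 g c) p v w = - wedge (\<eta>12 c) (eta1 g c) p v w"
      if "p \<in> FM g c" "v \<in> tangent_space (FM g c) p" "w \<in> tangent_space (FM g c) p" for p v w
      using assms(3) c that unfolding connection_form_def by blast+
    show "smooth_on (chart_image c) (\<lambda>x. K (chart_inv c x))"
      using assms(4) c unfolding Gauss_curvature_def by blast
    show "ext_d (\<eta>12 c) p v w = - pullback_FM K c p * wedge (eta1 g c) (eta2 g c) p v w"
      if "p \<in> FM g c" "v \<in> tangent_space (FM g c) p" "w \<in> tangent_space (FM g c) p" for p v w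
      using assms(4) c that unfolding Gauss_curvature_def by blast
    show "\<epsilon> = 1 \<or> \<epsilon> = -1" by (rule \<epsilon>K(1))
    show "0 < \<epsilon> * K (chart_inv c x)" if "x \<in> chart_image c" for x
      by (rule \<epsilon>K(2)[OF inv[OF c that]])
    note cov = bspec[OF assms(7)[unfolded covariant_derivatives_def] c]
    show "smooth_on (FM_ambient c) (q1 c)" "smooth_on (FM_ambient c) (q2 c)" "smooth_on (FM_ambient c) (q11 c)"
      "smooth_on (FM_ambient c) (q12 c)" "smooth_on (FM_ambient c) (q21 c)" "smooth_on (FM_ambient c) (q22 c)"
      using cov[THEN conjunct1] by simp_all
    show "differential (pullback_FM (\<lambda>x. \<bar>K x\<bar> powr (-3/4)) c) p v = q1 c p * eta1 g c p v + q2 c p * eta2 g c p v"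
      "differential (q1 c) p v = q2 c p * \<eta>12 c p v + q11 c p * eta1 g c p v + q12 c p * eta2 g c p v"
      "differential (q2 c) p v = q1 c p * \<eta>12 c p v + q21 c p * eta1 g c p v + q22 c p * eta2 g c p v"
      if "p \<in> FM g c" "v \<in> tangent_space (FM g c) p" for p v
      using bspec[OF bspec[OF cov[THEN conjunct2] that(1)] that(2)] unfolding assms(6) by simp_all
  qed
  let ?cond = "\<lambda>c p. q11 c p = - q22 c p \<and> - q22 c p = 3 * \<epsilon> * pullback_FM q c p powr (-1/3) \<and>
       q12 c p = 0 \<and> q21 c p = 0"
  \<comment> \<open>The field of values is left open: the reals serve for \<kappa> = 1 and -1, the
    complex numbers for \<i> and -\<i>.\<close>
  have suff: "contains_transverse_Frobenius (FM g c \<times> FR) (embedding_system g \<eta>12 c) (singular_system g \<eta>12 K c \<kappa>) p"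
    if c: "c \<in> A" and p: "p \<in> FM g c \<times> FR" and cond: "\<forall>p\<in>FM g c. ?cond c p" and \<kappa>: "\<kappa> * \<kappa> = - of_real \<epsilon>"
    for c p and \<kappa> :: "'c::real_normed_field"
  proof -
    interpret curved_chart g c \<eta>12 K \<epsilon> "q1 c" "q2 c" "q11 c" "q12 c" "q21 c" "q22 c" by (rule chart[OF c])
    have "pullback_FM q c = qf" by (simp only: qf_def assms(6))
    then show ?thesis
      using contains_transverse_Frobenius_if_condition[OF _ \<kappa> p] condition_iff cond by metis
  qed
  \<comment> \<open>One singular system at one point over \<open>p\<close> is enough for the
    condition at \<open>p\<close>.\<close>
  have nec: "?cond c p"
    if c: "c \<in> A" and p: "p \<in> FM g c" "s \<in> FR" and \<kappa>: "\<kappa> * \<kappa> = - of_real \<epsilon>"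
      and con: "contains_transverse_Frobenius (FM g c \<times> FR) (embedding_system g \<eta>12 c) (singular_system g \<eta>12 K c \<kappa>) (p, s)"
    for c p s and \<kappa> :: "'c::real_normed_field"
  proof -
    interpret curved_chart g c \<eta>12 K \<epsilon> "q1 c" "q2 c" "q11 c" "q12 c" "q21 c" "q22 c" by (rule chart[OF c])
    have "pullback_FM q c = qf" by (simp only: qf_def assms(6))
    moreover have "(p, s) \<in> FM g c \<times> FR" using p by simp
    ultimately show ?thesis
      using condition_if_contains_transverse_Frobenius[OF con \<kappa>] condition_iff[OF p(1)] by simp
  qed
  \<comment> \<open>A frame of Minkowski space completes a frame of the surface to a point of the
    product, where Darboux integrability can be used.\<close>
  obtain s where s: "s \<in> FR" using FR_nonempty by blast
  show ?thesis
  proof (intro iffI ballI)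
    fix c p assume D: "Darboux_integrable A g \<eta>12 K" and c: "c \<in> A" and p: "p \<in> FM g c"
    have x: "chart_inv c (fst p) \<in> topspace X"
      using inv[OF c] p by (auto simp: FM_def)
    from D consider "\<forall>x\<in>topspace X. K x < 0" "Darboux_hyperbolic A g \<eta>12 K"
      | "\<forall>x\<in>topspace X. K x > 0" "Darboux_elliptic A g \<eta>12 K"
      unfolding Darboux_integrable_def top by blast
    then show "?cond c p"
    proof cases
      case 1
      \<comment> \<open>The base point of \<open>p\<close> shows that the surface is not empty, so
        the case of Darboux integrability that holds has to match the sign \<epsilon>.\<close>
      have "\<epsilon> = -1" using \<epsilon>K(1) \<epsilon>K(2)[OF x] 1(1) x by force
      then have "(1::real) * 1 = - of_real \<epsilon>" by simp
      moreover have "contains_transverse_Frobenius (FM g c \<times> FR) (embedding_system g \<eta>12 c)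
          (singular_system g \<eta>12 K c (1::real)) (p, s)"
        using 1(2) c p s unfolding Darboux_hyperbolic_def by blast
      ultimately show ?thesis by (rule nec[OF c p s])
    next
      case 2
      have "\<epsilon> = 1" using \<epsilon>K(1) \<epsilon>K(2)[OF x] 2(1) x by force
      then have "\<i> * \<i> = - of_real \<epsilon>" by simp
      moreover have "contains_transverse_Frobenius (FM g c \<times> FR) (embedding_system g \<eta>12 c)
          (singular_system g \<eta>12 K c \<i>) (p, s)"
        using 2(2) c p s unfolding Darboux_elliptic_def by blast
      ultimately show ?thesis by (rule nec[OF c p s])
    qed
  next
    assume cond: "\<forall>c\<in>A. \<forall>p\<in>FM g c. ?cond c p"
    from assms(5) show "Darboux_integrable A g \<eta>12 K"
    proof
      assume e: "(\<forall>x\<in>topspace X. K x > 0) \<and> \<epsilon> = 1"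
      have "Darboux_elliptic A g \<eta>12 K"
        unfolding Darboux_elliptic_def conj_singular_system using cond e
        by (auto intro!: suff)
      then show ?thesis using e unfolding Darboux_integrable_def top by blast
    next
      assume e: "(\<forall>x\<in>topspace X. K x < 0) \<and> \<epsilon> = -1"
      have "Darboux_hyperbolic A g \<eta>12 K"
        unfolding Darboux_hyperbolic_def using cond e by (auto intro!: suff)
      then show ?thesis using e unfolding Darboux_integrable_def top by blast
    qed
  qed
qed

end
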